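(* For every $x\in\mathbb{C}$, $$\mathbb{D}_{p_n}(x)=\frac{1-e^{-|x|^2}}{\pi|x|^2}+\frac1\pi\int_0^1 e^{-(s-s\log s)|x|^2}\,ds+o(1)\qquad\text{as } n\to\infty,$$ where at $x=0$ the quotient $\frac{1-e^{-|x|^2}}{|x|^2}$ is understood as its limiting value $1$.
   Context: Let $a_0,a_1,a_2,\dots$ be i.i.d. complex random variables with density $\frac1\pi e^{-|z|^2}$ with respect to Lebesgue measure on $\mathbb{C}$. For a positive integer $n$, the Gaussian $SU(2)$ random polynomial is $p_n(z)=\sum_{j=0}^n a_j\sqrt{\binom nj}\,z^j$, $z\in\mathbb{C}$. The empirical measure of the critical values of $p_n$ is $\mathcal{C}_{p_n}=\sum_{z\in\mathbb{C}:\,p_n'(z)=0}\delta_{p_n(z)}$, a measure on $\mathbb{C}\cong\mathbb{R}^2$. The expected density $\mathbb{D}_{p_n}$ is the (continuous) function on $\mathbb{C}$ such that for every smooth compactly supported $\phi$ on $\mathbb{R}^2\cong\mathbb{C}$, $$\mathbb{E}\sum_{z:\,p_n'(z)=0}\phi(p_n(z))=\int_{\mathbb{C}}\phi(x)\,\mathbb{D}_{p_n}(x)\,d\ell_x,$$ where $d\ell_x$ is Lebesgue measure on $\mathbb{C}$. The integrand uses the convention $s\log s=0$ at $s=0$. *)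

theory Defs
  imports "HOL-Probability.Probability" "HOL-Computational_Algebra.Polynomial"
    "HOL-Library.Landau_Symbols"
begin

primrec Ck :: "nat \<Rightarrow> ('a::real_normed_vector \<Rightarrow> 'b::real_normed_vector) \<Rightarrow> bool" where
  "Ck 0 f \<longleftrightarrow> continuous_on UNIV f"
| "Ck (Suc k) f \<longleftrightarrow>
     (\<forall>x. f differentiable (at x)) \<and> (\<forall>v. Ck k (\<lambda>x. frechet_derivative f (at x) v))"

text \<open>Differentiability on the complex plane is over the reals here.\<close>

definition test_function :: "(complex \<Rightarrow> real) \<Rightarrow> bool" where
  "test_function \<phi> \<longleftrightarrow> (\<forall>k. Ck k \<phi>) \<and> compact (closure {x. \<phi> x \<noteq> 0})"

definition SU2_poly :: "(nat \<Rightarrow> 'a \<Rightarrow> complex) \<Rightarrow> nat \<Rightarrow> 'a \<Rightarrow> complex poly" where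
  "SU2_poly a n \<omega> = (\<Sum>j\<le>n. monom (a j \<omega> * of_real (sqrt (real (n choose j)))) j)"

text \<open>The sum ranges over the set of critical points, without multiplicity. It is 0 by convention
  when this set is infinite, that is, when the polynomial is constant; for the Gaussian
  polynomials of positive degree bound this happens with probability 0.\<close>

definition is_expected_density ::
    "'a measure \<Rightarrow> ('a \<Rightarrow> complex poly) \<Rightarrow> (complex \<Rightarrow> real) \<Rightarrow> bool" where
  "is_expected_density M p D \<longleftrightarrow>
     continuous_on UNIV D \<and>
     (\<forall>\<phi>. test_function \<phi> \<longrightarrow>
        (\<integral>\<omega>. (\<Sum>z | poly (pderiv (p \<omega>)) z = 0. \<phi> (poly (p \<omega>) z)) \<partial>M)
          = (\<integral>x. \<phi> x * D x \<partial>lborel))"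

definition expected_density :: "'a measure \<Rightarrow> ('a \<Rightarrow> complex poly) \<Rightarrow> complex \<Rightarrow> real" where
  "expected_density M p = (THE D. is_expected_density M p D)"

end

theory Submission
  imports Defs "HOL-Complex_Analysis.Complex_Analysis" "HOL-Real_Asymp.Real_Asymp"
begin

text \<open>
  Write \<open>p = a\<^sub>0 + w \<surd>n z + q(z)\<close> with \<open>w = a\<^sub>1\<close>. A point \<open>z\<close> is critical iff
  \<open>w = - q'(z) / \<surd>n\<close>, so the area formula for the polynomial map \<open>- q' / \<surd>n\<close> turns the
  integral over \<open>w\<close> of the sum over critical points into an integral over \<open>z\<close>; a shift in
  \<open>a\<^sub>0\<close> then exhibits the density at \<open>x\<close> as the integral over \<open>z\<close> of
  \<open>E [\<gamma>(x + z q' - q) \<gamma>(q' / \<surd>n) |q''|\<^sup>2 / n]\<close>, where \<open>\<gamma>\<close> is the Gaussian density.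
  Such an expectation is an explicit function of the covariances of \<open>(p, p', p'')\<close> at \<open>z\<close>,
  because integrating out one Gaussian coefficient only changes the parameters of the weight.
  With \<open>t = |z|\<^sup>2\<close> this gives, for \<open>n \<ge> 4\<close>, the exact density
  \<open>1/\<pi> \<integral>\<^sub>0\<^sup>\<infinity> exp (- |x|\<^sup>2 (1 + n t) / (1 + t)\<^sup>n)
     (n (n-1)\<^sup>2 t\<^sup>2 |x|\<^sup>2 / (1 + t)\<^bsup>2n+2\<^esup> + 2 (n-1) / (1 + t)\<^bsup>n+2\<^esup>) dt\<close>.
  Rescaling \<open>t = \<tau> / n\<close>, dominated convergence, one integration by parts and
  \<open>s = exp (- \<tau>)\<close> give the limit.
\<close>

text \<open>No general Kac-Rice theorem is invoked. Once the other coefficients are fixed, the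
  critical points form the fibre over \<open>w\<close> of one deterministic polynomial, and outside
  finitely many \<open>w\<close> they are all simple, so counting without multiplicity costs
  nothing. What results is nevertheless the Kac-Rice integrand: the joint density of (p(z), p'(z))
  at (x, 0) times the conditional mean of |p''(z)|^2. Regression parameters, updated by one Gaussian
  coefficient at a time, take the place of inverting a 3 x 3 covariance matrix. The formal
  definition creates two further obligations. The integral of a non-measurable function is 0 by
  default, so the sum over critical points has to be shown measurable. The density is a definite
  description, so continuous densities must be shown unique, which requires smooth compactly
  supported bumps. Only large n matters for the limit; n \<ge> 4 keeps the natural exponent n - 4 in
  the covariances a genuine difference.\<close>

section \<open>Gaussian integrals over the complex plane\<close>

text \<open>Polar coordinates with the angle already integrated out. A disc of squared radius r has
  area pi r, so both measures agree on the rays \<open>{..<r}\<close>, an intersection-stable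
  generator of the Borel sets.\<close>

lemma distr_norm_sq_lborel:
  "distr lborel borel (\<lambda>z::complex. (norm z)\<^sup>2)
     = density lborel (\<lambda>t::real. ennreal pi * indicator {0..} t)" (is "?L = ?R")
proof (rule measure_eqI_generator_eq[where E = "range lessThan" and \<Omega> = UNIV and A = "\<lambda>i::nat. {..<real i}"])
  show "Int_stable (range (lessThan :: real \<Rightarrow> _))"
  proof (unfold Int_stable_def, safe)
    fix a b :: real
    have "{..<a} \<inter> {..<b} = {..<min a b}" by auto
    then show "{..<a} \<inter> {..<b} \<in> range lessThan" by simp
  qed
  have em: "emeasure ?L {..<r} = ennreal pi * emeasure lborel {0..<r}" for r :: real
  proof -
    have "emeasure ?L {..<r} = emeasure lborel {z::complex. (norm z)\<^sup>2 < r}"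
      by (subst emeasure_distr) (auto intro!: arg_cong[where f = "emeasure lborel"])
    also have "{z::complex. (norm z)\<^sup>2 < r} = ball 0 (sqrt r)"
      by (auto simp: real_less_rsqrt) (metis abs_norm_cancel real_less_lsqrt real_sqrt_abs real_sqrt_less_iff)
    also have "emeasure lborel \<dots> = ennreal pi * emeasure lborel {0..<r}"
    proof (cases "r \<ge> 0")
      case True
      then show ?thesis
        by (simp add: emeasure_ball unit_ball_vol_2 ennreal_mult)
    next
      case False
      then show ?thesis by (simp add: ball_empty)
    qed
    finally show ?thesis .
  qed
  have em2: "emeasure ?R {..<r} = ennreal pi * emeasure lborel {0..<r}" for r :: real
  proof -
    have "emeasure ?R {..<r} = (\<integral>\<^sup>+ t. ennreal pi * indicator {0..<r} t \<partial>lborel)"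
      by (subst emeasure_density) (auto intro!: nn_integral_cong split: split_indicator)
    then show ?thesis by (simp add: nn_integral_cmult_indicator)
  qed
  show "emeasure ?L X = emeasure ?R X" if "X \<in> range lessThan" for X
    using that by (auto simp: em em2 simp del: emeasure_lborel_Ico)
  show "sets ?L = sigma_sets UNIV (range lessThan)" "sets ?R = sigma_sets UNIV (range lessThan)"
    by (simp_all add: borel_Iio)
  show "range (\<lambda>i::nat. {..<real i}) \<subseteq> range lessThan" by auto
  show "(\<Union>i::nat. {..<real i}) = UNIV" by (auto simp: reals_Archimedean2)
  show "emeasure ?L {..<real i} \<noteq> \<infinity>" for i :: nat
    by (simp add: em ennreal_mult_eq_top_iff del: emeasure_distr)
qed auto

lemma nn_integral_norm_sq:
  fixes f :: "real \<Rightarrow> ennreal"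
  assumes [measurable]: "f \<in> borel_measurable borel"
  shows "(\<integral>\<^sup>+(z::complex). f ((norm z)\<^sup>2) \<partial>lborel) = ennreal pi * (\<integral>\<^sup>+t. f t * indicator {0..} t \<partial>lborel)"
proof -
  have "(\<integral>\<^sup>+(z::complex). f ((norm z)\<^sup>2) \<partial>lborel)
      = (\<integral>\<^sup>+t. f t \<partial>distr lborel borel (\<lambda>z::complex. (norm z)\<^sup>2))"
    by (subst nn_integral_distr) auto
  also have "\<dots> = (\<integral>\<^sup>+t. ennreal pi * (f t * indicator {0..} t) \<partial>lborel)"
    by (subst distr_norm_sq_lborel, subst nn_integral_density) (auto intro!: nn_integral_cong simp: mult_ac)
  finally show ?thesis by (simp add: nn_integral_cmult)
qed

lemma nn_integral_lborel_shift:
  fixes f :: "'a::euclidean_space \<Rightarrow> ennreal"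
  assumes [measurable]: "f \<in> borel_measurable borel"
  shows "(\<integral>\<^sup>+z. f (a + z) \<partial>lborel) = (\<integral>\<^sup>+z. f z \<partial>lborel)"
  by (subst (2) lborel_distr_plus[of a, symmetric], subst nn_integral_distr) auto

lemma nn_integral_lborel_uminus:
  fixes f :: "'a::euclidean_space \<Rightarrow> ennreal"
  assumes [measurable]: "f \<in> borel_measurable borel"
  shows "(\<integral>\<^sup>+z. f (- z) \<partial>lborel) = (\<integral>\<^sup>+z. f z \<partial>lborel)"
proof -
  have "(lborel :: 'a measure) = distr lborel borel uminus"
    using lborel_affine[of "-1" "0::'a"] by (simp add: density_1)
  then have "(\<integral>\<^sup>+z. f z \<partial>lborel) = (\<integral>\<^sup>+z. f z \<partial>distr lborel borel (uminus :: 'a \<Rightarrow> 'a))"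
    by simp
  also have "\<dots> = (\<integral>\<^sup>+z. f (- z) \<partial>lborel)"
    by (subst nn_integral_distr) auto
  finally show ?thesis by simp
qed

lemma nn_integral_exp_norm_sq:
  assumes "A > 0"
  shows "(\<integral>\<^sup>+(z::complex). ennreal (exp (- A * (norm z)\<^sup>2)) \<partial>lborel) = ennreal (pi / A)"
proof -
  have "(\<integral>\<^sup>+t. ennreal (exp (- A * t)) * indicator {0..} t \<partial>lborel) = ennreal (0 - (- (exp (- A * 0) / A)))"
  proof (rule nn_integral_FTC_atLeast)
    show "((\<lambda>t. - (exp (- A * t) / A)) \<longlongrightarrow> 0) at_top"
      using assms by real_asymp
    show "((\<lambda>t. - (exp (- A * t) / A)) has_real_derivative exp (- A * x)) (at x)" for x
      using assms by (auto intro!: derivative_eq_intros)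
  qed auto
  with nn_integral_norm_sq[of "\<lambda>t. ennreal (exp (- A * t))"] show ?thesis
    using assms by (simp add: ennreal_mult[symmetric])
qed

lemma nn_integral_norm_sq_exp_norm_sq:
  assumes "A > 0"
  shows "(\<integral>\<^sup>+(z::complex). ennreal ((norm z)\<^sup>2 * exp (- A * (norm z)\<^sup>2)) \<partial>lborel) = ennreal (pi / A\<^sup>2)"
proof -
  have "(\<integral>\<^sup>+t. ennreal (t * exp (- A * t)) * indicator {0..} t \<partial>lborel)
      = ennreal (0 - (- ((0 / A + 1 / A\<^sup>2) * exp (- A * 0))))"
  proof (rule nn_integral_FTC_atLeast)
    show "((\<lambda>t. - ((t / A + 1 / A\<^sup>2) * exp (- A * t))) \<longlongrightarrow> 0) at_top"
      using assms by real_asymp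
    show "((\<lambda>t. - ((t / A + 1 / A\<^sup>2) * exp (- A * t))) has_real_derivative x * exp (- A * x)) (at x)" for x
      using assms by (auto intro!: derivative_eq_intros simp: field_simps power2_eq_square)
  qed auto
  with nn_integral_norm_sq[of "\<lambda>t. ennreal (t * exp (- A * t))"] show ?thesis
    using assms by (simp add: ennreal_mult[symmetric])
qed

text \<open>Recovers an integral from its symmetrised form, the sum of the integral and its
  reflected copy.\<close>

lemma ennreal_eq_if_double_eq:
  fixes x :: ennreal
  assumes "x + x = ennreal (2 * y)" "y \<ge> 0"
  shows "x = ennreal y"
proof (cases x)
  case (real r)
  with assms show ?thesis by (simp add: ennreal_plus[symmetric] del: ennreal_plus)
qed (use assms in simp)

text \<open>The cross term of the square changes sign, so it cannot be integrated separately as an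
  extended nonnegative function. Adding the integral at -z removes it pointwise by the parallelogram
  law.\<close>

lemma nn_integral_centred_gaussian_quadratic:
  fixes \<alpha> \<beta> :: complex
  assumes "A > 0" "c \<ge> 0"
  shows "(\<integral>\<^sup>+(z::complex). ennreal (exp (- A * (norm z)\<^sup>2) * ((norm (\<alpha> + \<beta> * z))\<^sup>2 + c)) \<partial>lborel)
       = ennreal (pi / A * ((norm \<alpha>)\<^sup>2 + (norm \<beta>)\<^sup>2 / A + c))" (is "?I = _")
proof (rule ennreal_eq_if_double_eq)
  have "?I + ?I = ?I + (\<integral>\<^sup>+(z::complex). ennreal (exp (- A * (norm (-z))\<^sup>2) * ((norm (\<alpha> + \<beta> * (-z)))\<^sup>2 + c)) \<partial>lborel)"
    by (subst nn_integral_lborel_uminus) auto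
  also have "\<dots> = (\<integral>\<^sup>+(z::complex). ennreal (exp (- A * (norm z)\<^sup>2) * ((norm (\<alpha> + \<beta> * z))\<^sup>2 + c)
      + exp (- A * (norm (-z))\<^sup>2) * ((norm (\<alpha> + \<beta> * (-z)))\<^sup>2 + c)) \<partial>lborel)"
    using assms by (subst nn_integral_add[symmetric]) (auto intro!: nn_integral_cong simp: ennreal_plus)
  also have "\<dots> = (\<integral>\<^sup>+(z::complex). ennreal (2 * ((norm \<alpha>)\<^sup>2 + c)) * ennreal (exp (- A * (norm z)\<^sup>2))
      + ennreal (2 * (norm \<beta>)\<^sup>2) * ennreal ((norm z)\<^sup>2 * exp (- A * (norm z)\<^sup>2)) \<partial>lborel)"
  proof (intro nn_integral_cong)
    fix z :: complex
    have "(norm (\<alpha> + \<beta> * z))\<^sup>2 + (norm (\<alpha> + \<beta> * (-z)))\<^sup>2 = 2 * (norm \<alpha>)\<^sup>2 + 2 * ((norm \<beta>)\<^sup>2 * (norm z)\<^sup>2)"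
      unfolding cmod_power2 by (simp add: power2_eq_square algebra_simps)
    then have "exp (- A * (norm z)\<^sup>2) * ((norm (\<alpha> + \<beta> * z))\<^sup>2 + (norm (\<alpha> + \<beta> * (-z)))\<^sup>2 + 2 * c)
      = exp (- A * (norm z)\<^sup>2) * (2 * (norm \<alpha>)\<^sup>2 + 2 * ((norm \<beta>)\<^sup>2 * (norm z)\<^sup>2) + 2 * c)"
      by (simp only:)
    then have "exp (- A * (norm z)\<^sup>2) * ((norm (\<alpha> + \<beta> * z))\<^sup>2 + c)
      + exp (- A * (norm (-z))\<^sup>2) * ((norm (\<alpha> + \<beta> * (-z)))\<^sup>2 + c)
      = 2 * ((norm \<alpha>)\<^sup>2 + c) * exp (- A * (norm z)\<^sup>2) + 2 * (norm \<beta>)\<^sup>2 * ((norm z)\<^sup>2 * exp (- A * (norm z)\<^sup>2))"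
      by (simp add: algebra_simps)
    then show "ennreal (exp (- A * (norm z)\<^sup>2) * ((norm (\<alpha> + \<beta> * z))\<^sup>2 + c)
      + exp (- A * (norm (-z))\<^sup>2) * ((norm (\<alpha> + \<beta> * (-z)))\<^sup>2 + c)) =
      ennreal (2 * ((norm \<alpha>)\<^sup>2 + c)) * ennreal (exp (- A * (norm z)\<^sup>2))
      + ennreal (2 * (norm \<beta>)\<^sup>2) * ennreal ((norm z)\<^sup>2 * exp (- A * (norm z)\<^sup>2))"
      using assms by (simp add: ennreal_mult[symmetric] ennreal_plus[symmetric] del: ennreal_plus)
  qed
  also have "\<dots> = ennreal (2 * ((norm \<alpha>)\<^sup>2 + c)) * ennreal (pi / A) + ennreal (2 * (norm \<beta>)\<^sup>2) * ennreal (pi / A\<^sup>2)"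
    using nn_integral_exp_norm_sq[OF assms(1)] nn_integral_norm_sq_exp_norm_sq[OF assms(1)]
    by (simp add: nn_integral_add nn_integral_cmult)
  also have "\<dots> = ennreal (2 * (pi / A * ((norm \<alpha>)\<^sup>2 + (norm \<beta>)\<^sup>2 / A + c)))"
    using assms by (simp add: ennreal_mult[symmetric] ennreal_plus[symmetric] field_simps power2_eq_square del: ennreal_plus)
  finally show "?I + ?I = ennreal (2 * (pi / A * ((norm \<alpha>)\<^sup>2 + (norm \<beta>)\<^sup>2 / A + c)))" .
qed (use assms in auto)

text \<open>Completing the square: the translation by B / A removes the linear term and produces the
  factor exp(|B|^2 / A).\<close>

lemma nn_integral_gaussian_quadratic:
  fixes \<alpha> \<beta> B :: complex
  assumes "A > 0" "c \<ge> 0"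
  shows "(\<integral>\<^sup>+(z::complex). ennreal (exp (- A * (norm z)\<^sup>2 + 2 * Re (cnj z * B)) * ((norm (\<alpha> + \<beta> * z))\<^sup>2 + c)) \<partial>lborel)
       = ennreal (pi / A * exp ((norm B)\<^sup>2 / A) * ((norm (\<alpha> + \<beta> * B / A))\<^sup>2 + (norm \<beta>)\<^sup>2 / A + c))"
proof -
  have sq: "- A * (norm (B / A + z))\<^sup>2 + 2 * Re (cnj (B / A + z) * B) = - A * (norm z)\<^sup>2 + (norm B)\<^sup>2 / A" for z
    using assms unfolding cmod_power2 by (simp add: power2_eq_square field_simps)
  have "(\<integral>\<^sup>+(z::complex). ennreal (exp (- A * (norm z)\<^sup>2 + 2 * Re (cnj z * B)) * ((norm (\<alpha> + \<beta> * z))\<^sup>2 + c)) \<partial>lborel)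
     = (\<integral>\<^sup>+(z::complex). ennreal (exp (- A * (norm (B / A + z))\<^sup>2 + 2 * Re (cnj (B / A + z) * B)) * ((norm (\<alpha> + \<beta> * (B / A + z)))\<^sup>2 + c)) \<partial>lborel)"
    by (subst nn_integral_lborel_shift) auto
  also have "\<dots> = (\<integral>\<^sup>+(z::complex). ennreal (exp ((norm B)\<^sup>2 / A)) *
      ennreal (exp (- A * (norm z)\<^sup>2) * ((norm ((\<alpha> + \<beta> * B / A) + \<beta> * z))\<^sup>2 + c)) \<partial>lborel)"
  proof (intro nn_integral_cong)
    fix z
    have "\<alpha> + \<beta> * (B / A + z) = (\<alpha> + \<beta> * B / A) + \<beta> * z" by (simp add: algebra_simps)
    then show "ennreal (exp (- A * (norm (B / A + z))\<^sup>2 + 2 * Re (cnj (B / A + z) * B)) * ((norm (\<alpha> + \<beta> * (B / A + z)))\<^sup>2 + c))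
      = ennreal (exp ((norm B)\<^sup>2 / A)) *
        ennreal (exp (- A * (norm z)\<^sup>2) * ((norm ((\<alpha> + \<beta> * B / A) + \<beta> * z))\<^sup>2 + c))"
      unfolding sq by (subst ennreal_mult'[symmetric]) (simp_all only: exp_add exp_ge_zero mult_ac)
  qed
  also have "\<dots> = ennreal (exp ((norm B)\<^sup>2 / A)) * ennreal (pi / A * ((norm (\<alpha> + \<beta> * B / A))\<^sup>2 + (norm \<beta>)\<^sup>2 / A + c))"
    by (subst nn_integral_cmult, simp, subst nn_integral_centred_gaussian_quadratic[OF assms]) simp
  finally show ?thesis using assms by (simp add: ennreal_mult[symmetric] mult_ac)
qed

section \<open>Gaussian weights of triples\<close>

text \<open>For jointly Gaussian (Y, V, W) this is the density of (Y, V) at (x, y) times the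
  conditional mean of |w + W|^2 given Y = x and V = y. Here V has variance r, Y - k V has variance
  s, and the conditional law of W has mean l y + t (x - k y) and variance c.\<close>

definition gauss_weight :: "real \<Rightarrow> complex \<Rightarrow> real \<Rightarrow> complex \<Rightarrow> complex \<Rightarrow> real
    \<Rightarrow> complex \<Rightarrow> complex \<Rightarrow> complex \<Rightarrow> real" where
  "gauss_weight r k s l t c x y w =
     exp (- (norm y)\<^sup>2 / r - (norm (x - k * y))\<^sup>2 / s) *
     ((norm (w + l * y + t * (x - k * y)))\<^sup>2 + c) / (pi\<^sup>2 * r * s)"

text \<open>Coefficient comparison for the exponent after one Gaussian variable has been integrated
  out: Y and X stand for the squared moduli of y and x - k y, and m for their cross term. All
  coefficients share the denominator E = r s A = r' s', the determinant of the updated covariance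
  matrix of (Y, V).\<close>

lemma gauss_weight_exponent:
  fixes r s Q \<Delta> X Y m :: real
  assumes "r > 0" "s > 0" "Q \<ge> 0" "\<Delta> \<ge> 0"
    and A: "A = 1 + Q / r + \<Delta> / s" and r': "r' = r + Q" and s': "s' = s + r * \<Delta> / (r + Q)"
  shows "Y / r + X / s - (Q * Y / r\<^sup>2 + \<Delta> * X / s\<^sup>2 + 2 * m / (r * s)) / A
     = Y / r' + (X - 2 * m / r' + \<Delta> * Q * Y / r'\<^sup>2) / s'"
proof -
  define E where "E = r * s + Q * s + \<Delta> * r"
  have E: "E > 0" unfolding E_def using assms by (simp add: add_pos_nonneg)
  have r'0: "r' > 0" using assms by auto
  have A': "A = E / (r * s)" using assms unfolding E_def A by (simp add: field_simps)
  have s'': "s' = E / r'" using assms r'0 unfolding E_def s' r' by (simp add: field_simps)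
  have a1: "1 / r - Q / (r\<^sup>2 * A) = (s + \<Delta>) / E"
    using assms(1,2) E unfolding A' by (simp add: field_simps power2_eq_square) (simp add: E_def algebra_simps)
  have a2: "1 / s - \<Delta> / (s\<^sup>2 * A) = r' / E"
    using assms(1,2) E unfolding A' r' by (simp add: field_simps power2_eq_square) (simp add: E_def algebra_simps)
  have a3: "1 / r' + \<Delta> * Q / (r'\<^sup>2 * s') = (s + \<Delta>) / E"
    using r'0 E unfolding s'' by (simp add: field_simps power2_eq_square) (simp add: E_def r' algebra_simps)
  have "Y / r + X / s - (Q * Y / r\<^sup>2 + \<Delta> * X / s\<^sup>2 + 2 * m / (r * s)) / A
    = Y * (1 / r - Q / (r\<^sup>2 * A)) + X * (1 / s - \<Delta> / (s\<^sup>2 * A)) - 2 * m / (r * s * A)"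
    by (simp add: algebra_simps add_divide_distrib)
  also have "\<dots> = Y * ((s + \<Delta>) / E) + X * (r' / E) - 2 * m / E"
    unfolding a1 a2 using assms(1,2) by (simp add: A')
  also have "\<dots> = Y * (1 / r' + \<Delta> * Q / (r'\<^sup>2 * s')) + X / s' - 2 * m / (r' * s')"
    unfolding a3 using r'0 by (simp add: s'')
  also have "\<dots> = Y / r' + (X - 2 * m / r' + \<Delta> * Q * Y / r'\<^sup>2) / s'"
    by (simp add: algebra_simps add_divide_distrib diff_divide_distrib)
  finally show ?thesis .
qed

text \<open>A complex Gaussian triple \<open>(Y, V, W)\<close> is encoded by regression: \<open>V\<close> has variance \<open>r\<close>,
  \<open>Y - k V\<close> is independent of \<open>V\<close> with variance \<open>s\<close>, and \<open>W - l V - t (Y - k V)\<close>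
  is independent of both with variance \<open>c\<close>.\<close>

definition gram_eq :: "real \<Rightarrow> complex \<Rightarrow> real \<Rightarrow> complex \<Rightarrow> complex \<Rightarrow> real
    \<Rightarrow> complex \<Rightarrow> complex \<Rightarrow> complex \<Rightarrow> complex \<Rightarrow> complex \<Rightarrow> complex \<Rightarrow> bool" where
  "gram_eq r k s l t c gvv gyv gyy gwv gwy gww \<longleftrightarrow>
     r > 0 \<and> s > 0 \<and> c \<ge> 0 \<and> of_real r = gvv \<and> k * of_real r = gyv \<and> of_real s + k * cnj k * of_real r = gyy \<and>
     l * of_real r = gwv \<and> l * of_real r * cnj k + t * of_real s = gwy \<and>
     of_real c + l * cnj l * of_real r + t * cnj t * of_real s = gww"

text \<open>Adding b (d, q, e) with b an independent standard Gaussian keeps a triple Gaussian and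
  adds a rank-one matrix to its Gram matrix. Integrating over b is the corresponding convolution, so
  the weight keeps its shape and its new parameters are the regression parameters of the new Gram
  matrix.\<close>

lemma gauss_weight_update:
  assumes g: "gram_eq r k s l t c gvv gyv gyy gwv gwy gww"
  shows "\<exists>r' k' s' l' t' c'.
     gram_eq r' k' s' l' t' c' (gvv + q * cnj q) (gyv + d * cnj q) (gyy + d * cnj d)
       (gwv + e * cnj q) (gwy + e * cnj d) (gww + e * cnj e) \<and>
     (\<forall>x y w. (\<integral>\<^sup>+b. ennreal (exp (- (norm b)\<^sup>2) / pi) *
          ennreal (gauss_weight r k s l t c (x - b * d) (y - b * q) (w + b * e)) \<partial>lborel)
        = ennreal (gauss_weight r' k' s' l' t' c' x y w))"
proof -
  have rs: "r > 0" "s > 0" "c \<ge> 0" using g by (auto simp: gram_eq_def)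
  define Q where "Q = (norm q)\<^sup>2"
  \<comment> \<open>\<open>\<delta>\<close> is the increment of the residual Y - k V, and
    \<open>\<epsilon>\<close> below is the increment of the residual of W. \<open>A\<close> is the
    coefficient of |b|^2 in the combined Gaussian exponent.\<close>
  define \<delta> where "\<delta> = d - k * q"
  define \<Delta> where "\<Delta> = (norm \<delta>)\<^sup>2"
  define A where "A = 1 + Q / r + \<Delta> / s"
  define \<epsilon> where "\<epsilon> = e - l * q - t * \<delta>"
  \<comment> \<open>These witnesses come from the rank-one (recursive least squares) update of a
    regression: each old parameter is corrected by the matching residual increment.\<close>
  define r' where "r' = r + Q"
  define s' where "s' = s + r * \<Delta> / (r + Q)"
  define k' where "k' = k + \<delta> * cnj q / of_real r'"
  define l' where "l' = l + (\<epsilon> + t * \<delta>) * cnj q / of_real r'"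
  define t' where "t' = t + \<epsilon> * cnj \<delta> / of_real (s * A)"
  define c' where "c' = c + (norm \<epsilon>)\<^sup>2 / A"
  have Q0: "Q \<ge> 0" "\<Delta> \<ge> 0" by (auto simp: Q_def \<Delta>_def)
  have A0: "A > 0" using rs Q0 by (simp add: A_def add_pos_nonneg)
  have r'0: "r' > 0" using rs Q0 by (simp add: r'_def)
  have s'0: "s' > 0" using rs Q0 by (simp add: s'_def add_pos_nonneg)
  have c'0: "c' \<ge> 0" using rs A0 by (simp add: c'_def)
  have Qc: "of_real Q = q * cnj q" unfolding Q_def by (rule complex_norm_square)
  have Dc: "of_real \<Delta> = \<delta> * cnj \<delta>" unfolding \<Delta>_def by (rule complex_norm_square)
  \<comment> \<open>The matrix determinant lemma for the rank-one update of the covariance of (Y,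
    V).\<close>
  have rsA: "r * s * A = r' * s'"
    using rs Q0 r'0 by (simp add: A_def s'_def r'_def field_simps)
  have Ec: "of_real ((norm \<epsilon>)\<^sup>2) = \<epsilon> * cnj \<epsilon>" by (rule complex_norm_square)
  have d: "d = \<delta> + k * q" and e: "e = \<epsilon> + l * q + t * \<delta>" by (auto simp: \<delta>_def \<epsilon>_def)
  have integral: "(\<integral>\<^sup>+b. ennreal (exp (- (norm b)\<^sup>2) / pi) *
          ennreal (gauss_weight r k s l t c (x - b * d) (y - b * q) (w + b * e)) \<partial>lborel)
        = ennreal (gauss_weight r' k' s' l' t' c' x y w)" for x y w
  proof -
    define \<xi> where "\<xi> = x - k * y"
    define B where "B = cnj q * y / of_real r + cnj \<delta> * \<xi> / of_real s"
    define \<alpha> where "\<alpha> = w + l * y + t * \<xi>"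
    define C where "C = (norm y)\<^sup>2 / r + (norm \<xi>)\<^sup>2 / s"
    have e1: "- (norm b)\<^sup>2 - (norm (y - b * q))\<^sup>2 / r - (norm (\<xi> - b * \<delta>))\<^sup>2 / s
        = (- A * (norm b)\<^sup>2 + 2 * Re (cnj b * B)) - C" for b
      using rs unfolding A_def Q_def \<Delta>_def B_def C_def cmod_power2
      by (simp add: power2_eq_square divide_simps) (simp add: algebra_simps)
    have xi: "x - b * d - k * (y - b * q) = \<xi> - b * \<delta>" for b
      by (simp add: \<xi>_def \<delta>_def algebra_simps)
    have al: "w + b * e + l * (y - b * q) + t * (\<xi> - b * \<delta>) = \<alpha> + \<epsilon> * b" for b
      by (simp add: \<alpha>_def \<epsilon>_def algebra_simps)
    have "(\<integral>\<^sup>+b. ennreal (exp (- (norm b)\<^sup>2) / pi) *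
          ennreal (gauss_weight r k s l t c (x - b * d) (y - b * q) (w + b * e)) \<partial>lborel)
      = (\<integral>\<^sup>+b. ennreal (exp (- C) / (pi ^ 3 * r * s)) *
          ennreal (exp (- A * (norm b)\<^sup>2 + 2 * Re (cnj b * B)) * ((norm (\<alpha> + \<epsilon> * b))\<^sup>2 + c)) \<partial>lborel)"
    proof (intro nn_integral_cong)
      fix b
      have "exp (- (norm b)\<^sup>2) / pi * gauss_weight r k s l t c (x - b * d) (y - b * q) (w + b * e)
        = exp (- (norm b)\<^sup>2 - (norm (y - b * q))\<^sup>2 / r - (norm (\<xi> - b * \<delta>))\<^sup>2 / s)
          * ((norm (\<alpha> + \<epsilon> * b))\<^sup>2 + c) / (pi ^ 3 * r * s)"
        unfolding gauss_weight_def xi al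
        by (simp add: exp_diff exp_minus exp_add field_simps power2_eq_square power3_eq_cube)
      also have "\<dots> = exp (- C) / (pi ^ 3 * r * s) *
          (exp (- A * (norm b)\<^sup>2 + 2 * Re (cnj b * B)) * ((norm (\<alpha> + \<epsilon> * b))\<^sup>2 + c))"
        unfolding e1 exp_diff[of _ C] exp_minus[of C] by (simp add: field_simps)
      finally show "ennreal (exp (- (norm b)\<^sup>2) / pi) *
          ennreal (gauss_weight r k s l t c (x - b * d) (y - b * q) (w + b * e)) = 
         ennreal (exp (- C) / (pi ^ 3 * r * s)) *
          ennreal (exp (- A * (norm b)\<^sup>2 + 2 * Re (cnj b * B)) * ((norm (\<alpha> + \<epsilon> * b))\<^sup>2 + c))"
        using rs by (simp only: ennreal_mult'[symmetric] divide_nonneg_nonneg exp_ge_zero pi_ge_zero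
            zero_le_power mult_nonneg_nonneg less_imp_le)
    qed
    also have "\<dots> = ennreal (exp (- C) / (pi ^ 3 * r * s)) *
       ennreal (pi / A * exp ((norm B)\<^sup>2 / A) * ((norm (\<alpha> + \<epsilon> * B / A))\<^sup>2 + (norm \<epsilon>)\<^sup>2 / A + c))"
      by (subst nn_integral_cmult, simp, subst nn_integral_gaussian_quadratic[OF A0 rs(3)]) (rule refl)
    also have "\<dots> = ennreal (exp (- (C - (norm B)\<^sup>2 / A)) / (pi\<^sup>2 * (r * s * A)) * ((norm (\<alpha> + \<epsilon> * B / A))\<^sup>2 + c'))"
    proof -
      have gen: "u / (pi ^ 3 * r * s) * (pi / A * v * (g + h / A + c)) = v * u / (pi\<^sup>2 * (r * s * A)) * (g + (c + h / A))"
        for u v g h :: real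
        using rs A0 by (simp add: power2_eq_square power3_eq_cube add_ac mult_ac)
      have "exp (- (C - (norm B)\<^sup>2 / A)) = exp ((norm B)\<^sup>2 / A) * exp (- C)"
        by (simp add: exp_add[symmetric])
      then show ?thesis
        unfolding c'_def using rs by (subst ennreal_mult'[symmetric]) (simp_all only: gen, simp)
    qed
    also have "C - (norm B)\<^sup>2 / A = (norm y)\<^sup>2 / r' + (norm (x - k' * y))\<^sup>2 / s'"
    proof -
      define m where "m = Re (cnj q * y * cnj (cnj \<delta> * \<xi>))"
      have B2: "(norm B)\<^sup>2 = Q * (norm y)\<^sup>2 / r\<^sup>2 + \<Delta> * (norm \<xi>)\<^sup>2 / s\<^sup>2 + 2 * m / (r * s)"
        using rs unfolding B_def Q_def \<Delta>_def m_def cmod_power2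
        by (simp add: power2_eq_square divide_simps) (simp add: algebra_simps)
      have "x - k' * y = \<xi> - \<delta> * cnj q * y / of_real r'"
        by (simp add: \<xi>_def k'_def algebra_simps)
      then have X2: "(norm (x - k' * y))\<^sup>2 = (norm \<xi>)\<^sup>2 - 2 * m / r' + \<Delta> * Q * (norm y)\<^sup>2 / r'\<^sup>2"
      proof (elim ssubst)
        show "(norm (\<xi> - \<delta> * cnj q * y / of_real r'))\<^sup>2
            = (norm \<xi>)\<^sup>2 - 2 * m / r' + \<Delta> * Q * (norm y)\<^sup>2 / r'\<^sup>2"
          using r'0 unfolding Q_def \<Delta>_def m_def cmod_power2
          by (simp add: power2_eq_square divide_simps) (simp add: algebra_simps)
      qed
      show ?thesis unfolding B2 X2 C_def
        by (rule gauss_weight_exponent[OF rs(1,2) Q0 A_def r'_def s'_def])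
    qed
    also have "\<alpha> + \<epsilon> * B / A = w + l' * y + t' * (x - k' * y)"
    proof -
      have nz: "complex_of_real r \<noteq> 0" "complex_of_real s \<noteq> 0" "complex_of_real A \<noteq> 0" "complex_of_real r' \<noteq> 0"
        using rs A0 r'0 by auto
      have AA: "complex_of_real A * r * s = r * s + q * cnj q * s + \<delta> * cnj \<delta> * r"
        using rs by (simp add: A_def Qc[symmetric] Dc[symmetric] field_simps)
      have rr: "complex_of_real r' = r + q * cnj q" by (simp add: r'_def Qc)
      have "l' * y + t' * (x - k' * y) - l * y - t * \<xi>
        = \<epsilon> * cnj q * y / of_real r' - \<epsilon> * cnj \<delta> * \<delta> * cnj q * y / (of_real s * of_real A * of_real r')
          + \<epsilon> * cnj \<delta> * \<xi> / (of_real s * of_real A)"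
        using nz by (simp add: l'_def t'_def k'_def \<xi>_def field_simps)
      also have "\<dots> = \<epsilon> * cnj q * y * (1 / of_real r' - cnj \<delta> * \<delta> / (of_real s * of_real A * of_real r'))
          + \<epsilon> * cnj \<delta> * \<xi> / (of_real s * of_real A)"
        by (simp add: algebra_simps)
      also have "1 / of_real r' - cnj \<delta> * \<delta> / (of_real s * of_real A * of_real r') = 1 / (of_real r * of_real A)"
      proof -
        have "of_real s * of_real A * of_real r - cnj \<delta> * \<delta> * of_real r = complex_of_real s * of_real r'"
          using AA unfolding rr by (simp add: algebra_simps)
        then have "(of_real s * of_real A - cnj \<delta> * \<delta>) * (of_real r * of_real A) = of_real s * of_real A * of_real r'"
          by (simp add: algebra_simps)
        then show ?thesis using nz by (simp add: divide_simps)
      qed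
      also have "\<epsilon> * cnj q * y * (1 / (of_real r * of_real A)) + \<epsilon> * cnj \<delta> * \<xi> / (of_real s * of_real A) = \<epsilon> * B / A"
        using nz by (simp add: B_def field_simps)
      finally have eq: "l' * y + t' * (x - k' * y) - l * y - t * \<xi> = \<epsilon> * B / A" .
      show ?thesis unfolding \<alpha>_def eq[symmetric] by simp
    qed
    also have "ennreal (exp (- ((norm y)\<^sup>2 / r' + (norm (x - k' * y))\<^sup>2 / s')) / (pi\<^sup>2 * (r * s * A)) *
          ((norm (w + l' * y + t' * (x - k' * y)))\<^sup>2 + c'))
        = ennreal (gauss_weight r' k' s' l' t' c' x y w)"
      unfolding gauss_weight_def rsA by (simp add: mult.assoc)
    finally show ?thesis .
  qed
  have "gram_eq r' k' s' l' t' c' (gvv + q * cnj q) (gyv + d * cnj q) (gyy + d * cnj d)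
       (gwv + e * cnj q) (gwy + e * cnj d) (gww + e * cnj e)"
  proof -
    have nz: "complex_of_real r \<noteq> 0" "complex_of_real s \<noteq> 0" "complex_of_real A \<noteq> 0" "complex_of_real r' \<noteq> 0"
        using rs A0 r'0 by auto
    have rr: "complex_of_real r' = r + q * cnj q" by (simp add: r'_def Qc)
    have ss: "complex_of_real s' = s + r * (\<delta> * cnj \<delta>) / r'"
      by (simp add: s'_def r'_def Dc[symmetric])
    have "complex_of_real (r * s * A) = complex_of_real (r' * s')" by (simp only: rsA)
    then have sr: "complex_of_real s' / (s * A) = r / r'"
      using nz by (simp add: divide_simps mult_ac)
    have sr': "complex_of_real s' * r' = s * r' + r * (\<delta> * cnj \<delta>)"
      using nz by (simp add: ss field_simps)
    have kr: "k' * r' = k * r' + \<delta> * cnj q" using nz by (simp add: k'_def field_simps)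
    have lr: "l' * r' = l * r' + (\<epsilon> + t * \<delta>) * cnj q" using nz by (simp add: l'_def field_simps)
    have ckr: "cnj k' * r' = cnj k * r' + cnj \<delta> * q" using nz by (simp add: k'_def field_simps)
    have clr: "cnj l' * r' = cnj l * r' + (cnj \<epsilon> + cnj t * cnj \<delta>) * q" using nz by (simp add: l'_def field_simps)
    have ts: "t' * s' = t * s' + \<epsilon> * cnj \<delta> * r / r'"
    proof -
      have "t' * s' = t * s' + \<epsilon> * cnj \<delta> * (complex_of_real s' / (s * A))"
        by (simp add: t'_def algebra_simps)
      then show ?thesis unfolding sr by simp
    qed
    have tsr: "t' * s' * r' = t * (s * r' + r * (\<delta> * cnj \<delta>)) + \<epsilon> * cnj \<delta> * r"
    proof -
      have "t' * s' * r' = t * (complex_of_real s' * r') + \<epsilon> * cnj \<delta> * r"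
        unfolding ts using nz by (simp add: field_simps)
      then show ?thesis unfolding sr' .
    qed
    have G: "of_real r = gvv" "k * of_real r = gyv" "of_real s + k * cnj k * of_real r = gyy"
      "l * of_real r = gwv" "l * of_real r * cnj k + t * of_real s = gwy"
      "of_real c + l * cnj l * of_real r + t * cnj t * of_real s = gww"
      using g by (auto simp: gram_eq_def)
    have 1: "of_real r' = gvv + q * cnj q" using G rr by simp
    have 2: "k' * of_real r' = gyv + d * cnj q"
      unfolding kr unfolding G(2)[symmetric] d rr by (simp add: algebra_simps)
    have 3: "of_real s' + k' * cnj k' * of_real r' = gyy + d * cnj d"
    proof -
      have "(of_real s' + k' * cnj k' * of_real r') * r' = complex_of_real s' * r' + (k' * r') * (cnj k' * r')"
        by (simp add: algebra_simps)
      also have "\<dots> = (gyy + d * cnj d) * r'"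
        unfolding kr ckr sr' unfolding G(3)[symmetric] d by (simp add: rr algebra_simps)
      finally show ?thesis using nz by simp
    qed
    have 4: "l' * of_real r' = gwv + e * cnj q"
      unfolding lr unfolding G(4)[symmetric] e rr by (simp add: algebra_simps)
    have 5: "l' * of_real r' * cnj k' + t' * of_real s' = gwy + e * cnj d"
    proof -
      have "(l' * of_real r' * cnj k' + t' * of_real s') * r' = (l' * r') * (cnj k' * r') + (t' * s') * r'"
        by (simp add: algebra_simps)
      also have "\<dots> = (gwy + e * cnj d) * r'"
        unfolding lr ckr tsr unfolding G(5)[symmetric] d e by (simp add: rr algebra_simps)
      finally show ?thesis using nz by simp
    qed
    have 6: "of_real c' + l' * cnj l' * of_real r' + t' * cnj t' * of_real s' = gww + e * cnj e"
    proof -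
      have ct: "cnj t' = cnj t + cnj \<epsilon> * \<delta> / (s * A)" by (simp add: t'_def)
      have AA: "complex_of_real A * r * s = r * s + q * cnj q * s + \<delta> * cnj \<delta> * r"
        using rs by (simp add: A_def Qc[symmetric] Dc[symmetric] field_simps)
      have "t' * cnj t' * s' = (t' * s') * cnj t'" by simp
      also have "\<dots> = t * cnj t * s' + t * cnj \<epsilon> * \<delta> * (complex_of_real s' / (s * A)) + \<epsilon> * cnj \<delta> * cnj t * r / r'
           + \<epsilon> * cnj \<delta> * cnj \<epsilon> * \<delta> * r / (r' * (s * A))"
        unfolding ts ct by (simp add: algebra_simps)
      also have "\<dots> = t * cnj t * s' + t * cnj \<epsilon> * \<delta> * r / r' + \<epsilon> * cnj \<delta> * cnj t * r / r'
           + \<epsilon> * cnj \<delta> * cnj \<epsilon> * \<delta> * r / (r' * (s * A))"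
        unfolding sr by simp
      finally have T: "t' * cnj t' * s' = \<dots>" .
      have L: "l' * cnj l' * r' = l * cnj l * r' + l * (cnj \<epsilon> + cnj t * cnj \<delta>) * q + cnj l * (\<epsilon> + t * \<delta>) * cnj q
           + (\<epsilon> + t * \<delta>) * (cnj \<epsilon> + cnj t * cnj \<delta>) * q * cnj q / r'"
      proof -
        have "l' * cnj l' * r' * r' = (l' * r') * (cnj l' * r')" by (simp add: algebra_simps)
        also have "\<dots> = (l * cnj l * r' + l * (cnj \<epsilon> + cnj t * cnj \<delta>) * q + cnj l * (\<epsilon> + t * \<delta>) * cnj q
           + (\<epsilon> + t * \<delta>) * (cnj \<epsilon> + cnj t * cnj \<delta>) * q * cnj q / r') * r'"
          unfolding lr clr using nz by (simp add: field_simps)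
        finally show ?thesis using nz by simp
      qed
      have Cc: "of_real c' = c + \<epsilon> * cnj \<epsilon> / A" unfolding c'_def of_real_add of_real_divide Ec ..
      \<comment> \<open>The terms in |\<epsilon>|^2 from \<open>c'\<close> and from |t'|^2 s'
        combine to r / r'. This eliminates \<open>A\<close>, after which multiplying by r' leaves a
        polynomial identity.\<close>
      have E2: "1 / A + (\<delta> * cnj \<delta>) * r / (r' * (s * A)) = complex_of_real r / r'"
      proof -
        have "complex_of_real r' * s + \<delta> * cnj \<delta> * r = complex_of_real r * (s * A)"
          using AA unfolding rr by (simp add: algebra_simps)
        then show ?thesis using nz by (simp add: divide_simps)
      qed
      have "of_real c' + l' * cnj l' * of_real r' + t' * cnj t' * of_real s'
        = c + \<epsilon> * cnj \<epsilon> * (1 / A + (\<delta> * cnj \<delta>) * r / (r' * (s * A))) + l * cnj l * r'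
           + l * (cnj \<epsilon> + cnj t * cnj \<delta>) * q + cnj l * (\<epsilon> + t * \<delta>) * cnj q
           + (\<epsilon> + t * \<delta>) * (cnj \<epsilon> + cnj t * cnj \<delta>) * q * cnj q / r'
           + t * cnj t * s' + t * cnj \<epsilon> * \<delta> * r / r' + \<epsilon> * cnj \<delta> * cnj t * r / r'"
        unfolding T L Cc by (simp add: algebra_simps)
      also have "\<dots> = gww + e * cnj e"
      proof -
        have "(c + \<epsilon> * cnj \<epsilon> * (complex_of_real r / r') + l * cnj l * r'
           + l * (cnj \<epsilon> + cnj t * cnj \<delta>) * q + cnj l * (\<epsilon> + t * \<delta>) * cnj q
           + (\<epsilon> + t * \<delta>) * (cnj \<epsilon> + cnj t * cnj \<delta>) * q * cnj q / r'
           + t * cnj t * s' + t * cnj \<epsilon> * \<delta> * r / r' + \<epsilon> * cnj \<delta> * cnj t * r / r') * r' = (gww + e * cnj e) * r'"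
          unfolding ss G(6)[symmetric] e using nz by (simp add: field_simps) (simp add: rr algebra_simps)
        then show ?thesis unfolding E2 using nz by simp
      qed
      finally show ?thesis .
    qed
    show ?thesis unfolding gram_eq_def using 1 2 3 4 5 6 r'0 s'0 c'0 by simp
  qed
  with integral show ?thesis by blast
qed

section \<open>The standard complex Gaussian measure and its finite products\<close>

definition std_gauss :: "complex measure" where
  "std_gauss = density lborel (\<lambda>z. ennreal (exp (- (norm z)\<^sup>2) / pi))"

lemma sets_std_gauss [measurable_cong, simp]: "sets std_gauss = sets borel"
  and space_std_gauss [simp]: "space std_gauss = UNIV"
  by (simp_all add: std_gauss_def)

lemma nn_integral_std_gauss:
  assumes [measurable]: "f \<in> borel_measurable borel"
  shows "(\<integral>\<^sup>+z. f z \<partial>std_gauss) = (\<integral>\<^sup>+z. ennreal (exp (- (norm z)\<^sup>2) / pi) * f z \<partial>lborel)"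
  unfolding std_gauss_def by (rule nn_integral_density) auto

lemma prob_space_std_gauss: "prob_space std_gauss"
proof (rule prob_spaceI)
  have "emeasure std_gauss (space std_gauss) = (\<integral>\<^sup>+z. 1 \<partial>std_gauss)" by simp
  also have "\<dots> = (\<integral>\<^sup>+z. ennreal (1 / pi) * ennreal (exp (- 1 * (norm (z::complex))\<^sup>2)) \<partial>lborel)"
    by (subst nn_integral_std_gauss) (auto simp: ennreal_mult'[symmetric] intro!: nn_integral_cong)
  also have "\<dots> = ennreal (1 / pi) * ennreal (pi / 1)"
    by (subst nn_integral_cmult, simp, subst nn_integral_exp_norm_sq) auto
  also have "\<dots> = 1" by (simp add: ennreal_mult'[symmetric])
  finally show "emeasure std_gauss (space std_gauss) = 1" .
qed

interpretation std_gauss: prob_space std_gauss by (rule prob_space_std_gauss)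

interpretation std_gauss_product: product_sigma_finite "\<lambda>_::nat. std_gauss"
  by standard

lemma borel_measurable_gauss_weight [measurable (raw)]:
  assumes [measurable]: "f \<in> borel_measurable M" "g \<in> borel_measurable M" "h \<in> borel_measurable M"
  shows "(\<lambda>a. gauss_weight r k s l t c (f a) (g a) (h a)) \<in> borel_measurable M"
  unfolding gauss_weight_def by measurable

text \<open>Induction on I with one rank-one update per index. The parameters stay existential
  because the intermediate ones have no convenient closed form, whereas Gram entries simply add up
  and determine the parameters at the end.\<close>

lemma gauss_weight_product:
  fixes d q e :: "nat \<Rightarrow> complex"
  assumes "finite I" "gram_eq r k s l t c gvv gyv gyy gwv gwy gww"
  shows "\<exists>r' k' s' l' t' c'.
     gram_eq r' k' s' l' t' c' (gvv + (\<Sum>j\<in>I. q j * cnj (q j))) (gyv + (\<Sum>j\<in>I. d j * cnj (q j)))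
       (gyy + (\<Sum>j\<in>I. d j * cnj (d j))) (gwv + (\<Sum>j\<in>I. e j * cnj (q j)))
       (gwy + (\<Sum>j\<in>I. e j * cnj (d j))) (gww + (\<Sum>j\<in>I. e j * cnj (e j))) \<and>
     (\<forall>x y w. (\<integral>\<^sup>+b. ennreal (gauss_weight r k s l t c (x - (\<Sum>j\<in>I. b j * d j))
          (y - (\<Sum>j\<in>I. b j * q j)) (w + (\<Sum>j\<in>I. b j * e j))) \<partial>Pi\<^sub>M I (\<lambda>_. std_gauss))
        = ennreal (gauss_weight r' k' s' l' t' c' x y w))"
  using assms
proof (induction I rule: finite_induct)
  case empty
  then show ?case
    by (intro exI[of _ r] exI[of _ k] exI[of _ s] exI[of _ l] exI[of _ t] exI[of _ c])
       (simp add: PiM_empty nn_integral_count_space_finite)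
next
  case (insert i I)
  obtain r1 k1 s1 l1 t1 c1 where
    g1: "gram_eq r1 k1 s1 l1 t1 c1 (gvv + (\<Sum>j\<in>I. q j * cnj (q j))) (gyv + (\<Sum>j\<in>I. d j * cnj (q j)))
       (gyy + (\<Sum>j\<in>I. d j * cnj (d j))) (gwv + (\<Sum>j\<in>I. e j * cnj (q j)))
       (gwy + (\<Sum>j\<in>I. e j * cnj (d j))) (gww + (\<Sum>j\<in>I. e j * cnj (e j)))"
    and I1: "\<And>x y w. (\<integral>\<^sup>+b. ennreal (gauss_weight r k s l t c (x - (\<Sum>j\<in>I. b j * d j))
          (y - (\<Sum>j\<in>I. b j * q j)) (w + (\<Sum>j\<in>I. b j * e j))) \<partial>Pi\<^sub>M I (\<lambda>_. std_gauss))
        = ennreal (gauss_weight r1 k1 s1 l1 t1 c1 x y w)"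
    using insert.IH[OF insert.prems] by blast
  from gauss_weight_update[OF g1, of "q i" "d i" "e i"]
  obtain r2 k2 s2 l2 t2 c2 where
    g2: "gram_eq r2 k2 s2 l2 t2 c2 (gvv + (\<Sum>j\<in>I. q j * cnj (q j)) + q i * cnj (q i))
       (gyv + (\<Sum>j\<in>I. d j * cnj (q j)) + d i * cnj (q i)) (gyy + (\<Sum>j\<in>I. d j * cnj (d j)) + d i * cnj (d i))
       (gwv + (\<Sum>j\<in>I. e j * cnj (q j)) + e i * cnj (q i)) (gwy + (\<Sum>j\<in>I. e j * cnj (d j)) + e i * cnj (d i))
       (gww + (\<Sum>j\<in>I. e j * cnj (e j)) + e i * cnj (e i))"
    and I2: "\<And>x y w. (\<integral>\<^sup>+b. ennreal (exp (- (norm b)\<^sup>2) / pi) *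
          ennreal (gauss_weight r1 k1 s1 l1 t1 c1 (x - b * d i) (y - b * q i) (w + b * e i)) \<partial>lborel)
        = ennreal (gauss_weight r2 k2 s2 l2 t2 c2 x y w)"
    by blast
  have "(\<integral>\<^sup>+b. ennreal (gauss_weight r k s l t c (x - (\<Sum>j\<in>insert i I. b j * d j))
          (y - (\<Sum>j\<in>insert i I. b j * q j)) (w + (\<Sum>j\<in>insert i I. b j * e j))) \<partial>Pi\<^sub>M (insert i I) (\<lambda>_. std_gauss))
        = ennreal (gauss_weight r2 k2 s2 l2 t2 c2 x y w)" (is "?L = _") for x y w
  proof -
    have sum: "(\<Sum>j\<in>insert i I. (b(i := u)) j * v j) = u * v i + (\<Sum>j\<in>I. b j * v j)" for b v :: "nat \<Rightarrow> complex" and u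
      using insert.hyps by (simp add: sum.insert) (intro sum.cong, auto)
    have "?L = (\<integral>\<^sup>+u. \<integral>\<^sup>+b. ennreal (gauss_weight r k s l t c (x - (\<Sum>j\<in>insert i I. (b(i := u)) j * d j))
          (y - (\<Sum>j\<in>insert i I. (b(i := u)) j * q j)) (w + (\<Sum>j\<in>insert i I. (b(i := u)) j * e j)))
            \<partial>Pi\<^sub>M I (\<lambda>_. std_gauss) \<partial>std_gauss)"
      by (rule std_gauss_product.product_nn_integral_insert_rev) (use insert.hyps in measurable)
    also have "\<dots> = (\<integral>\<^sup>+u. \<integral>\<^sup>+b. ennreal (gauss_weight r k s l t c ((x - u * d i) - (\<Sum>j\<in>I. b j * d j))
          ((y - u * q i) - (\<Sum>j\<in>I. b j * q j)) ((w + u * e i) + (\<Sum>j\<in>I. b j * e j)))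
            \<partial>Pi\<^sub>M I (\<lambda>_. std_gauss) \<partial>std_gauss)"
      unfolding sum by (simp only: diff_diff_eq add.assoc)
    also have "\<dots> = (\<integral>\<^sup>+u. ennreal (gauss_weight r1 k1 s1 l1 t1 c1 (x - u * d i) (y - u * q i) (w + u * e i)) \<partial>std_gauss)"
      unfolding I1 ..
    also have "\<dots> = ennreal (gauss_weight r2 k2 s2 l2 t2 c2 x y w)"
      by (subst nn_integral_std_gauss) (auto simp: I2)
    finally show ?thesis .
  qed
  moreover have "(\<Sum>j\<in>insert i I. f j) = (\<Sum>j\<in>I. f j) + f i" for f :: "nat \<Rightarrow> complex"
    using insert.hyps by (simp add: add.commute)
  ultimately show ?case using g2 by (simp only: add.assoc) blast
qed

section \<open>Factorial moments of the binomial weights\<close>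

text \<open>The absorption identity j C(n+1, j) = (n+1) C(n, j-1) trades a factor j for a lower row
  and a shift of f. Iterated, it evaluates all falling factorial moments.\<close>

lemma binomial_sum_factor:
  fixes f :: "nat \<Rightarrow> real"
  shows "(\<Sum>j\<le>Suc n. real (Suc n choose j) * (real j * f j) * t ^ j)
       = real (Suc n) * t * (\<Sum>j\<le>n. real (n choose j) * f (Suc j) * t ^ j)"
proof -
  have "(\<Sum>j\<le>Suc n. real (Suc n choose j) * (real j * f j) * t ^ j)
     = (\<Sum>j\<le>n. real (Suc n choose Suc j) * (real (Suc j) * f (Suc j)) * t ^ Suc j)"
    by (subst sum.atMost_Suc_shift) simp
  also have "\<dots> = (\<Sum>j\<le>n. real (Suc n) * t * (real (n choose j) * f (Suc j) * t ^ j))"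
  proof (intro sum.cong refl)
    fix j
    have eq: "real (Suc j) * real (Suc n choose Suc j) = real (Suc n) * real (n choose j)"
      unfolding of_nat_mult[symmetric] by (simp only: Suc_times_binomial)
    have "real (Suc n choose Suc j) * (real (Suc j) * f (Suc j)) * t ^ Suc j
       = (real (Suc j) * real (Suc n choose Suc j)) * (f (Suc j) * t ^ Suc j)"
      by (simp only: mult_ac)
    then show "real (Suc n choose Suc j) * (real (Suc j) * f (Suc j)) * t ^ Suc j
       = real (Suc n) * t * (real (n choose j) * f (Suc j) * t ^ j)"
      unfolding eq by (simp only: power_Suc mult_ac)
  qed
  finally show ?thesis by (simp add: sum_distrib_left)
qed

lemma binomial_sum_0: "(\<Sum>j\<le>n. real (n choose j) * t ^ j) = (1 + t) ^ n"
proof -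
  have "(1 + t) ^ n = (\<Sum>j\<le>n. real (n choose j) * t ^ j * 1 ^ (n - j))"
    unfolding add.commute[of 1 t] by (rule binomial_ring)
  then show ?thesis by simp
qed

lemma binomial_sum_1: "(\<Sum>j\<le>Suc n. real (Suc n choose j) * real j * t ^ j) = real (Suc n) * t * (1 + t) ^ n"
  using binomial_sum_factor[of n "\<lambda>_. 1" t] binomial_sum_0[of n t] by simp

lemma binomial_sum_lin:
  "(\<Sum>j\<le>n. real (n choose j) * (f j + g j) * t ^ j)
     = (\<Sum>j\<le>n. real (n choose j) * f j * t ^ j) + (\<Sum>j\<le>n. real (n choose j) * g j * t ^ j)"
  "(\<Sum>j\<le>n. real (n choose j) * (c * f j) * t ^ j) = c * (\<Sum>j\<le>n. real (n choose j) * f j * t ^ j)"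
  by (simp_all add: algebra_simps sum.distrib sum_distrib_left)

lemma binomial_sum_falling_2:
  "(\<Sum>j\<le>Suc (Suc n). real (Suc (Suc n) choose j) * (real j * (real j - 1)) * t ^ j)
     = real (Suc (Suc n)) * real (Suc n) * t\<^sup>2 * (1 + t) ^ n"
  using binomial_sum_factor[of "Suc n" "\<lambda>j. real j - 1" t] binomial_sum_1[of n t]
  by (simp add: power2_eq_square del: binomial_Suc_Suc sum.atMost_Suc)

lemma binomial_sum_falling_3:
  "(\<Sum>j\<le>Suc (Suc (Suc n)). real (Suc (Suc (Suc n)) choose j) * (real j * ((real j - 1) * (real j - 2))) * t ^ j)
     = real (Suc (Suc (Suc n))) * real (Suc (Suc n)) * real (Suc n) * t ^ 3 * (1 + t) ^ n"
  using binomial_sum_factor[of "Suc (Suc n)" "\<lambda>j. (real j - 1) * (real j - 2)" t] binomial_sum_falling_2[of n t]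
  by (simp add: power2_eq_square power3_eq_cube del: binomial_Suc_Suc sum.atMost_Suc)

lemma binomial_sum_falling_4:
  "(\<Sum>j\<le>Suc (Suc (Suc (Suc n))). real (Suc (Suc (Suc (Suc n))) choose j) *
       (real j * ((real j - 1) * ((real j - 2) * (real j - 3)))) * t ^ j)
     = real (Suc (Suc (Suc (Suc n)))) * real (Suc (Suc (Suc n))) * real (Suc (Suc n)) * real (Suc n) * t ^ 4 * (1 + t) ^ n"
  using binomial_sum_factor[of "Suc (Suc (Suc n))" "\<lambda>j. (real j - 1) * ((real j - 2) * (real j - 3))" t]
    binomial_sum_falling_3[of n t]
  by (simp add: power_numeral_reduce del: binomial_Suc_Suc sum.atMost_Suc)

section \<open>The area formula for complex polynomials\<close>

text \<open>The change-of-variables theorem applied below expresses the Jacobian by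
  \<open>det\<close> and \<open>matrix\<close>, hence on \<open>real^2\<close>. This linear,
  measure-preserving identification carries it to the complex plane.\<close>

definition complex_of_vec :: "real^2 \<Rightarrow> complex" where
  "complex_of_vec v = Complex (v $ 1) (v $ 2)"

definition vec_of_complex :: "complex \<Rightarrow> real^2" where
  "vec_of_complex z = vector [Re z, Im z]"

lemma complex_of_vec_inverse [simp]: "vec_of_complex (complex_of_vec v) = v"
  by (simp add: vec_of_complex_def complex_of_vec_def vec_eq_iff forall_2)

lemma vec_of_complex_inverse [simp]: "complex_of_vec (vec_of_complex z) = z"
  by (simp add: vec_of_complex_def complex_of_vec_def complex_eq_iff)

lemma vec_of_complex_nth [simp]: "vec_of_complex z $ 1 = Re z" "vec_of_complex z $ 2 = Im z"
  by (simp_all add: vec_of_complex_def)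

lemma linear_complex_of_vec: "linear complex_of_vec"
  by (rule linearI) (simp_all add: complex_of_vec_def complex_eq_iff)

lemma linear_vec_of_complex: "linear vec_of_complex"
  by (rule linearI) (simp_all add: vec_eq_iff forall_2)

lemmas bounded_linear_complex_of_vec = linear_conv_bounded_linear[THEN iffD1, OF linear_complex_of_vec]
lemmas bounded_linear_vec_of_complex = linear_conv_bounded_linear[THEN iffD1, OF linear_vec_of_complex]

lemma borel_measurable_complex_of_vec [measurable]: "complex_of_vec \<in> borel_measurable borel"
  by (intro borel_measurable_continuous_onI linear_continuous_on bounded_linear_complex_of_vec)

lemma Basis_vec2: "(Basis :: (real^2) set) = {axis 1 1, axis 2 1}"
  by (auto simp: Basis_vec_def UNIV_2)

lemma lborel_distr_complex_of_vec: "distr lborel borel complex_of_vec = lborel"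
proof (rule lborel_eqI[symmetric])
  fix l u :: complex
  assume lu: "\<And>b. b \<in> Basis \<Longrightarrow> l \<bullet> b \<le> u \<bullet> b"
  have lu': "Re l \<le> Re u" "Im l \<le> Im u" using lu[of 1] lu[of \<i>] by (auto simp: Basis_complex_def)
  have ne: "axis 1 1 \<noteq> (axis 2 1 :: real^2)" by (simp add: axis_eq_axis)
  have "emeasure (distr lborel borel complex_of_vec) (box l u)
      = emeasure lborel (complex_of_vec -` box l u)"
    by (subst emeasure_distr) auto
  also have "complex_of_vec -` box l u = box (vec_of_complex l) (vec_of_complex u)"
    by (auto simp: in_box_complex_iff mem_box_cart forall_2 complex_of_vec_def)
  also have "emeasure lborel \<dots> = (\<Prod>b\<in>Basis. (vec_of_complex u - vec_of_complex l) \<bullet> b)"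
    using lu' by (subst emeasure_lborel_box) (auto simp: Basis_vec2 inner_axis)
  also have "\<dots> = ennreal ((Re u - Re l) * (Im u - Im l))"
    using ne by (simp add: Basis_vec2 inner_axis)
  finally show "emeasure (distr lborel borel complex_of_vec) (box l u) = (\<Prod>b\<in>Basis. (u - l) \<bullet> b)"
    by (simp add: Basis_complex_def)
qed simp

lemma emeasure_lborel_complex_of_vec:
  assumes "X \<in> sets borel"
  shows "emeasure lborel (complex_of_vec -` X) = emeasure lborel X"
proof -
  have "emeasure lborel X = emeasure (distr lborel borel complex_of_vec) X"
    by (simp only: lborel_distr_complex_of_vec)
  also have "\<dots> = emeasure lborel (complex_of_vec -` X)"
    by (subst emeasure_distr) (use assms in auto)
  finally show ?thesis by simp
qed

text \<open>The Cauchy-Riemann form of the Jacobian: the matrix of multiplication by c = a + ib has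
  determinant a^2 + b^2.\<close>

lemma det_complex_mult:
  "det (matrix (\<lambda>h. vec_of_complex (c * complex_of_vec h))) = (norm c)\<^sup>2"
  unfolding cmod_power2
  by (simp add: det_2 matrix_def complex_of_vec_def axis_def power2_eq_square)

text \<open>Change of variables on \<open>real^2\<close> with Jacobian |g'|^2. Boundedness of S and
  continuity of g' make the integral finite, so that it can be turned into the
  \<open>has_integral\<close> form in which that theorem computes the measure of an image.\<close>

lemma emeasure_inj_holomorphic_image:
  fixes g g' :: "complex \<Rightarrow> complex"
  assumes S [measurable]: "S \<in> sets borel" and "bounded S" and inj: "inj_on g S"
    and g: "\<And>z. z \<in> S \<Longrightarrow> (g has_field_derivative g' z) (at z)"
    and g': "continuous_on UNIV g'"
    and gS [measurable]: "g ` S \<in> sets borel"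
  shows "emeasure lborel (g ` S) = (\<integral>\<^sup>+z. ennreal ((norm (g' z))\<^sup>2) * indicator S z \<partial>lborel)"
proof -
  define T where "T = complex_of_vec -` S"
  define G where "G = (\<lambda>v. vec_of_complex (g (complex_of_vec v)))"
  define G' where "G' = (\<lambda>v h. vec_of_complex (g' (complex_of_vec v) * complex_of_vec h))"
  have [measurable]: "g' \<in> borel_measurable borel"
    using g' by (rule borel_measurable_continuous_onI)
  have T [measurable]: "T \<in> sets borel"
    using measurable_sets[OF borel_measurable_complex_of_vec S] by (simp add: T_def)
  define I where "I = (\<integral>\<^sup>+z. ennreal ((norm (g' z))\<^sup>2) * indicator S z \<partial>lborel)"
  have I: "I = (\<integral>\<^sup>+v. ennreal ((norm (g' (complex_of_vec v)))\<^sup>2 * indicator T v) \<partial>lborel)"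
    unfolding I_def by (subst lborel_distr_complex_of_vec[symmetric], subst nn_integral_distr)
      (auto simp: T_def intro!: nn_integral_cong split: split_indicator)
  have "I < \<infinity>"
  proof -
    from \<open>bounded S\<close> obtain R where R: "S \<subseteq> cball 0 R"
      by (metis ball_subset_cball bounded_subset_ballD order_trans)
    have "compact (g' ` cball 0 R)"
      using g' by (intro compact_continuous_image continuous_on_subset[OF g']) auto
    then obtain K where K: "\<And>z. z \<in> cball 0 R \<Longrightarrow> norm (g' z) \<le> K"
      by (metis bounded_iff compact_imp_bounded imageI)
    have "I \<le> (\<integral>\<^sup>+(z::complex). ennreal (K\<^sup>2) * indicator (cball 0 R) z \<partial>lborel)"
      unfolding I_def
    proof (rule nn_integral_mono)
      fix z :: complex
      show "ennreal ((norm (g' z))\<^sup>2) * indicator S z \<le> ennreal (K\<^sup>2) * indicator (cball 0 R) z"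
        using K[of z] R by (auto split: split_indicator intro!: ennreal_leI power_mono)
    qed
    also have "\<dots> < \<infinity>"
      using emeasure_bounded_finite[of "cball (0::complex) R"]
      by (subst nn_integral_cmult_indicator) (auto simp: ennreal_mult_less_top)
    finally show ?thesis .
  qed
  then have Ir: "I = ennreal (enn2real I)" by simp
  have "((\<lambda>v. (norm (g' (complex_of_vec v)))\<^sup>2 * indicator T v) has_integral enn2real I) UNIV"
  proof -
    let ?f = "\<lambda>v. (norm (g' (complex_of_vec v)))\<^sup>2 * indicator T v :: real"
    have "integrable lborel ?f"
      by (rule integrableI_nn_integral_finite[where x = "enn2real I"]) (use I Ir in auto)
    moreover have "integral\<^sup>L lborel ?f = enn2real I"
      using I by (subst integral_eq_nn_integral) auto
    ultimately show ?thesis using has_integral_integral_lborel by metis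
  qed
  moreover have "(\<lambda>v. (norm (g' (complex_of_vec v)))\<^sup>2 * indicator T v)
      = (\<lambda>v. if v \<in> T then \<bar>det (matrix (G' v))\<bar> else 0)"
    by (auto simp: fun_eq_iff G'_def det_complex_mult split: split_indicator)
  ultimately have hi: "((\<lambda>v. \<bar>det (matrix (G' v))\<bar>) has_integral enn2real I) T"
    by (simp add: has_integral_restrict_UNIV)
  have der: "(G has_derivative G' v) (at v within T)" if "v \<in> T" for v
  proof -
    have "(g has_derivative (\<lambda>h. g' (complex_of_vec v) * h)) (at (complex_of_vec v))"
      using g[of "complex_of_vec v"] that by (simp add: T_def has_field_derivative_def)
    then have "((\<lambda>v. g (complex_of_vec v)) has_derivative (\<lambda>h. g' (complex_of_vec v) * complex_of_vec h)) (at v within T)"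
      by (intro has_derivative_compose[OF bounded_linear.has_derivative[OF bounded_linear_complex_of_vec has_derivative_ident], of g, simplified])
    from bounded_linear.has_derivative[OF bounded_linear_vec_of_complex this]
    show ?thesis by (simp add: G_def G'_def)
  qed
  have injG: "inj_on G T"
    using inj by (auto simp: inj_on_def G_def T_def) (metis complex_of_vec_inverse vec_of_complex_inverse)+
  have GT: "G ` T = complex_of_vec -` (g ` S)"
  proof (intro equalityI subsetI)
    fix v assume "v \<in> G ` T" then show "v \<in> complex_of_vec -` (g ` S)" by (auto simp: G_def T_def)
  next
    fix v assume "v \<in> complex_of_vec -` (g ` S)"
    then obtain z where z: "complex_of_vec v = g z" "z \<in> S" by auto
    then have "v = G (vec_of_complex z)" by (metis G_def complex_of_vec_inverse vec_of_complex_inverse)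
    moreover have "vec_of_complex z \<in> T" using z by (simp add: T_def)
    ultimately show "v \<in> G ` T" by blast
  qed
  have GTs [measurable]: "G ` T \<in> sets borel"
    unfolding GT using measurable_sets[OF borel_measurable_complex_of_vec gS] by simp
  have "G ` T \<in> lmeasurable \<and> measure lebesgue (G ` T) = enn2real I"
    using T by (subst has_measure_differentiable_image[OF _ der injG]) (auto simp: hi)
  then have "emeasure lebesgue (G ` T) = I"
    using Ir by (metis emeasure_eq_measure2 fmeasurableD2 emeasure_eq_ennreal_measure)
  then have "emeasure lborel (G ` T) = I" by simp
  then show ?thesis
    unfolding GT by (simp add: emeasure_lborel_complex_of_vec I_def)
qed

text \<open>From sets to functions: evaluating on Borel sets E shows that the inverse branch pushes
  Lebesgue measure on g(V) forward to the measure with density |g'|^2 on V.\<close>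

lemma nn_integral_inj_holomorphic_image:
  fixes g g' :: "complex \<Rightarrow> complex"
  assumes V: "open V" "bounded V" and inj: "inj_on g V"
    and g: "\<And>z. (g has_field_derivative g' z) (at z)"
    and g': "continuous_on UNIV g'"
    and F [measurable]: "F \<in> borel_measurable borel"
  shows "(\<integral>\<^sup>+w. F (inv_into V g w) * indicator (g ` V) w \<partial>lborel)
       = (\<integral>\<^sup>+z. F z * (ennreal ((norm (g' z))\<^sup>2) * indicator V z) \<partial>lborel)"
proof -
  have contg: "continuous_on UNIV g"
    using g by (meson DERIV_isCont continuous_at_imp_continuous_on)
  have [measurable]: "g' \<in> borel_measurable borel"
    using g' by (rule borel_measurable_continuous_onI)
  have contV: "continuous_on V g" using contg continuous_on_subset by blast
  have openV: "open (g ` V)"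
    using invariance_of_domain[OF contV V(1) inj] .
  have V_borel [measurable]: "V \<in> sets borel" "g ` V \<in> sets borel" using V openV by auto
  have conth: "continuous_on (g ` V) (inv_into V g)"
    using continuous_on_inverse_open[OF V(1) contV _ inv_into_f_f[OF inj]] inj by auto
  \<comment> \<open>Extension by 0 makes the inverse branch a Borel function on the whole plane; by
    invariance of domain it is continuous on an open image.\<close>
  define h where "h = (\<lambda>w. if w \<in> g ` V then inv_into V g w else 0)"
  have [measurable]: "h \<in> borel_measurable borel"
    unfolding h_def by (rule borel_measurable_continuous_on_if) (use conth in \<open>auto\<close>)
  have "distr (density lborel (indicator (g ` V))) borel h
      = density lborel (\<lambda>z. ennreal ((norm (g' z))\<^sup>2) * indicator V z)" (is "?L = ?R")
  proof (rule measure_eqI)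
    fix E assume "E \<in> sets ?L"
    then have E [measurable]: "E \<in> sets borel" by simp
    have eq: "h -` E \<inter> g ` V = g ` (V \<inter> E)"
      using inj by (auto simp: h_def inv_into_f_f)
    have gE: "g ` (V \<inter> E) \<in> sets borel"
      unfolding eq[symmetric] using measurable_sets[of h borel borel E] by simp
    have "emeasure ?L E = emeasure lborel (h -` E \<inter> g ` V)"
    proof -
      have "emeasure ?L E = emeasure (density lborel (indicator (g ` V))) (h -` E)"
        by (subst emeasure_distr) auto
      also have "\<dots> = (\<integral>\<^sup>+w. indicator (h -` E \<inter> g ` V) w \<partial>lborel)"
        using measurable_sets[of h borel borel E]
        by (subst emeasure_density, simp, simp, intro nn_integral_cong) (auto split: split_indicator)
      finally show ?thesis using measurable_sets[of h borel borel E] by simp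
    qed
    also have "\<dots> = (\<integral>\<^sup>+z. ennreal ((norm (g' z))\<^sup>2) * indicator (V \<inter> E) z \<partial>lborel)"
      unfolding eq using V(2) inj g g' gE
      by (intro emeasure_inj_holomorphic_image) (auto intro: bounded_subset inj_on_subset)
    also have "\<dots> = emeasure ?R E"
      by (subst emeasure_density) (auto intro!: nn_integral_cong split: split_indicator)
    finally show "emeasure ?L E = emeasure ?R E" .
  qed simp
  then have "(\<integral>\<^sup>+w. F w \<partial>?L) = (\<integral>\<^sup>+w. F w \<partial>?R)" by simp
  then have "(\<integral>\<^sup>+w. indicator (g ` V) w * F (h w) \<partial>lborel)
       = (\<integral>\<^sup>+z. (ennreal ((norm (g' z))\<^sup>2) * indicator V z) * F z \<partial>lborel)"
    by (simp add: nn_integral_distr nn_integral_density)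
  moreover have "(\<integral>\<^sup>+w. indicator (g ` V) w * F (h w) \<partial>lborel)
      = (\<integral>\<^sup>+w. F (inv_into V g w) * indicator (g ` V) w \<partial>lborel)"
    by (intro nn_integral_cong) (auto simp: h_def split: split_indicator)
  ultimately show ?thesis by (simp add: mult_ac)
qed

text \<open>Local injectivity at points with nonzero derivative gives a cover by good balls, and the
  Lindelof property makes the cover countable.\<close>

lemma countable_injective_cover:
  fixes g :: "complex \<Rightarrow> complex"
  assumes "g holomorphic_on UNIV" "open {z. deriv g z \<noteq> 0}"
  obtains V :: "nat \<Rightarrow> complex set" where
    "\<And>i. open (V i)" "\<And>i. bounded (V i)" "\<And>i. inj_on g (V i)" "(\<Union>i. V i) = {z. deriv g z \<noteq> 0}"
proof -
  define \<F> where "\<F> = {B. open B \<and> bounded B \<and> inj_on g B \<and> B \<subseteq> {z. deriv g z \<noteq> 0}}"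
  obtain \<G> where \<G>: "\<G> \<subseteq> \<F>" "countable \<G>" "\<Union>\<G> = \<Union>\<F>"
    using Lindelof[of \<F>] by (auto simp: \<F>_def)
  have "\<Union>\<F> = {z. deriv g z \<noteq> 0}"
  proof safe
    fix z assume "deriv g z \<noteq> 0"
    then obtain r where "r > 0" "ball z r \<subseteq> {z. deriv g z \<noteq> 0}" "inj_on g (ball z r)"
      using has_complex_derivative_locally_injective[of g "{z. deriv g z \<noteq> 0}" z] assms
      by (auto intro: holomorphic_on_subset)
    then have "ball z r \<in> \<F>" "z \<in> ball z r" by (auto simp: \<F>_def)
    then show "z \<in> \<Union>\<F>" by blast
  qed (auto simp: \<F>_def)
  \<comment> \<open>The empty set is added so that the enumeration also makes sense for an empty
    cover, as for constant g.\<close>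
  define V where "V = from_nat_into (insert {} \<G>)"
  have ran: "range V = insert {} \<G>"
    unfolding V_def using \<G>(2) by (intro range_from_nat_into) auto
  then have "V i \<in> insert {} \<F>" for i using \<G>(1) by auto
  then have "open (V i)" "bounded (V i)" "inj_on g (V i)" for i
    by (auto simp: \<F>_def dest!: spec[of _ i]) (metis (mono_tags, lifting) Diff_iff bounded_empty inj_on_empty insertE mem_Collect_eq open_empty)+
  moreover have "(\<Union>i. V i) = {z. deriv g z \<noteq> 0}"
    using ran \<G>(3) \<open>\<Union>\<F> = _\<close> by simp
  ultimately show ?thesis using that by blast
qed

text \<open>The sum on the left is over an infinite set, hence \<open>0\<close>, only if \<open>p\<close> is constant and
  \<open>w\<close> is its value, that is, for at most one \<open>w\<close>.\<close>

theorem poly_area_formula: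
  fixes p :: "complex poly"
  assumes F [measurable]: "F \<in> borel_measurable borel"
  shows "(\<integral>\<^sup>+w. (\<Sum>z | poly p z = w. F z) \<partial>lborel)
       = (\<integral>\<^sup>+z. F z * ennreal ((norm (poly (pderiv p) z))\<^sup>2) \<partial>lborel)"
proof -
  define g where "g = poly p"
  define g' where "g' = poly (pderiv p)"
  have g: "(g has_field_derivative g' z) (at z)" for z
    by (simp add: g_def g'_def poly_DERIV)
  have g'c: "continuous_on UNIV g'" by (auto simp: g'_def intro!: continuous_intros)
  have [measurable]: "g' \<in> borel_measurable borel"
    using g'c by (rule borel_measurable_continuous_onI)
  have dg: "deriv g = g'" using g by (auto simp: fun_eq_iff intro!: DERIV_imp_deriv)
  define U where "U = {z. g' z \<noteq> 0}"
  have "open U" unfolding U_def using g'c by (intro open_Collect_neq) auto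
  moreover have "g holomorphic_on UNIV" using g by (auto simp: holomorphic_on_def field_differentiable_def)
  ultimately obtain V :: "nat \<Rightarrow> complex set" where
    V: "\<And>i. open (V i)" "\<And>i. bounded (V i)" "\<And>i. inj_on g (V i)" "(\<Union>i. V i) = U"
    using countable_injective_cover[of g] unfolding dg U_def by metis
  \<comment> \<open>The sets V i overlap. Splitting the weight over the disjoint S i counts every
    regular point once, while the inverse branches keep their open domains V i.\<close>
  define S where "S = disjointed V"
  have S: "disjoint_family S" "(\<Union>i. S i) = U" "\<And>i. S i \<subseteq> V i"
    using V(4) disjoint_family_disjointed[of V] disjointed_subset[of V]
    by (simp_all add: S_def UN_disjointed_eq)
  have Vb [measurable]: "V i \<in> sets borel" for i using V(1) by simp
  have "range V \<subseteq> sets borel" using Vb by auto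
  from sets.range_disjointed_sets[OF this] have Sb [measurable]: "S i \<in> sets borel" for i
    by (auto simp: S_def)
  \<comment> \<open>For constant p every point is critical, but there is still only one critical
    value.\<close>
  have "finite (g ` (- U))"
  proof (cases "pderiv p = 0")
    case True
    then obtain c where "p = [:c:]" using pderiv_iszero by blast
    then have "g ` (- U) \<subseteq> {c}" by (auto simp: g_def)
    then show ?thesis using finite_subset by blast
  next
    case False
    then have "finite (- U)" using poly_roots_finite[of "pderiv p"] by (simp add: U_def g'_def Collect_neg_eq[symmetric])
    then show ?thesis by simp
  qed
  then have crit: "AE w in lborel. w \<notin> g ` (- U)"
    by (intro AE_not_in) (auto intro: countable_imp_null_set_lborel countable_finite)
  \<comment> \<open>Over a noncritical value the fibre is finite, and each V i contains at most one
    of its points, namely the value of the inverse branch.\<close>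
  have pt: "(\<Sum>z | poly p z = w. F z)
      = (\<Sum>i. (F (inv_into (V i) g w) * indicator (S i) (inv_into (V i) g w)) * indicator (g ` V i) w)"
    if w: "w \<notin> g ` (- U)" for w
  proof -
    define Z where "Z = {z. poly p z = w}"
    have "Z \<subseteq> U" using w by (auto simp: Z_def g_def)
    have "finite Z"
    proof (cases "p = [:w:]")
      case True
      then have "U = {}" by (auto simp: U_def g'_def pderiv_pCons)
      with \<open>Z \<subseteq> U\<close> show ?thesis by simp
    next
      case False
      then have "finite {z. poly (p - [:w:]) z = 0}" by (intro poly_roots_finite) auto
      then show ?thesis by (simp add: Z_def)
    qed
    have "(F (inv_into (V i) g w) * indicator (S i) (inv_into (V i) g w)) * indicator (g ` V i) w
        = (\<Sum>z\<in>Z. F z * indicator (S i) z)" for i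
    proof (cases "w \<in> g ` V i")
      case True
      then obtain v where v: "v \<in> V i" "g v = w" by auto
      then have "inv_into (V i) g w = v" using V(3) by auto
      have "z = v" if "z \<in> Z" "z \<in> S i" for z
        using that S(3)[of i] V(3)[of i] v by (auto simp: Z_def g_def inj_on_def)
      then have eq: "(\<Sum>z\<in>Z. F z * indicator (S i) z) = (\<Sum>z\<in>{v}. F z * indicator (S i) z)"
        using \<open>finite Z\<close> v by (intro sum.mono_neutral_right) (auto simp: Z_def g_def split: split_indicator)
      have single: "(\<Sum>z\<in>{v}. G z) = G v" for G :: "complex \<Rightarrow> ennreal" by simp
      show ?thesis unfolding eq single \<open>inv_into (V i) g w = v\<close> using True by simp
    next
      case False
      then have "z \<notin> S i" if "z \<in> Z" for z using that S(3)[of i] by (auto simp: Z_def g_def)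
      then show ?thesis using False by simp
    qed
    then have "(\<Sum>i. (F (inv_into (V i) g w) * indicator (S i) (inv_into (V i) g w)) * indicator (g ` V i) w)
       = (\<Sum>i. \<Sum>z\<in>Z. F z * indicator (S i) z)" by simp
    also have "\<dots> = (\<Sum>z\<in>Z. \<Sum>i. F z * indicator (S i) z)"
      by (rule suminf_sum) simp
    also have "\<dots> = (\<Sum>z\<in>Z. F z)"
    proof (intro sum.cong refl)
      fix z assume "z \<in> Z"
      then obtain i where "z \<in> S i" using \<open>Z \<subseteq> U\<close> S(2) by blast
      then show "(\<Sum>i. F z * indicator (S i) z) = F z"
        using suminf_cmult_indicator[OF S(1), of z i "\<lambda>_. F z"] by simp
    qed
    finally show ?thesis by (simp add: Z_def)
  qed
  have "(\<integral>\<^sup>+w. (\<Sum>z | poly p z = w. F z) \<partial>lborel)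
     = (\<integral>\<^sup>+w. (\<Sum>i. (F (inv_into (V i) g w) * indicator (S i) (inv_into (V i) g w)) * indicator (g ` V i) w) \<partial>lborel)"
    using crit by (intro nn_integral_cong_AE) (auto intro: pt)
  also have "\<dots> = (\<Sum>i. \<integral>\<^sup>+w. (F (inv_into (V i) g w) * indicator (S i) (inv_into (V i) g w)) * indicator (g ` V i) w \<partial>lborel)"
  proof (rule nn_integral_suminf)
    fix i
    have contV: "continuous_on (V i) g"
      using g by (meson DERIV_isCont continuous_at_imp_continuous_on)
    have openV: "open (g ` V i)" by (rule invariance_of_domain[OF contV V(1,3)])
    have [measurable]: "g ` V i \<in> sets borel" using openV by simp
    have conth: "continuous_on (g ` V i) (inv_into (V i) g)"
      using continuous_on_inverse_open[OF V(1) contV _ inv_into_f_f[OF V(3)]] V(3) by auto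
    define h where "h = (\<lambda>w. if w \<in> g ` V i then inv_into (V i) g w else 0)"
    have [measurable]: "h \<in> borel_measurable borel"
      unfolding h_def by (rule borel_measurable_continuous_on_if) (use conth in \<open>auto\<close>)
    have "(\<lambda>w. (F (h w) * indicator (S i) (h w)) * indicator (g ` V i) w) \<in> borel_measurable lborel"
      by measurable
    moreover have "(\<lambda>w. (F (h w) * indicator (S i) (h w)) * indicator (g ` V i) w)
      = (\<lambda>w. (F (inv_into (V i) g w) * indicator (S i) (inv_into (V i) g w)) * indicator (g ` V i) w)"
      by (auto simp: h_def fun_eq_iff split: split_indicator)
    ultimately show "(\<lambda>w. (F (inv_into (V i) g w) * indicator (S i) (inv_into (V i) g w)) * indicator (g ` V i) w)
        \<in> borel_measurable lborel" by simp
  qed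
  also have "\<dots> = (\<Sum>i. \<integral>\<^sup>+z. (F z * indicator (S i) z) * (ennreal ((norm (g' z))\<^sup>2) * indicator (V i) z) \<partial>lborel)"
    by (intro suminf_cong nn_integral_inj_holomorphic_image[OF V(1,2,3) g g'c]) auto
  also have "\<dots> = (\<integral>\<^sup>+z. (\<Sum>i. (F z * indicator (S i) z) * (ennreal ((norm (g' z))\<^sup>2) * indicator (V i) z)) \<partial>lborel)"
    by (subst nn_integral_suminf) auto
  also have "\<dots> = (\<integral>\<^sup>+z. F z * ennreal ((norm (g' z))\<^sup>2) \<partial>lborel)"
  proof (intro nn_integral_cong)
    fix z
    have eq: "(\<lambda>i. (F z * indicator (S i) z) * (ennreal ((norm (g' z))\<^sup>2) * indicator (V i) z))
        = (\<lambda>i. (F z * ennreal ((norm (g' z))\<^sup>2)) * indicator (S i) z)"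
      using S(3) by (auto simp: fun_eq_iff split: split_indicator)
    show "(\<Sum>i. (F z * indicator (S i) z) * (ennreal ((norm (g' z))\<^sup>2) * indicator (V i) z))
        = F z * ennreal ((norm (g' z))\<^sup>2)"
    proof (cases "z \<in> U")
      case True
      then obtain i where "z \<in> S i" using S(2) by blast
      then show ?thesis unfolding eq
        using suminf_cmult_indicator[OF S(1), of z i "\<lambda>_. F z * ennreal ((norm (g' z))\<^sup>2)"] by simp
    next
      case False
      then show ?thesis unfolding eq by (simp add: U_def)
    qed
  qed
  finally show ?thesis by (simp add: g'_def)
qed

section \<open>Measurability of sums over zeros\<close>

text \<open>By compactness a continuous function has a zero on K iff its modulus becomes arbitrarily
  small on a countable dense subset, which replaces an uncountable existential by countable
  operations.\<close>

lemma measurable_zero_in_compact: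
  fixes f :: "'a \<Rightarrow> complex \<Rightarrow> complex"
  assumes f [measurable]: "\<And>z. (\<lambda>\<omega>. f \<omega> z) \<in> borel_measurable M"
    and cont: "\<And>\<omega>. \<omega> \<in> space M \<Longrightarrow> continuous_on UNIV (f \<omega>)" and K: "compact K"
  shows "{\<omega> \<in> space M. \<exists>z\<in>K. f \<omega> z = 0} \<in> sets M"
proof -
  obtain D where D: "countable D" "D \<subseteq> K" "K \<subseteq> closure D"
    using separable[of K] by blast
  have "{\<omega> \<in> space M. \<exists>z\<in>K. f \<omega> z = 0}
      = {\<omega> \<in> space M. \<forall>n::nat. \<exists>d\<in>D. norm (f \<omega> d) < 1 / real (Suc n)}"
  proof (intro Collect_cong conj_cong refl iffI allI)
    fix \<omega> and n :: nat
    assume \<omega>: "\<omega> \<in> space M" and "\<exists>z\<in>K. f \<omega> z = 0"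
    then obtain z where z: "z \<in> closure D" "f \<omega> z = 0" using D by blast
    have "open {y. norm (f \<omega> y) < 1 / real (Suc n)}"
      using cont[OF \<omega>] by (intro open_Collect_less continuous_intros)
    moreover have "z \<in> {y. norm (f \<omega> y) < 1 / real (Suc n)}" using z by simp
    ultimately have "{y. norm (f \<omega> y) < 1 / real (Suc n)} \<inter> D \<noteq> {}"
      using z(1) open_Int_closure_eq_empty by blast
    then show "\<exists>d\<in>D. norm (f \<omega> d) < 1 / real (Suc n)" by blast
  next
    fix \<omega>
    assume \<omega>: "\<omega> \<in> space M" and *: "\<forall>n::nat. \<exists>d\<in>D. norm (f \<omega> d) < 1 / real (Suc n)"
    have "K \<noteq> {}" using * D(2) by blast
    moreover have "continuous_on K (\<lambda>z. norm (f \<omega> z))"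
      using cont[OF \<omega>] by (intro continuous_intros) (auto intro: continuous_on_subset)
    ultimately obtain z where z: "z \<in> K" "\<And>y. y \<in> K \<Longrightarrow> norm (f \<omega> z) \<le> norm (f \<omega> y)"
      using continuous_attains_inf[OF K] by blast
    have "norm (f \<omega> z) < inverse (real (Suc n))" for n :: nat
      using * z(2) D(2) by (metis inverse_eq_divide order_le_less_trans subsetD)
    then have "norm (f \<omega> z) = 0"
      by (metis norm_ge_zero order_le_less reals_Archimedean not_less_iff_gr_or_eq)
    then show "\<exists>z\<in>K. f \<omega> z = 0" using z(1) by auto
  qed
  also have "\<dots> \<in> sets M" using D(1) by measurable
  finally show ?thesis .
qed

text \<open>Half-open cells tile the plane without overlap but are not compact; each one is a
  countable union of compact boxes.\<close>

lemma measurable_zero_in_cell: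
  fixes f :: "'a \<Rightarrow> complex \<Rightarrow> complex"
  assumes f: "\<And>z. (\<lambda>\<omega>. f \<omega> z) \<in> borel_measurable M"
    and cont: "\<And>\<omega>. \<omega> \<in> space M \<Longrightarrow> continuous_on UNIV (f \<omega>)"
  shows "{\<omega> \<in> space M. \<exists>z. a \<le> Re z \<and> Re z < b \<and> c \<le> Im z \<and> Im z < d \<and> f \<omega> z = 0} \<in> sets M"
proof -
  define K where "K = (\<lambda>n::nat. cbox (Complex a c) (Complex (b - inverse (real (Suc n))) (d - inverse (real (Suc n)))))"
  have "{\<omega> \<in> space M. \<exists>z. a \<le> Re z \<and> Re z < b \<and> c \<le> Im z \<and> Im z < d \<and> f \<omega> z = 0}
      = (\<Union>n. {\<omega> \<in> space M. \<exists>z\<in>K n. f \<omega> z = 0})"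
  proof (intro equalityI subsetI)
    fix \<omega> assume "\<omega> \<in> {\<omega> \<in> space M. \<exists>z. a \<le> Re z \<and> Re z < b \<and> c \<le> Im z \<and> Im z < d \<and> f \<omega> z = 0}"
    then obtain z where \<omega>: "\<omega> \<in> space M" and z: "a \<le> Re z" "Re z < b" "c \<le> Im z" "Im z < d" "f \<omega> z = 0" by blast
    obtain n where n: "inverse (real (Suc n)) < min (b - Re z) (d - Im z)"
      using reals_Archimedean[of "min (b - Re z) (d - Im z)"] z by auto
    then have "z \<in> K n" using z by (auto simp: K_def in_cbox_complex_iff)
    then show "\<omega> \<in> (\<Union>n. {\<omega> \<in> space M. \<exists>z\<in>K n. f \<omega> z = 0})" using \<omega> z by blast
  next
    fix \<omega> assume "\<omega> \<in> (\<Union>n. {\<omega> \<in> space M. \<exists>z\<in>K n. f \<omega> z = 0})"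
    then obtain n z where \<omega>: "\<omega> \<in> space M" and z: "z \<in> K n" "f \<omega> z = 0" by blast
    have "inverse (real (Suc n)) > 0" by simp
    then have "a \<le> Re z" "Re z < b" "c \<le> Im z" "Im z < d"
      using z(1) unfolding K_def in_cbox_complex_iff complex.sel atLeastAtMost_iff by linarith+
    then show "\<omega> \<in> {\<omega> \<in> space M. \<exists>z. a \<le> Re z \<and> Re z < b \<and> c \<le> Im z \<and> Im z < d \<and> f \<omega> z = 0}"
      using \<omega> z(2) by blast
  qed
  also have "\<dots> \<in> sets M"
    using measurable_zero_in_compact[OF f cont] by (intro sets.countable_UN) (auto simp: K_def)
  finally show ?thesis .
qed

lemma tendsto_dyadic_floor: "(\<lambda>m. real_of_int \<lfloor>2 ^ m * x\<rfloor> / 2 ^ m) \<longlonglongrightarrow> (x::real)"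
proof (rule tendsto_sandwich)
  show "\<forall>\<^sub>F m in sequentially. x - (1/2) ^ m \<le> real_of_int \<lfloor>2 ^ m * x\<rfloor> / 2 ^ m"
  proof (intro always_eventually allI)
    fix m :: nat
    have "2 ^ m * x - 1 \<le> real_of_int \<lfloor>2 ^ m * x\<rfloor>" by linarith
    then have "(2 ^ m * x - 1) / 2 ^ m \<le> real_of_int \<lfloor>2 ^ m * x\<rfloor> / 2 ^ m"
      by (rule divide_right_mono) simp
    then show "x - (1/2) ^ m \<le> real_of_int \<lfloor>2 ^ m * x\<rfloor> / 2 ^ m"
      by (simp add: diff_divide_distrib power_one_over)
  qed
  show "\<forall>\<^sub>F m in sequentially. real_of_int \<lfloor>2 ^ m * x\<rfloor> / 2 ^ m \<le> x"
    by (intro always_eventually allI) (simp add: divide_le_eq mult.commute)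
  have "(\<lambda>m. x - (1/2) ^ m) \<longlonglongrightarrow> x - 0"
    by (intro tendsto_intros LIMSEQ_power_zero) auto
  then show "(\<lambda>m. x - (1/2) ^ m) \<longlonglongrightarrow> x" by simp
qed auto

text \<open>Avoids a measurable selection of zeros. At dyadic level m, \<open>S m\<close> sums
  \<psi> at the lower left corners of all cells of side 2^-m that contain a zero. Occupation of a
  cell is a measurable event, and the sums converge as the grid is refined.\<close>

lemma borel_measurable_sum_zeros_finite:
  fixes f :: "'a \<Rightarrow> complex \<Rightarrow> complex" and \<psi> :: "'a \<Rightarrow> complex \<Rightarrow> real"
  assumes f: "\<And>z. (\<lambda>\<omega>. f \<omega> z) \<in> borel_measurable M"
    and contf: "\<And>\<omega>. \<omega> \<in> space M \<Longrightarrow> continuous_on UNIV (f \<omega>)"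
    and \<psi> [measurable]: "\<And>z. (\<lambda>\<omega>. \<psi> \<omega> z) \<in> borel_measurable M"
    and cont\<psi>: "\<And>\<omega>. \<omega> \<in> space M \<Longrightarrow> continuous_on UNIV (\<psi> \<omega>)"
    and fin: "\<And>\<omega>. \<omega> \<in> space M \<Longrightarrow> finite {z. f \<omega> z = 0}"
  shows "(\<lambda>\<omega>. \<Sum>z | f \<omega> z = 0. \<psi> \<omega> z) \<in> borel_measurable M"
proof -
  define corner where "corner = (\<lambda>(m::nat) z. (\<lfloor>2 ^ m * Re z\<rfloor>, \<lfloor>2 ^ m * Im z\<rfloor>))"
  define pt where "pt = (\<lambda>(m::nat) c. Complex (real_of_int (fst c) / 2 ^ m) (real_of_int (snd c) / 2 ^ m))"
  define Z where "Z = (\<lambda>\<omega>. {z. f \<omega> z = 0})"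
  have lim: "(\<lambda>m. pt m (corner m z)) \<longlonglongrightarrow> z" for z
  proof -
    have "(\<lambda>m. Complex (real_of_int \<lfloor>2 ^ m * Re z\<rfloor> / 2 ^ m) (real_of_int \<lfloor>2 ^ m * Im z\<rfloor> / 2 ^ m))
        \<longlonglongrightarrow> Complex (Re z) (Im z)"
      by (intro tendsto_Complex tendsto_dyadic_floor)
    then show ?thesis by (simp add: pt_def corner_def)
  qed
  define S where "S = (\<lambda>m \<omega>. \<Sum>c\<in>corner m ` Z \<omega>. \<psi> \<omega> (pt m c))"
  have event: "{\<omega> \<in> space M. c \<in> corner m ` Z \<omega>} \<in> sets M" for m and c :: "int \<times> int"
  proof -
    have "c \<in> corner m ` Z \<omega> \<longleftrightarrow> (\<exists>z. fst c / 2 ^ m \<le> Re z \<and> Re z < (fst c + 1) / 2 ^ m \<and>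
         snd c / 2 ^ m \<le> Im z \<and> Im z < (snd c + 1) / 2 ^ m \<and> f \<omega> z = 0)" for \<omega>
    proof -
      have fl: "\<lfloor>2 ^ m * x\<rfloor> = i \<longleftrightarrow> i / 2 ^ m \<le> x \<and> x < (i + 1) / 2 ^ m" for x :: real and i :: int
        unfolding floor_eq_iff by (simp add: divide_le_eq less_divide_eq mult.commute)
      have "c \<in> corner m ` Z \<omega> \<longleftrightarrow> (\<exists>z. \<lfloor>2 ^ m * Re z\<rfloor> = fst c \<and> \<lfloor>2 ^ m * Im z\<rfloor> = snd c \<and> f \<omega> z = 0)"
        by (cases c) (auto simp: corner_def Z_def image_iff)
      then show ?thesis by (simp add: fl conj_assoc)
    qed
    then show ?thesis using measurable_zero_in_cell[OF f contf] by simp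
  qed
  \<comment> \<open>Which cells are occupied depends on \<omega>, so \<open>S m\<close> is obtained
    as a limit of sums over the fixed finite grids \<open>G N\<close>, eventually constant for each
    \<omega>.\<close>
  have Smeas: "S m \<in> borel_measurable M" for m
  proof (rule borel_measurable_LIMSEQ_real)
    define G where "G = (\<lambda>N::nat. {- int N..int N} \<times> {- int N..int N})"
    show "(\<lambda>\<omega>. \<Sum>c\<in>G N. indicator {\<omega> \<in> space M. c \<in> corner m ` Z \<omega>} \<omega> * \<psi> \<omega> (pt m c)) \<in> borel_measurable M" for N
      using event by measurable
    fix \<omega> assume \<omega>: "\<omega> \<in> space M"
    have finZ: "finite (corner m ` Z \<omega>)" using fin[OF \<omega>] by (simp add: Z_def)
    define B where "B = (\<Sum>c\<in>corner m ` Z \<omega>. nat \<bar>fst c\<bar> + nat \<bar>snd c\<bar>)"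
    have "corner m ` Z \<omega> \<subseteq> G N" if "N \<ge> B" for N
    proof
      fix c assume c: "c \<in> corner m ` Z \<omega>"
      have "nat \<bar>fst c\<bar> + nat \<bar>snd c\<bar> \<le> B" unfolding B_def
        by (rule member_le_sum[OF c]) (use finZ in auto)
      then show "c \<in> G N" using that by (cases c) (auto simp: G_def)
    qed
    then have "(\<Sum>c\<in>G N. indicator {\<omega> \<in> space M. c \<in> corner m ` Z \<omega>} \<omega> * \<psi> \<omega> (pt m c)) = S m \<omega>" if "N \<ge> B" for N
      unfolding S_def using that \<omega> by (intro sum.mono_neutral_cong_right) (auto simp: G_def)
    then show "(\<lambda>N. \<Sum>c\<in>G N. indicator {\<omega> \<in> space M. c \<in> corner m ` Z \<omega>} \<omega> * \<psi> \<omega> (pt m c)) \<longlonglongrightarrow> S m \<omega>"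
      by (intro tendsto_eventually eventually_sequentiallyI[of B]) auto
  qed
  show ?thesis
  proof (rule borel_measurable_LIMSEQ_real[OF _ Smeas])
    fix \<omega> assume \<omega>: "\<omega> \<in> space M"
    have finZ: "finite (Z \<omega>)" using fin[OF \<omega>] by (simp add: Z_def)
    \<comment> \<open>Two zeros in the same cell would be counted only once, so the grid has to
      separate the finitely many zeros first.\<close>
    have "\<forall>\<^sub>F m in sequentially. \<forall>z\<in>Z \<omega>. \<forall>z'\<in>Z \<omega>. z \<noteq> z' \<longrightarrow> corner m z \<noteq> corner m z'"
    proof (intro eventually_ball_finite finZ ballI)
      fix z z'
      show "\<forall>\<^sub>F m in sequentially. z \<noteq> z' \<longrightarrow> corner m z \<noteq> corner m z'"
      proof (cases "z = z'")
        case False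
        have "(\<lambda>m. dist (pt m (corner m z)) (pt m (corner m z'))) \<longlonglongrightarrow> dist z z'"
          by (intro tendsto_dist lim)
        then have "\<forall>\<^sub>F m in sequentially. 0 < dist (pt m (corner m z)) (pt m (corner m z'))"
          using False by (intro order_tendstoD(1)) auto
        then show ?thesis by eventually_elim auto
      qed simp
    qed
    then have ev: "\<forall>\<^sub>F m in sequentially. (\<Sum>z\<in>Z \<omega>. \<psi> \<omega> (pt m (corner m z))) = S m \<omega>"
      unfolding S_def
    proof eventually_elim
      case (elim m)
      then have "inj_on (corner m) (Z \<omega>)" unfolding inj_on_def by blast
      then show ?case by (simp add: sum.reindex)
    qed
    have "(\<lambda>m. \<Sum>z\<in>Z \<omega>. \<psi> \<omega> (pt m (corner m z))) \<longlonglongrightarrow> (\<Sum>z\<in>Z \<omega>. \<psi> \<omega> z)"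
    proof (intro tendsto_sum)
      fix z
      have "isCont (\<psi> \<omega>) z" using cont\<psi>[OF \<omega>] by (simp add: continuous_on_eq_continuous_at)
      then show "(\<lambda>m. \<psi> \<omega> (pt m (corner m z))) \<longlonglongrightarrow> \<psi> \<omega> z"
        using lim[of z] by (rule isCont_tendsto_compose)
    qed
    from Lim_transform_eventually[OF this ev]
    show "(\<lambda>m. S m \<omega>) \<longlonglongrightarrow> (\<Sum>z | f \<omega> z = 0. \<psi> \<omega> z)"
      by (simp add: Z_def)
  qed
qed

text \<open>Where the zero set is infinite, f is replaced by the constant 1. The sum over the
  resulting empty set is 0, which agrees with the default value of a sum over an infinite
  set.\<close>

lemma borel_measurable_sum_zeros:
  fixes f :: "'a \<Rightarrow> complex \<Rightarrow> complex" and \<psi> :: "'a \<Rightarrow> complex \<Rightarrow> real"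
  assumes f [measurable]: "\<And>z. (\<lambda>\<omega>. f \<omega> z) \<in> borel_measurable M"
    and contf: "\<And>\<omega>. \<omega> \<in> space M \<Longrightarrow> continuous_on UNIV (f \<omega>)"
    and \<psi>: "\<And>z. (\<lambda>\<omega>. \<psi> \<omega> z) \<in> borel_measurable M"
    and cont\<psi>: "\<And>\<omega>. \<omega> \<in> space M \<Longrightarrow> continuous_on UNIV (\<psi> \<omega>)"
    and fin [measurable]: "{\<omega> \<in> space M. finite {z. f \<omega> z = 0}} \<in> sets M"
  shows "(\<lambda>\<omega>. \<Sum>z | f \<omega> z = 0. \<psi> \<omega> z) \<in> borel_measurable M"
proof -
  define g where "g = (\<lambda>\<omega> z. if finite {z. f \<omega> z = 0} then f \<omega> z else 1)"
  have "(\<lambda>\<omega>. \<Sum>z | g \<omega> z = 0. \<psi> \<omega> z) \<in> borel_measurable M"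
  proof (rule borel_measurable_sum_zeros_finite[OF _ _ \<psi> cont\<psi>])
    show "(\<lambda>\<omega>. g \<omega> z) \<in> borel_measurable M" for z unfolding g_def by measurable
    show "continuous_on UNIV (g \<omega>)" if "\<omega> \<in> space M" for \<omega>
      using contf[OF that] by (cases "finite {z. f \<omega> z = 0}") (simp_all add: g_def)
    show "finite {z. g \<omega> z = 0}" for \<omega>
      by (cases "finite {z. f \<omega> z = 0}") (simp_all add: g_def)
  qed auto
  moreover have "(\<Sum>z | g \<omega> z = 0. \<psi> \<omega> z) = (\<Sum>z | f \<omega> z = 0. \<psi> \<omega> z)" for \<omega>
    by (cases "finite {z. f \<omega> z = 0}") (simp_all add: g_def)
  ultimately show ?thesis by simp
qed

section \<open>The limit of the radial integral\<close>

text \<open>The limit of exp(-\<rho> (1 + n t) / (1 + t)^n) when the variable t is replaced by t /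
  n.\<close>

definition lim_weight :: "real \<Rightarrow> real \<Rightarrow> real" where
  "lim_weight \<rho> t = exp (- \<rho> * ((1 + t) * exp (- t)))"

lemma lim_weight_pos [simp]: "lim_weight \<rho> t > 0"
  and borel_measurable_lim_weight [measurable]: "lim_weight \<rho> \<in> borel_measurable borel"
  by (simp_all add: lim_weight_def[abs_def])

lemma DERIV_lim_weight:
  "(lim_weight \<rho> has_real_derivative \<rho> * t * exp (- t) * lim_weight \<rho> t) (at t)"
  unfolding lim_weight_def[abs_def]
  by (auto intro!: derivative_eq_intros simp: algebra_simps)

lemma tendsto_lim_weight: "(lim_weight \<rho> \<longlongrightarrow> 1) at_top"
proof -
  have "((\<lambda>t::real. (1 + t) * exp (- t)) \<longlongrightarrow> 0) at_top" by real_asymp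
  then have "((\<lambda>t. exp (- \<rho> * ((1 + t) * exp (- t)))) \<longlongrightarrow> exp (- \<rho> * 0)) at_top"
    by (intro tendsto_intros)
  then show ?thesis by (simp add: lim_weight_def[abs_def])
qed

lemma nn_integral_lim_weight_by_parts:
  assumes "\<rho> \<ge> 0"
  shows "(\<integral>\<^sup>+t. ennreal ((\<rho> * t\<^sup>2 * exp (- t) ^ 2 + exp (- t)) * lim_weight \<rho> t) * indicator {0..} t \<partial>lborel)
    = ennreal (if \<rho> = 0 then 1 else (1 - exp (- \<rho>)) / \<rho>)"
proof (cases "\<rho> = 0")
  case True
  have "(\<integral>\<^sup>+t. ennreal (exp (- t)) * indicator {0..} t \<partial>lborel) = ennreal (0 - (- exp (- 0)))"
  proof (rule nn_integral_FTC_atLeast)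
    show "((\<lambda>t::real. - exp (- t)) \<longlongrightarrow> 0) at_top" by real_asymp
  qed (auto intro!: derivative_eq_intros)
  then show ?thesis using True by (simp add: lim_weight_def)
next
  case False
  \<comment> \<open>As w = \<open>lim_weight \<rho>\<close> satisfies w' = \<rho> t exp(-t) w,
    differentiating t exp(-t) w yields the integrand minus t exp(-t) w, and w / \<rho> supplies the
    missing term. The division is why \<rho> = 0 is treated apart.\<close>
  define F where "F = (\<lambda>t. t * exp (- t) * lim_weight \<rho> t + lim_weight \<rho> t / \<rho>)"
  have "(\<integral>\<^sup>+t. ennreal ((\<rho> * t\<^sup>2 * exp (- t) ^ 2 + exp (- t)) * lim_weight \<rho> t) * indicator {0..} t \<partial>lborel)
      = ennreal (1 / \<rho> - F 0)"
  proof (rule nn_integral_FTC_atLeast)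
    fix t :: real
    show "(F has_real_derivative (\<rho> * t\<^sup>2 * exp (- t) ^ 2 + exp (- t)) * lim_weight \<rho> t) (at t)"
      unfolding F_def using False
      by (auto intro!: derivative_eq_intros DERIV_lim_weight simp: algebra_simps power2_eq_square)
    show "0 \<le> (\<rho> * t\<^sup>2 * exp (- t) ^ 2 + exp (- t)) * lim_weight \<rho> t"
      using assms by (intro mult_nonneg_nonneg add_nonneg_nonneg less_imp_le[OF lim_weight_pos]) auto
  next
    have "((\<lambda>t::real. t * exp (- t)) \<longlongrightarrow> 0) at_top" by real_asymp
    then have "(F \<longlongrightarrow> 0 * 1 + 1 / \<rho>) at_top"
      unfolding F_def using False by (intro tendsto_intros tendsto_lim_weight)
    then show "(F \<longlongrightarrow> 1 / \<rho>) at_top" by simp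
  qed simp
  then show ?thesis using False by (simp add: F_def lim_weight_def diff_divide_distrib)
qed

text \<open>The substitution s = exp(-t), under which s - s ln s becomes (1 + t) exp(-t). The
  substitution rule concerns compact intervals, so it is used on [exp(-n), 1] and followed by
  monotone convergence; the endpoint s = 0 is a null set.\<close>

lemma set_integral_lim_weight:
  "(\<integral>\<^sup>+s. ennreal (exp (- (s - s * ln s) * \<rho>)) * indicator {0..1} s \<partial>lborel)
     = (\<integral>\<^sup>+t. ennreal (exp (- t) * lim_weight \<rho> t) * indicator {0..} t \<partial>lborel)"
proof -
  define f where "f = (\<lambda>s::real. exp (- (s - s * ln s) * \<rho>))"
  have [measurable]: "f \<in> borel_measurable borel" unfolding f_def by measurable
  have fe: "f (exp (- t)) = lim_weight \<rho> t" for t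
    by (simp add: f_def lim_weight_def algebra_simps)
  have eq: "(\<integral>\<^sup>+s. ennreal (f s) * indicator {exp (- real n)..1} s \<partial>lborel)
      = (\<integral>\<^sup>+t. ennreal (exp (- t) * lim_weight \<rho> t) * indicator {0..real n} t \<partial>lborel)" for n
  proof -
    have "(\<integral>\<^sup>+s. ennreal (f s) * indicator {exp (- real n)..1} s \<partial>lborel)
       = (\<integral>\<^sup>+s. ennreal (f s * indicator {exp (- real n)..exp 0} s) \<partial>lborel)"
      by (intro nn_integral_cong) (auto split: split_indicator)
    also have "\<dots> = (\<integral>\<^sup>+t. ennreal (f (exp t) * exp t * indicator {- real n..0} t) \<partial>lborel)"
      by (rule nn_integral_substitution)
         (auto intro!: derivative_eq_intros continuous_intros simp: set_borel_measurable_def)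
    also have "\<dots> = (\<integral>\<^sup>+t. ennreal (f (exp (- t)) * exp (- t) * indicator {- real n..0} (- t)) \<partial>lborel)"
      by (subst nn_integral_lborel_uminus[where f = "\<lambda>t. ennreal (f (exp t) * exp t * indicator {- real n..0} t)"]) auto
    also have "\<dots> = (\<integral>\<^sup>+t. ennreal (exp (- t) * lim_weight \<rho> t) * indicator {0..real n} t \<partial>lborel)"
      unfolding fe by (intro nn_integral_cong) (auto simp: mult.commute split: split_indicator)
    finally show ?thesis .
  qed
  \<comment> \<open>Monotone convergence in the form of continuity from below of the measure with
    density g.\<close>
  have sup: "(\<integral>\<^sup>+x. g x * indicator (\<Union>n. A n) x \<partial>lborel) = (SUP n. \<integral>\<^sup>+x. g x * indicator (A n) x \<partial>lborel)"
    if "incseq A" and [measurable]: "\<And>n. A n \<in> sets borel" "g \<in> borel_measurable borel"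
    for g :: "real \<Rightarrow> ennreal" and A :: "nat \<Rightarrow> real set"
  proof -
    have "emeasure (density lborel g) (\<Union>n. A n) = (SUP n. emeasure (density lborel g) (A n))"
      using that(1) by (intro SUP_emeasure_incseq[symmetric]) auto
    then show ?thesis by (simp add: emeasure_density)
  qed
  have "(\<integral>\<^sup>+s. ennreal (f s) * indicator {0..1} s \<partial>lborel) = (\<integral>\<^sup>+s. ennreal (f s) * indicator {0<..1} s \<partial>lborel)"
    by (intro nn_integral_cong_AE AE_I[where N = "{0}"]) (auto split: split_indicator)
  also have "{0<..1} = (\<Union>n. {exp (- real n)..1})"
  proof (intro equalityI subsetI)
    fix s :: real assume s: "s \<in> {0<..1}"
    obtain n where "real n \<ge> - ln s" using real_arch_simple by blast
    then have "exp (- real n) \<le> exp (ln s)" by (subst exp_le_cancel_iff) simp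
    also have "exp (ln s) = s" using s by simp
    finally have "exp (- real n) \<le> s" .
    then show "s \<in> (\<Union>n. {exp (- real n)..1})" using s by auto
  qed (auto intro: less_le_trans[OF exp_gt_zero])
  also have "(\<integral>\<^sup>+s. ennreal (f s) * indicator (\<Union>n. {exp (- real n)..1}) s \<partial>lborel)
      = (SUP n. \<integral>\<^sup>+s. ennreal (f s) * indicator {exp (- real n)..1} s \<partial>lborel)"
    by (rule sup) (auto simp: incseq_def intro: order_trans[rotated])
  also have "\<dots> = (SUP n. \<integral>\<^sup>+t. ennreal (exp (- t) * lim_weight \<rho> t) * indicator {0..real n} t \<partial>lborel)"
    unfolding eq ..
  also have "\<dots> = (\<integral>\<^sup>+t. ennreal (exp (- t) * lim_weight \<rho> t) * indicator (\<Union>n. {0..real n}) t \<partial>lborel)"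
    by (rule sup[symmetric]) (auto simp: incseq_def)
  also have "(\<Union>n. {0..real n}) = {0..}"
    by (auto simp: real_arch_simple)
  finally show ?thesis by (simp add: f_def)
qed

section \<open>The radial integral for fixed n\<close>

text \<open>The roles are \<rho> = |x|^2 and t = |z|^2.\<close>

definition critical_integrand :: "nat \<Rightarrow> real \<Rightarrow> real \<Rightarrow> real" where
  "critical_integrand n \<rho> t = exp (- \<rho> * (1 + real n * t) / (1 + t) ^ n) *
     (real n * (real n - 1)\<^sup>2 * t\<^sup>2 * \<rho> / (1 + t) ^ (2 * n + 2) + 2 * (real n - 1) / (1 + t) ^ (n + 2))"


lemma critical_integrand_nonneg: "\<rho> \<ge> 0 \<Longrightarrow> t \<ge> 0 \<Longrightarrow> n \<ge> 1 \<Longrightarrow> critical_integrand n \<rho> t \<ge> 0"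
  by (simp add: critical_integrand_def)

lemma borel_measurable_critical_integrand [measurable (raw)]:
  assumes [measurable]: "f \<in> borel_measurable M" "g \<in> borel_measurable M"
  shows "(\<lambda>a. critical_integrand n (f a) (g a)) \<in> borel_measurable M"
  unfolding critical_integrand_def by measurable

text \<open>Supplies both dominating functions: a = 1 for fixed n, a = 8 for the rescaled
  limit.\<close>

lemma integrable_inverse_square:
  fixes a :: real
  assumes "a > 0"
  shows "integrable lborel (\<lambda>t. K * (1 / (1 + t / a)\<^sup>2) * indicator {0..} t)"
proof -
  have "(\<integral>\<^sup>+t. ennreal (1 / (1 + t / a)\<^sup>2) * indicator {0..} t \<partial>lborel) = ennreal (0 - (- (a / (1 + 0 / a))))"
  proof (rule nn_integral_FTC_atLeast)
    show "((\<lambda>t. - (a / (1 + t / a))) \<longlongrightarrow> 0) at_top"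
      using assms by real_asymp
    fix t :: real assume "0 \<le> t"
    then have "1 + t / a > 0" using assms by (simp add: add_pos_nonneg)
    then show "((\<lambda>t. - (a / (1 + t / a))) has_real_derivative 1 / (1 + t / a)\<^sup>2) (at t)"
      using assms by (auto intro!: derivative_eq_intros simp: power2_eq_square)
  qed auto
  moreover have "(\<integral>\<^sup>+t. ennreal (1 / (1 + t / a)\<^sup>2) * indicator {0..} t \<partial>lborel)
     = (\<integral>\<^sup>+t. ennreal (1 / (1 + t / a)\<^sup>2 * indicator {0..} t) \<partial>lborel)"
    by (intro nn_integral_cong) (auto split: split_indicator)
  ultimately have "integrable lborel (\<lambda>t. 1 / (1 + t / a)\<^sup>2 * indicator {0..} t)"
    using assms by (intro integrableI_nn_integral_finite[where x = a]) auto
  from integrable_mult_right[OF this, of K] show ?thesis by (simp add: mult.assoc)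
qed

text \<open>The exponential factor is at most 1, and t^2 \<le> (1 + t)^2 leaves quadratic decay.
  Uniformity in \<rho> \<le> P serves the continuity of the density in x.\<close>

lemma critical_integrand_bound:
  assumes "0 \<le> \<rho>" "\<rho> \<le> P" "t \<ge> 0" "n \<ge> 1"
  shows "critical_integrand n \<rho> t \<le> (real n * (real n - 1)\<^sup>2 * P + 2 * (real n - 1)) * (1 / (1 + t / 1)\<^sup>2)"
proof -
  define A where "A = real n * (real n - 1)\<^sup>2 * t\<^sup>2 * \<rho> / (1 + t) ^ (2 * n + 2)"
  define B where "B = 2 * (real n - 1) / (1 + t) ^ (n + 2)"
  have AB: "A \<ge> 0" "B \<ge> 0" using assms by (auto simp: A_def B_def)
  have t1: "1 + t > 0" using assms by simp
  have pow: "(1 + t) ^ 2 \<le> (1 + t) ^ k" if "k \<ge> 2" for k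
    using that assms by (intro power_increasing) auto
  have "exp (- \<rho> * (1 + real n * t) / (1 + t) ^ n) \<le> 1" using assms by (simp add: divide_nonneg_nonneg)
  then have "critical_integrand n \<rho> t \<le> 1 * (A + B)"
    unfolding critical_integrand_def A_def[symmetric] B_def[symmetric] using AB by (intro mult_right_mono) auto
  moreover have "B \<le> 2 * (real n - 1) / (1 + t)\<^sup>2"
    unfolding B_def using assms pow[of "n + 2"] by (intro divide_left_mono) (auto intro!: mult_pos_pos)
  moreover have "A \<le> real n * (real n - 1)\<^sup>2 * P / (1 + t)\<^sup>2"
  proof -
    have "A \<le> real n * (real n - 1)\<^sup>2 * (1 + t)\<^sup>2 * P / (1 + t) ^ (2 * n + 2)"
      unfolding A_def using assms
      by (intro divide_right_mono mult_mono mult_left_mono power_mono) auto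
    also have "\<dots> = real n * (real n - 1)\<^sup>2 * P / (1 + t) ^ (2 * n)"
      using t1 by (simp add: power_add power2_eq_square)
    also have "\<dots> \<le> real n * (real n - 1)\<^sup>2 * P / (1 + t)\<^sup>2"
      using assms pow[of "2 * n"] by (intro divide_left_mono) (auto intro!: mult_pos_pos mult_nonneg_nonneg)
    finally show ?thesis .
  qed
  ultimately show ?thesis by (simp add: add_divide_distrib)
qed

definition critical_integral :: "nat \<Rightarrow> real \<Rightarrow> real" where
  "critical_integral n \<rho> = (\<integral>t. critical_integrand n \<rho> t * indicator {0..} t \<partial>lborel)"

lemma integrable_critical_integrand:
  assumes "\<rho> \<ge> 0" "n \<ge> 1"
  shows "integrable lborel (\<lambda>t. critical_integrand n \<rho> t * indicator {0..} t)"
proof (rule Bochner_Integration.integrable_bound[OF integrable_inverse_square[of 1 "real n * (real n - 1)\<^sup>2 * \<rho> + 2 * (real n - 1)"]])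
  show "AE t in lborel. norm (critical_integrand n \<rho> t * indicator {0..} t)
    \<le> norm ((real n * (real n - 1)\<^sup>2 * \<rho> + 2 * (real n - 1)) * (1 / (1 + t / 1)\<^sup>2) * indicator {0..} t)"
  proof (intro AE_I2)
    fix t :: real
    show "norm (critical_integrand n \<rho> t * indicator {0..} t)
    \<le> norm ((real n * (real n - 1)\<^sup>2 * \<rho> + 2 * (real n - 1)) * (1 / (1 + t / 1)\<^sup>2) * indicator {0..} t)"
    proof (cases "t \<ge> 0")
      case True
      have "norm (critical_integrand n \<rho> t) = critical_integrand n \<rho> t"
        using critical_integrand_nonneg[OF assms(1) True assms(2)] by simp
      also have "\<dots> \<le> (real n * (real n - 1)\<^sup>2 * \<rho> + 2 * (real n - 1)) * (1 / (1 + t / 1)\<^sup>2)"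
        using critical_integrand_bound[OF assms(1) order_refl True assms(2)] .
      also have "\<dots> \<le> norm \<dots>" by (simp only: real_norm_def abs_ge_self)
      finally show ?thesis using True by simp
    qed simp
  qed
qed auto

lemma nn_integral_critical_integrand:
  assumes "\<rho> \<ge> 0" "n \<ge> 1"
  shows "(\<integral>\<^sup>+t. ennreal (critical_integrand n \<rho> t) * indicator {0..} t \<partial>lborel) = ennreal (critical_integral n \<rho>)"
proof -
  have "(\<integral>\<^sup>+t. ennreal (critical_integrand n \<rho> t) * indicator {0..} t \<partial>lborel)
      = (\<integral>\<^sup>+t. ennreal (critical_integrand n \<rho> t * indicator {0..} t) \<partial>lborel)"
    by (intro nn_integral_cong) (auto split: split_indicator)
  also have "\<dots> = ennreal (critical_integral n \<rho>)"
    unfolding critical_integral_def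
    by (intro nn_integral_eq_integral integrable_critical_integrand[OF assms] AE_I2)
       (auto split: split_indicator simp: critical_integrand_nonneg[OF assms(1) _ assms(2)])
  finally show ?thesis .
qed

lemma critical_integral_nonneg:
  assumes "\<rho> \<ge> 0" "n \<ge> 1"
  shows "critical_integral n \<rho> \<ge> 0"
  unfolding critical_integral_def
  by (intro Bochner_Integration.integral_nonneg)
     (auto split: split_indicator simp: critical_integrand_nonneg[OF assms(1) _ assms(2)])

lemma tendsto_critical_integral:
  fixes u :: "nat \<Rightarrow> real"
  assumes u: "\<And>i. u i \<ge> 0" and lim: "u \<longlonglongrightarrow> \<rho>" and n: "n \<ge> 1"
  shows "(\<lambda>i. critical_integral n (u i)) \<longlonglongrightarrow> critical_integral n \<rho>"
proof -
  obtain P where P: "\<And>i. u i \<le> P"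
    using convergent_imp_Bseq[of u] lim unfolding convergent_def Bseq_def
    by (metis abs_le_D1 real_norm_def)
  show ?thesis unfolding critical_integral_def
  proof (rule integral_dominated_convergence[where
        w = "\<lambda>t. (real n * (real n - 1)\<^sup>2 * P + 2 * (real n - 1)) * (1 / (1 + t / 1)\<^sup>2) * indicator {0..} t"])
    show "integrable lborel (\<lambda>t. (real n * (real n - 1)\<^sup>2 * P + 2 * (real n - 1)) * (1 / (1 + t / 1)\<^sup>2) * indicator {0..} t)"
      by (rule integrable_inverse_square) simp
    show "AE t in lborel. (\<lambda>i. critical_integrand n (u i) t * indicator {0..} t) \<longlonglongrightarrow> critical_integrand n \<rho> t * indicator {0..} t"
    proof (intro AE_I2)
      fix t :: real
      show "(\<lambda>i. critical_integrand n (u i) t * indicator {0..} t) \<longlonglongrightarrow> critical_integrand n \<rho> t * indicator {0..} t"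
      proof (cases "t \<ge> 0")
        case True
        then have "(1 + t) ^ n \<noteq> 0" "(1 + t) ^ (2 * n + 2) \<noteq> 0" by auto
        then show ?thesis unfolding critical_integrand_def using lim by (intro tendsto_intros) auto
      qed simp
    qed
    show "AE t in lborel. norm (critical_integrand n (u i) t * indicator {0..} t)
      \<le> (real n * (real n - 1)\<^sup>2 * P + 2 * (real n - 1)) * (1 / (1 + t / 1)\<^sup>2) * indicator {0..} t" for i
      using critical_integrand_bound[OF u P _ n] critical_integrand_nonneg[OF u _ n]
      by (intro AE_I2) (auto split: split_indicator)
  qed auto
qed

section \<open>Rescaling and the limit in n\<close>

text \<open>Bernoulli's inequality for the exponent k = n div 4, then a fourth power. The 8 comes
  from n \<le> 8 k, valid for n \<ge> 4. The result bounds the n-dependent power below by a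
  polynomial independent of n, as domination requires.\<close>

lemma one_plus_over_power_ge:
  assumes "\<tau> \<ge> 0" "n \<ge> 4"
  shows "(1 + \<tau> / 8) ^ 4 \<le> (1 + \<tau> / real n) ^ n"
proof -
  define k where "k = n div 4"
  have k: "4 * k \<le> n" "n \<le> 8 * k" using assms(2) unfolding k_def by presburger+
  have n0: "real n > 0" using assms by simp
  have kn: "real n \<le> 8 * real k" using k(2) by linarith
  have "\<tau> / 8 \<le> real k * (\<tau> / real n)"
    using mult_right_mono[OF kn assms(1)] n0 by (simp add: field_simps)
  then have "1 + \<tau> / 8 \<le> 1 + real k * (\<tau> / real n)" by simp
  also have "\<dots> \<le> (1 + \<tau> / real n) ^ k"
    using assms by (intro Bernoulli_inequality) (simp add: order_trans[of _ 0])
  finally have "(1 + \<tau> / 8) ^ 4 \<le> ((1 + \<tau> / real n) ^ k) ^ 4"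
    using assms by (intro power_mono) auto
  also have "\<dots> = (1 + \<tau> / real n) ^ (4 * k)" by (simp add: power_mult[symmetric] mult.commute)
  also have "\<dots> \<le> (1 + \<tau> / real n) ^ n"
    using assms k by (intro power_increasing) auto
  finally show ?thesis .
qed

definition rescaled_integrand :: "nat \<Rightarrow> real \<Rightarrow> real \<Rightarrow> real" where
  "rescaled_integrand n \<rho> \<tau> = critical_integrand n \<rho> (\<tau> / real n) / real n"

lemma rescaled_integrand_eq:
  assumes "\<tau> \<ge> 0" "n \<ge> 1"
  defines "E \<equiv> (1 + \<tau> / real n) ^ n" and "S \<equiv> (1 + \<tau> / real n)\<^sup>2"
  shows "rescaled_integrand n \<rho> \<tau> = exp (- \<rho> * (1 + \<tau>) / E) *
     ((1 - 1 / real n)\<^sup>2 * \<tau>\<^sup>2 * \<rho> / (E\<^sup>2 * S) + 2 * (1 - 1 / real n) / (E * S))"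
proof -
  define m where "m = real n"
  have m: "m > 0" using assms by (simp add: m_def)
  have p: "(1 + \<tau> / m) ^ (2 * n + 2) = E\<^sup>2 * S" "(1 + \<tau> / m) ^ (n + 2) = E * S"
    unfolding E_def S_def m_def[symmetric] power_add power_mult[symmetric] by (simp_all add: mult.commute)
  have "m * (\<tau> / m) = \<tau>" using m by simp
  then have "critical_integrand n \<rho> (\<tau> / m) = exp (- \<rho> * (1 + \<tau>) / E) *
     (m * (m - 1)\<^sup>2 * (\<tau> / m)\<^sup>2 * \<rho> / (E\<^sup>2 * S) + 2 * (m - 1) / (E * S))"
    unfolding critical_integrand_def m_def[symmetric] p by (simp add: E_def m_def)
  also have "\<dots> / m = exp (- \<rho> * (1 + \<tau>) / E) *
     ((1 - 1 / m)\<^sup>2 * \<tau>\<^sup>2 * \<rho> / (E\<^sup>2 * S) + 2 * (1 - 1 / m) / (E * S))"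
  proof -
    have "(1 - 1 / m) = (m - 1) / m" using m by (simp add: field_simps)
    then show ?thesis using m by (simp add: power2_eq_square add_divide_distrib distrib_left mult_ac)
  qed
  finally show ?thesis by (simp add: rescaled_integrand_def m_def)
qed

definition limit_integrand :: "real \<Rightarrow> real \<Rightarrow> real" where
  "limit_integrand \<rho> \<tau> = (\<rho> * \<tau>\<^sup>2 * exp (- \<tau>) ^ 2 + 2 * exp (- \<tau>)) * lim_weight \<rho> \<tau>"

lemma tendsto_rescaled_integrand:
  assumes "\<tau> \<ge> 0"
  shows "(\<lambda>n. rescaled_integrand n \<rho> \<tau>) \<longlonglongrightarrow> limit_integrand \<rho> \<tau>"
proof -
  have 1: "(\<lambda>n. (1 + \<tau> / real n) ^ n) \<longlonglongrightarrow> exp \<tau>"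
    by (rule tendsto_exp_limit_sequentially)
  have 2: "(\<lambda>n. 1 / real n) \<longlonglongrightarrow> 0" by real_asymp
  have 3: "(\<lambda>n. (1 + \<tau> / real n)\<^sup>2) \<longlonglongrightarrow> 1" by real_asymp
  have "(\<lambda>n. exp (- \<rho> * (1 + \<tau>) / (1 + \<tau> / real n) ^ n) *
     ((1 - 1 / real n)\<^sup>2 * \<tau>\<^sup>2 * \<rho> / (((1 + \<tau> / real n) ^ n)\<^sup>2 * (1 + \<tau> / real n)\<^sup>2)
        + 2 * (1 - 1 / real n) / ((1 + \<tau> / real n) ^ n * (1 + \<tau> / real n)\<^sup>2)))
    \<longlonglongrightarrow> exp (- \<rho> * (1 + \<tau>) / exp \<tau>) * ((1 - 0)\<^sup>2 * \<tau>\<^sup>2 * \<rho> / ((exp \<tau>)\<^sup>2 * 1) + 2 * (1 - 0) / (exp \<tau> * 1))"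
    by (intro tendsto_intros 1 2 3) auto
  moreover have "exp (- \<rho> * (1 + \<tau>) / exp \<tau>) * ((1 - 0)\<^sup>2 * \<tau>\<^sup>2 * \<rho> / ((exp \<tau>)\<^sup>2 * 1) + 2 * (1 - 0) / (exp \<tau> * 1))
      = limit_integrand \<rho> \<tau>"
    by (simp add: limit_integrand_def lim_weight_def exp_minus power_inverse divide_inverse mult_ac)
  moreover have "\<forall>\<^sub>F n in sequentially. exp (- \<rho> * (1 + \<tau>) / (1 + \<tau> / real n) ^ n) *
     ((1 - 1 / real n)\<^sup>2 * \<tau>\<^sup>2 * \<rho> / (((1 + \<tau> / real n) ^ n)\<^sup>2 * (1 + \<tau> / real n)\<^sup>2)
        + 2 * (1 - 1 / real n) / ((1 + \<tau> / real n) ^ n * (1 + \<tau> / real n)\<^sup>2)) = rescaled_integrand n \<rho> \<tau>"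
    using eventually_ge_at_top[of 1] by eventually_elim (simp only: rescaled_integrand_eq[OF assms])
  ultimately show ?thesis by (simp only: Lim_transform_eventually)
qed

lemma rescaled_integrand_bound:
  assumes "\<tau> \<ge> 0" "n \<ge> 4" "\<rho> \<ge> 0"
  shows "0 \<le> rescaled_integrand n \<rho> \<tau>"
    and "rescaled_integrand n \<rho> \<tau> \<le> (64 * \<rho> + 2) * (1 / (1 + \<tau> / 8)\<^sup>2)"
proof -
  define E where "E = (1 + \<tau> / real n) ^ n"
  define S where "S = (1 + \<tau> / real n)\<^sup>2"
  define V where "V = (1 + \<tau> / 8)\<^sup>2"
  define b where "b = 1 - 1 / real n"
  have n: "n \<ge> 1" using assms by simp
  have b: "0 \<le> b" "b \<le> 1" using assms by (auto simp: b_def)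
  have V: "V \<ge> 1" using assms by (simp add: V_def)
  have EV: "E \<ge> V\<^sup>2"
    using one_plus_over_power_ge[OF assms(1,2)] by (simp add: E_def V_def power_mult[symmetric])
  have V2: "V\<^sup>2 \<ge> V" using V by (simp add: power2_eq_square)
  then have E1: "E \<ge> V" using EV by linarith
  have S: "S \<ge> 1" using assms by (simp add: S_def)
  \<comment> \<open>\<tau> = 8 (\<tau> / 8) \<le> 8 (1 + \<tau> / 8); this is the origin of the
    constant 64.\<close>
  have t2: "\<tau>\<^sup>2 \<le> 64 * V" using assms by (simp add: V_def power2_eq_square algebra_simps)
  have eq: "rescaled_integrand n \<rho> \<tau> = exp (- \<rho> * (1 + \<tau>) / E) *
     (b\<^sup>2 * \<tau>\<^sup>2 * \<rho> / (E\<^sup>2 * S) + 2 * b / (E * S))"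
    unfolding b_def E_def S_def using rescaled_integrand_eq[OF assms(1) n] .
  have nn: "0 \<le> b\<^sup>2 * \<tau>\<^sup>2 * \<rho> / (E\<^sup>2 * S) + 2 * b / (E * S)"
    using b V E1 S assms by (intro add_nonneg_nonneg divide_nonneg_nonneg mult_nonneg_nonneg) auto
  then show "0 \<le> rescaled_integrand n \<rho> \<tau>" unfolding eq by simp
  have "exp (- \<rho> * (1 + \<tau>) / E) \<le> 1" using assms V E1 by (simp add: divide_nonneg_nonneg)
  then have "rescaled_integrand n \<rho> \<tau> \<le> 1 * (b\<^sup>2 * \<tau>\<^sup>2 * \<rho> / (E\<^sup>2 * S) + 2 * b / (E * S))"
    unfolding eq using nn by (intro mult_right_mono) auto
  moreover have "2 * b / (E * S) \<le> 2 * 1 / (V * 1)"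
    using b V E1 S by (intro frac_le mult_mono) auto
  moreover have "b\<^sup>2 * \<tau>\<^sup>2 * \<rho> / (E\<^sup>2 * S) \<le> 64 * \<rho> / V"
  proof -
    have "b\<^sup>2 * \<tau>\<^sup>2 * \<rho> \<le> 1 * (64 * V) * \<rho>"
      using b t2 V assms by (intro mult_right_mono mult_mono power_le_one) auto
    moreover have "V\<^sup>2 \<le> E\<^sup>2 * S"
    proof -
      have "V\<^sup>2 * 1 \<le> E\<^sup>2 * S" using V E1 S by (intro mult_mono power_mono) auto
      then show ?thesis by simp
    qed
    ultimately have "b\<^sup>2 * \<tau>\<^sup>2 * \<rho> / (E\<^sup>2 * S) \<le> 1 * (64 * V) * \<rho> / V\<^sup>2"
      using V assms by (intro frac_le) auto
    then show ?thesis using V by (simp add: power2_eq_square)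
  qed
  ultimately show "rescaled_integrand n \<rho> \<tau> \<le> (64 * \<rho> + 2) * (1 / (1 + \<tau> / 8)\<^sup>2)"
    unfolding V_def[symmetric] by (simp add: add_divide_distrib)
qed

lemma critical_integral_rescaled:
  assumes "n \<ge> 1"
  shows "critical_integral n \<rho> = (\<integral>\<tau>. rescaled_integrand n \<rho> \<tau> * indicator {0..} \<tau> \<partial>lborel)"
proof -
  have n: "real n > 0" using assms by simp
  have "critical_integral n \<rho> = \<bar>1 / real n\<bar> *\<^sub>R
      (\<integral>\<tau>. critical_integrand n \<rho> (0 + 1 / real n * \<tau>) * indicator {0..} (0 + 1 / real n * \<tau>) \<partial>lborel)"
    unfolding critical_integral_def using n by (intro lborel_integral_real_affine) auto
  also have "\<dots> = (\<integral>\<tau>. 1 / real n * (critical_integrand n \<rho> (0 + 1 / real n * \<tau>) * indicator {0..} (0 + 1 / real n * \<tau>)) \<partial>lborel)"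
    using n by simp
  also have "\<dots> = (\<integral>\<tau>. rescaled_integrand n \<rho> \<tau> * indicator {0..} \<tau> \<partial>lborel)"
    using n by (intro Bochner_Integration.integral_cong)
      (auto simp: rescaled_integrand_def zero_le_divide_iff split: split_indicator)
  finally show ?thesis .
qed

lemma borel_measurable_rescaled [measurable]:
  "rescaled_integrand n \<rho> \<in> borel_measurable borel" "limit_integrand \<rho> \<in> borel_measurable borel"
  unfolding rescaled_integrand_def[abs_def] limit_integrand_def[abs_def] by measurable

lemma critical_integral_limit:
  assumes \<rho>: "\<rho> \<ge> 0"
  shows "(\<lambda>n. critical_integral n \<rho>) \<longlonglongrightarrow> (\<integral>\<tau>. limit_integrand \<rho> \<tau> * indicator {0..} \<tau> \<partial>lborel)"
    and "integrable lborel (\<lambda>\<tau>. limit_integrand \<rho> \<tau> * indicator {0..} \<tau>)"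
proof -
  let ?w = "\<lambda>\<tau>. (64 * \<rho> + 2) * (1 / (1 + \<tau> / 8)\<^sup>2) * indicator {0..} \<tau>"
  have w: "integrable lborel ?w" by (rule integrable_inverse_square) simp
  \<comment> \<open>The sequence starts at index 4, from where the uniform bound holds.\<close>
  have lim: "AE \<tau> in lborel. (\<lambda>i. rescaled_integrand (i + 4) \<rho> \<tau> * indicator {0..} \<tau>) \<longlonglongrightarrow> limit_integrand \<rho> \<tau> * indicator {0..} \<tau>"
  proof (intro AE_I2)
    fix \<tau> :: real
    show "(\<lambda>i. rescaled_integrand (i + 4) \<rho> \<tau> * indicator {0..} \<tau>) \<longlonglongrightarrow> limit_integrand \<rho> \<tau> * indicator {0..} \<tau>"
    proof (cases "\<tau> \<ge> 0")
      case True
      then show ?thesis using LIMSEQ_ignore_initial_segment[OF tendsto_rescaled_integrand[OF True, of \<rho>], of 4] by simp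
    qed simp
  qed
  have bd: "AE \<tau> in lborel. norm (rescaled_integrand (i + 4) \<rho> \<tau> * indicator {0..} \<tau>) \<le> ?w \<tau>" for i
    using rescaled_integrand_bound[OF _ _ \<rho>, where n = "i + 4"]
    by (intro AE_I2) (auto split: split_indicator)
  have "(\<lambda>i. \<integral>\<tau>. rescaled_integrand (i + 4) \<rho> \<tau> * indicator {0..} \<tau> \<partial>lborel)
      \<longlonglongrightarrow> (\<integral>\<tau>. limit_integrand \<rho> \<tau> * indicator {0..} \<tau> \<partial>lborel)"
    by (rule integral_dominated_convergence[OF _ _ w lim bd]) auto
  then have "(\<lambda>i. critical_integral (i + 4) \<rho>) \<longlonglongrightarrow> (\<integral>\<tau>. limit_integrand \<rho> \<tau> * indicator {0..} \<tau> \<partial>lborel)"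
    by (simp add: critical_integral_rescaled)
  then show "(\<lambda>n. critical_integral n \<rho>) \<longlonglongrightarrow> (\<integral>\<tau>. limit_integrand \<rho> \<tau> * indicator {0..} \<tau> \<partial>lborel)"
    by (rule LIMSEQ_offset)
  show "integrable lborel (\<lambda>\<tau>. limit_integrand \<rho> \<tau> * indicator {0..} \<tau>)"
    by (rule integrable_dominated_convergence[OF _ _ w lim bd]) auto
qed

text \<open>Explains the two summands of the answer: 2 exp(-\<tau>) is split in two. One half joins
  the \<rho> \<tau>^2 term to form an exact derivative, the other half becomes the integral over
  [0, 1].\<close>

lemma integral_limit_integrand:
  assumes \<rho>: "\<rho> \<ge> 0"
  shows "(\<integral>\<tau>. limit_integrand \<rho> \<tau> * indicator {0..} \<tau> \<partial>lborel)
    = (if \<rho> = 0 then 1 else (1 - exp (- \<rho>)) / \<rho>) + (LBINT s:{0..1}. exp (- (s - s * ln s) * \<rho>))"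
proof -
  define a where "a = (if \<rho> = 0 then 1 else (1 - exp (- \<rho>)) / \<rho>)"
  define B where "B = (\<integral>\<^sup>+s. ennreal (exp (- (s - s * ln s) * \<rho>)) * indicator {0..1} s \<partial>lborel)"
  have a0: "a \<ge> 0" using \<rho> by (simp add: a_def)
  have nn: "limit_integrand \<rho> \<tau> * indicator {0..} \<tau> \<ge> 0" for \<tau>
    using \<rho> by (auto simp: limit_integrand_def split: split_indicator intro!: mult_nonneg_nonneg add_nonneg_nonneg less_imp_le[OF lim_weight_pos])
  have "(\<integral>\<^sup>+\<tau>. ennreal (limit_integrand \<rho> \<tau> * indicator {0..} \<tau>) \<partial>lborel)
     = (\<integral>\<^sup>+\<tau>. ennreal ((\<rho> * \<tau>\<^sup>2 * exp (- \<tau>) ^ 2 + exp (- \<tau>)) * lim_weight \<rho> \<tau>) * indicator {0..} \<tau>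
         + ennreal (exp (- \<tau>) * lim_weight \<rho> \<tau>) * indicator {0..} \<tau> \<partial>lborel)"
  proof (intro nn_integral_cong)
    fix \<tau> :: real
    have "limit_integrand \<rho> \<tau> = (\<rho> * \<tau>\<^sup>2 * exp (- \<tau>) ^ 2 + exp (- \<tau>)) * lim_weight \<rho> \<tau> + exp (- \<tau>) * lim_weight \<rho> \<tau>"
      by (simp add: limit_integrand_def algebra_simps)
    moreover have "0 \<le> (\<rho> * \<tau>\<^sup>2 * exp (- \<tau>) ^ 2 + exp (- \<tau>)) * lim_weight \<rho> \<tau>"
      using \<rho> by (intro mult_nonneg_nonneg add_nonneg_nonneg less_imp_le[OF lim_weight_pos]) auto
    moreover have "0 \<le> exp (- \<tau>) * lim_weight \<rho> \<tau>" by (simp add: less_imp_le)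
    ultimately show "ennreal (limit_integrand \<rho> \<tau> * indicator {0..} \<tau>)
      = ennreal ((\<rho> * \<tau>\<^sup>2 * exp (- \<tau>) ^ 2 + exp (- \<tau>)) * lim_weight \<rho> \<tau>) * indicator {0..} \<tau>
         + ennreal (exp (- \<tau>) * lim_weight \<rho> \<tau>) * indicator {0..} \<tau>"
      by (cases "\<tau> \<ge> 0") (simp_all del: mult_nonneg_nonneg)
  qed
  also have "\<dots> = ennreal a + B"
    unfolding a_def B_def set_integral_lim_weight nn_integral_lim_weight_by_parts[OF \<rho>, symmetric]
    by (rule nn_integral_add) auto
  finally have sum: "(\<integral>\<^sup>+\<tau>. ennreal (limit_integrand \<rho> \<tau> * indicator {0..} \<tau>) \<partial>lborel) = ennreal a + B" .
  have I: "(\<integral>\<^sup>+\<tau>. ennreal (limit_integrand \<rho> \<tau> * indicator {0..} \<tau>) \<partial>lborel)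
     = ennreal (\<integral>\<tau>. limit_integrand \<rho> \<tau> * indicator {0..} \<tau> \<partial>lborel)"
    using nn by (intro nn_integral_eq_integral critical_integral_limit(2)[OF \<rho>]) auto
  \<comment> \<open>Finiteness of the second summand is inherited from the integrability of the
    limit.\<close>
  have "B \<noteq> top" using sum I by auto
  then have B: "B = ennreal (enn2real B)" by (simp add: top.not_eq_extremum)
  have "(LBINT s:{0..1}. exp (- (s - s * ln s) * \<rho>)) = enn2real B"
  proof -
    have "(LBINT s:{0..1}. exp (- (s - s * ln s) * \<rho>))
       = enn2real (\<integral>\<^sup>+s. ennreal (indicator {0..1} s *\<^sub>R exp (- (s - s * ln s) * \<rho>)) \<partial>lborel)"
      unfolding set_lebesgue_integral_def by (rule integral_eq_nn_integral) auto
    also have "(\<integral>\<^sup>+s. ennreal (indicator {0..1} s *\<^sub>R exp (- (s - s * ln s) * \<rho>)) \<partial>lborel) = B"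
      unfolding B_def by (intro nn_integral_cong) (auto split: split_indicator)
    finally show ?thesis .
  qed
  moreover have "(\<integral>\<tau>. limit_integrand \<rho> \<tau> * indicator {0..} \<tau> \<partial>lborel) = a + enn2real B"
  proof -
    have "ennreal (\<integral>\<tau>. limit_integrand \<rho> \<tau> * indicator {0..} \<tau> \<partial>lborel) = ennreal (a + enn2real B)"
      using sum I B a0 by (metis ennreal_plus enn2real_nonneg)
    then show ?thesis using nn a0
      by (subst (asm) ennreal_inj) (auto intro: Bochner_Integration.integral_nonneg)
  qed
  ultimately show ?thesis by (simp add: a_def)
qed

section \<open>The covariances at a point\<close>

text \<open>The products are expanded in falling factorials, the last one as (j(j-1))^2 =
  j(j-1)(j-2)(j-3) + 4 j(j-1)(j-2) + 2 j(j-1). The sums are the covariances of p' with itself, of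
  p'' with p', and of p'' with itself, up to powers of z.\<close>

lemma binomial_sum_square:
  assumes "n \<ge> 4"
  shows "(\<Sum>j\<le>n. real (n choose j) * (real j * real j) * t ^ j)
     = real n * t * (1 + t) ^ (n - 2) * (1 + real n * t)"
    and "(\<Sum>j\<le>n. real (n choose j) * (real j * (real j * (real j - 1))) * t ^ j)
     = real n * (real n - 1) * t\<^sup>2 * (1 + t) ^ (n - 3) * (2 + real n * t)"
    and "(\<Sum>j\<le>n. real (n choose j) * ((real j * (real j - 1)) * (real j * (real j - 1))) * t ^ j)
     = real n * (real n - 1) * t\<^sup>2 * (1 + t) ^ (n - 4) *
       ((real n - 2) * (real n - 3) * t\<^sup>2 + 4 * (real n - 2) * t * (1 + t) + 2 * (1 + t)\<^sup>2)"
proof -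
  obtain N where "n = N + 4"
    using assms by (metis add.commute le_iff_add)
  then have n: "n = Suc (Suc (Suc (Suc N)))" by simp
  have r: "real n = real N + 4" "real n - 1 = real N + 3" "real n - 2 = real N + 2" "real n - 3 = real N + 1"
    "n - 2 = N + 2" "n - 3 = N + 1" "n - 4 = N" by (simp_all add: n)
  have f1: "(\<Sum>j\<le>n. real (n choose j) * real j * t ^ j) = (real N + 4) * t * (1 + t) ^ (N + 3)"
    using binomial_sum_1[of "N + 3" t] unfolding n by (simp add: add_ac numeral_eq_Suc del: binomial_Suc_Suc sum.atMost_Suc)
  have f2: "(\<Sum>j\<le>n. real (n choose j) * (real j * (real j - 1)) * t ^ j)
      = (real N + 4) * (real N + 3) * t\<^sup>2 * (1 + t) ^ (N + 2)"
    using binomial_sum_falling_2[of "N + 2" t] unfolding n by (simp add: add_ac numeral_eq_Suc del: binomial_Suc_Suc sum.atMost_Suc)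
  have f3: "(\<Sum>j\<le>n. real (n choose j) * (real j * ((real j - 1) * (real j - 2))) * t ^ j)
      = (real N + 4) * (real N + 3) * (real N + 2) * t ^ 3 * (1 + t) ^ (N + 1)"
    using binomial_sum_falling_3[of "N + 1" t] unfolding n by (simp add: add_ac numeral_eq_Suc del: binomial_Suc_Suc sum.atMost_Suc)
  have f4: "(\<Sum>j\<le>n. real (n choose j) * (real j * ((real j - 1) * ((real j - 2) * (real j - 3)))) * t ^ j)
      = (real N + 4) * (real N + 3) * (real N + 2) * (real N + 1) * t ^ 4 * (1 + t) ^ N"
    using binomial_sum_falling_4[of N t] unfolding n by (simp add: add_ac numeral_eq_Suc del: binomial_Suc_Suc sum.atMost_Suc)
  have "(\<Sum>j\<le>n. real (n choose j) * (real j * real j) * t ^ j)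
     = (\<Sum>j\<le>n. real (n choose j) * (real j + real j * (real j - 1)) * t ^ j)"
    by (simp add: algebra_simps)
  also have "\<dots> = (real N + 4) * t * (1 + t) ^ (N + 2) * (1 + (real N + 4) * t)"
    unfolding binomial_sum_lin f1 f2 by (simp add: power_add power2_eq_square power3_eq_cube algebra_simps)
  finally show "(\<Sum>j\<le>n. real (n choose j) * (real j * real j) * t ^ j)
     = real n * t * (1 + t) ^ (n - 2) * (1 + real n * t)"
    unfolding r(2-) unfolding r(1) .
  have "(\<Sum>j\<le>n. real (n choose j) * (real j * (real j * (real j - 1))) * t ^ j)
     = (\<Sum>j\<le>n. real (n choose j) * (real j * ((real j - 1) * (real j - 2)) + 2 * (real j * (real j - 1))) * t ^ j)"
    by (simp add: algebra_simps)
  also have "\<dots> = (real N + 4) * (real N + 3) * t\<^sup>2 * (1 + t) ^ (N + 1) * (2 + (real N + 4) * t)"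
    unfolding binomial_sum_lin f2 f3 by (simp add: power_add power2_eq_square power3_eq_cube algebra_simps)
  finally show "(\<Sum>j\<le>n. real (n choose j) * (real j * (real j * (real j - 1))) * t ^ j)
     = real n * (real n - 1) * t\<^sup>2 * (1 + t) ^ (n - 3) * (2 + real n * t)"
    unfolding r(2-) unfolding r(1) .
  have "(\<Sum>j\<le>n. real (n choose j) * ((real j * (real j - 1)) * (real j * (real j - 1))) * t ^ j)
     = (\<Sum>j\<le>n. real (n choose j) * ((real j * ((real j - 1) * ((real j - 2) * (real j - 3)))
         + 4 * (real j * ((real j - 1) * (real j - 2)))) + 2 * (real j * (real j - 1))) * t ^ j)"
    by (simp add: algebra_simps)
  also have "\<dots> = (real N + 4) * (real N + 3) * t\<^sup>2 * (1 + t) ^ N *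
       ((real N + 2) * (real N + 1) * t\<^sup>2 + 4 * (real N + 2) * t * (1 + t) + 2 * (1 + t)\<^sup>2)"
    unfolding binomial_sum_lin f2 f3 f4
    by (simp add: power_add power_numeral_reduce algebra_simps)
  finally show "(\<Sum>j\<le>n. real (n choose j) * ((real j * (real j - 1)) * (real j * (real j - 1))) * t ^ j)
     = real n * (real n - 1) * t\<^sup>2 * (1 + t) ^ (n - 4) *
       ((real n - 2) * (real n - 3) * t\<^sup>2 + 4 * (real n - 2) * t * (1 + t) + 2 * (1 + t)\<^sup>2)"
    unfolding r(2-) unfolding r(1) .
qed

text \<open>The Gram entries are multiplied by powers of z and its conjugate because this turns them
  into real functions of t. The equations of \<open>gram_eq\<close> are triangular and are solved in
  turn; k, l and \<tau> come out as z, \<open>cnj z\<close> and its square times real functions of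
  t. Only the modulus of \<tau> is recorded, since the weight will be evaluated at y = w =
  0.\<close>

lemma critical_point_covariance:
  fixes z :: complex
  assumes g: "gram_eq r k s l \<tau> c gvv gyv gyy gwv gwy gww" and z: "z \<noteq> 0" and n: "n \<ge> 4"
    and t: "t = (norm z)\<^sup>2"
    and vv: "z * cnj z * gvv = of_real (real n * t * (1 + t) ^ (n - 2) * (1 + real n * t))"
    and yv: "cnj z * gyv = of_real (real n * t * (1 + t) ^ (n - 1))"
    and yy: "gyy = of_real ((1 + t) ^ n)"
    and wv: "z\<^sup>2 * cnj z * gwv = of_real (real n * (real n - 1) * t\<^sup>2 * (1 + t) ^ (n - 3) * (2 + real n * t))"
    and wy: "z\<^sup>2 * gwy = of_real (real n * (real n - 1) * t\<^sup>2 * (1 + t) ^ (n - 2))"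
    and ww: "z\<^sup>2 * (cnj z)\<^sup>2 * gww = of_real (real n * (real n - 1) * t\<^sup>2 * (1 + t) ^ (n - 4) *
       ((real n - 2) * (real n - 3) * t\<^sup>2 + 4 * (real n - 2) * t * (1 + t) + 2 * (1 + t)\<^sup>2))"
  shows "r = real n * (1 + t) ^ (n - 2) * (1 + real n * t)"
    and "s = (1 + t) ^ n / (1 + real n * t)"
    and "(norm \<tau>)\<^sup>2 = (real n)\<^sup>2 * (real n - 1)\<^sup>2 * t\<^sup>2 / (1 + t) ^ 4"
    and "c = 2 * real n * (real n - 1) * (1 + t) ^ (n - 4)"
proof -
  define N where "N = n - 4"
  define R where "R = 1 + t"
  define m where "m = real n"
  define u where "u = 1 + m * t"
  have nN: "n = N + 4" using n by (simp add: N_def)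
  have t0: "t > 0" using z by (simp add: t)
  have R0: "R > 0" and u0: "u > 0" and m0: "m > 0" using t0 n by (auto simp: R_def u_def m_def add_pos_nonneg)
  have zz: "z * cnj z = of_real t" unfolding t by (rule complex_norm_square[symmetric])
  have e: "n - 2 = N + 2" "n - 1 = N + 3" "n - 3 = N + 1" "n - 4 = N" using n by (auto simp: N_def)
  have z2: "z\<^sup>2 * (cnj z)\<^sup>2 = of_real (t\<^sup>2)" by (simp add: zz power_mult_distrib[symmetric])
  note G = g[unfolded gram_eq_def]
  have rs: "r > 0" "s > 0" using G by auto
  have Gyy: "of_real s + k * cnj k * of_real r = gyy" and Gwv: "l * of_real r = gwv"
    and Gwy: "l * of_real r * cnj k + \<tau> * of_real s = gwy"
    and Gww: "of_real c + l * cnj l * of_real r + \<tau> * cnj \<tau> * of_real s = gww"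
    using G by blast+
  have "complex_of_real (t * r) = of_real (m * t * R ^ (N + 2) * u)"
    using vv G by (simp add: zz e m_def R_def u_def)
  then have "t * r = t * (m * R ^ (N + 2) * u)" by (simp only: of_real_eq_iff mult_ac)
  then have r: "r = m * R ^ (N + 2) * u" using t0 by simp
  then show "r = real n * (1 + t) ^ (n - 2) * (1 + real n * t)" by (simp add: e m_def R_def u_def)
  have rc: "complex_of_real r \<noteq> 0" using rs by simp
  have k: "k = z * of_real (R / u)"
  proof -
    have "cnj z * (k * of_real r) = cnj z * (z * of_real (m * R ^ (N + 3)))"
    proof -
      have kr: "k * of_real r = gyv" using G by blast
      have "cnj z * (k * of_real r) = of_real t * of_real (m * R ^ (N + 3))"
        unfolding kr yv e m_def R_def by (simp add: mult_ac)
      then show ?thesis unfolding zz[symmetric] by (simp only: mult_ac)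
    qed
    then have "k * of_real r = z * of_real (m * R ^ (N + 3))" using z by simp
    also have "m * R ^ (N + 3) = R / u * r" using u0 unfolding r by (simp add: power_add power2_eq_square power3_eq_cube)
    finally have "k * of_real r = z * of_real (R / u) * of_real r" by simp
    then show ?thesis using rc by (metis mult_right_cancel)
  qed
  have kk: "k * cnj k = of_real (t * (R / u)\<^sup>2)"
    unfolding k by (simp add: power2_eq_square zz[symmetric])
  have "complex_of_real (s + t * (R / u)\<^sup>2 * r) = of_real (R ^ (N + 4))"
    using Gyy unfolding yy kk by (simp add: R_def nN)
  then have "s + t * (R / u)\<^sup>2 * r = R ^ (N + 4)" by (simp only: of_real_eq_iff)
  then have "s = R ^ (N + 4) - t * (R / u)\<^sup>2 * r" by simp
  also have "t * (R / u)\<^sup>2 * r = R ^ (N + 4) * (m * t / u)"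
    using u0 unfolding r by (simp add: power_add power_numeral_reduce)
  also have "R ^ (N + 4) - R ^ (N + 4) * (m * t / u) = R ^ (N + 4) / u"
    using u0 by (simp add: field_simps) (simp add: u_def algebra_simps)
  finally have s: "s = R ^ (N + 4) / u" .
  then show "s = (1 + t) ^ n / (1 + real n * t)" by (simp add: R_def u_def m_def nN)
  have sc: "complex_of_real s \<noteq> 0" using rs by simp
  define L where "L = (m - 1) * (2 + m * t) / (R * u)"
  have l: "l = cnj z * of_real L"
  proof -
    have "z\<^sup>2 * cnj z * (l * of_real r) = z\<^sup>2 * (cnj z)\<^sup>2 * of_real (m * (m - 1) * R ^ (N + 1) * (2 + m * t))"
      using wv unfolding z2 Gwv by (simp add: e m_def R_def mult_ac)
    then have "(z\<^sup>2 * cnj z) * (l * of_real r) = (z\<^sup>2 * cnj z) * (cnj z * of_real (m * (m - 1) * R ^ (N + 1) * (2 + m * t)))"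
      by (simp add: power2_eq_square mult_ac)
    then have "l * of_real r = cnj z * of_real (m * (m - 1) * R ^ (N + 1) * (2 + m * t))"
      using z by (subst (asm) mult_left_cancel) auto
    also have "m * (m - 1) * R ^ (N + 1) * (2 + m * t) = L * r"
      using u0 R0 unfolding r L_def by (simp add: power_add power2_eq_square power3_eq_cube)
    finally have "l * of_real r = cnj z * of_real L * of_real r" by simp
    then show ?thesis using rc by (metis mult_right_cancel)
  qed
  \<comment> \<open>The conditional mean of p''(z) given p(z) = x and p'(z) = 0 is (cnj z)^2 T x;
    the value of T comes from subtracting the regression on p' in the equation for
    \<open>gwy\<close>.\<close>
  define T where "T = - (m * (m - 1) / R\<^sup>2)"
  have tau: "\<tau> = (cnj z)\<^sup>2 * of_real T"
  proof -
    have "z\<^sup>2 * gwy = z\<^sup>2 * ((cnj z)\<^sup>2 * of_real (m * (m - 1) * R ^ (N + 2)))"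
      using wy unfolding mult.assoc[symmetric] z2 by (simp add: e m_def R_def mult_ac)
    then have wy': "gwy = (cnj z)\<^sup>2 * of_real (m * (m - 1) * R ^ (N + 2))" using z by simp
    have "\<tau> * of_real s = gwy - l * of_real r * cnj k" unfolding Gwy[symmetric] by simp
    also have "l * of_real r * cnj k = (cnj z)\<^sup>2 * of_real (L * r * (R / u))"
      unfolding l k by (simp add: power2_eq_square)
    also have "gwy - \<dots> = (cnj z)\<^sup>2 * of_real (m * (m - 1) * R ^ (N + 2) - L * r * (R / u))"
      unfolding wy' by (simp only: of_real_diff right_diff_distrib)
    also have "m * (m - 1) * R ^ (N + 2) - L * r * (R / u) = T * s"
      using u0 R0 unfolding r L_def s T_def
      by (simp add: power_add power_numeral_reduce field_simps) (simp add: u_def algebra_simps)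
    finally have "\<tau> * of_real s = (cnj z)\<^sup>2 * of_real T * of_real s" by simp
    then show ?thesis using sc by (metis mult_right_cancel)
  qed
  have "norm \<tau> = t * \<bar>T\<bar>" unfolding tau by (simp add: norm_mult norm_power t)
  then show "(norm \<tau>)\<^sup>2 = (real n)\<^sup>2 * (real n - 1)\<^sup>2 * t\<^sup>2 / (1 + t) ^ 4"
    by (simp add: T_def m_def R_def power_mult_distrib power_divide)
  have ll: "l * cnj l = of_real (t * L\<^sup>2)" unfolding l by (simp add: power2_eq_square zz[symmetric])
  have tt: "\<tau> * cnj \<tau> = of_real (t\<^sup>2 * T\<^sup>2)" unfolding tau by (simp add: power2_eq_square zz[symmetric])
  define W where "W = m * (m - 1) * R ^ N * ((m - 2) * (m - 3) * t\<^sup>2 + 4 * (m - 2) * t * R + 2 * R\<^sup>2)"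
  have "complex_of_real (t\<^sup>2) * gww = of_real (t\<^sup>2) * of_real W"
    using ww unfolding z2 by (simp add: W_def e m_def R_def mult_ac)
  then have gww: "gww = of_real W" using t0 by simp
  have "complex_of_real (c + t * L\<^sup>2 * r + t\<^sup>2 * T\<^sup>2 * s) = of_real W"
    using Gww unfolding gww ll tt by simp
  then have "c + t * L\<^sup>2 * r + t\<^sup>2 * T\<^sup>2 * s = W" by (simp only: of_real_eq_iff)
  then have c: "c = W - t * L\<^sup>2 * r - t\<^sup>2 * T\<^sup>2 * s" by simp
  have a1: "t * L\<^sup>2 * r = m * (m - 1)\<^sup>2 * t * R ^ N * ((2 + m * t)\<^sup>2 / u)"
    using u0 R0 unfolding r L_def by (simp add: power_add power_numeral_reduce field_simps)
  have a2: "t\<^sup>2 * T\<^sup>2 * s = m * (m - 1)\<^sup>2 * t * R ^ N * (m * t / u)"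
    using u0 R0 unfolding s T_def by (simp add: power_add power_numeral_reduce field_simps)
  \<comment> \<open>(2 + m t)^2 + m t = (1 + m t) (4 + m t), so the denominator u cancels from the
    conditional variance c.\<close>
  have a3: "(2 + m * t)\<^sup>2 / u + m * t / u = 4 + m * t"
    using u0 by (simp add: field_simps power2_eq_square) (simp add: u_def algebra_simps)
  have "c = W - m * (m - 1)\<^sup>2 * t * R ^ N * ((2 + m * t)\<^sup>2 / u + m * t / u)"
    unfolding c a1 a2 by (simp add: algebra_simps)
  also have "\<dots> = m * (m - 1) * R ^ N * 2"
    unfolding a3 W_def by (simp add: R_def power2_eq_square algebra_simps)
  finally show "c = 2 * real n * (real n - 1) * (1 + t) ^ (n - 4)"
    by (simp add: m_def R_def e)
qed

text \<open>The parameters n, z, 1, 0, 0, 0 encode the contribution of the terms j = 0, 1 to (p, p',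
  p''): V = \<open>a\<^sub>1\<close> sqrt n has variance n, Y - z V = \<open>a\<^sub>0\<close> has
  variance 1, and W = 0. Integrating over the remaining coefficients gives the weight of the full
  triple, taken at value x and derivative 0.\<close>

lemma gaussian_critical_weight:
  fixes z x :: complex
  assumes n: "n \<ge> 4" and z: "z \<noteq> 0"
  defines "D \<equiv> \<lambda>j. of_real (sqrt (real (n choose j))) * z ^ j"
    and "Q \<equiv> \<lambda>j. of_real (real j * sqrt (real (n choose j))) * z ^ (j - 1)"
    and "E \<equiv> \<lambda>j. of_real (real j * (real j - 1) * sqrt (real (n choose j))) * z ^ (j - 2)"
  shows "(\<integral>\<^sup>+b. ennreal (gauss_weight (real n) z 1 0 0 0 (x - (\<Sum>j\<in>{2..n}. b j * D j))
          (- (\<Sum>j\<in>{2..n}. b j * Q j)) (\<Sum>j\<in>{2..n}. b j * E j)) \<partial>Pi\<^sub>M {2..n} (\<lambda>_. std_gauss))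
       = ennreal (critical_integrand n ((norm x)\<^sup>2) ((norm z)\<^sup>2) / pi\<^sup>2)"
proof -
  define t where "t = (norm z)\<^sup>2"
  define B where "B = (\<lambda>j. of_real (sqrt (real (n choose j))) * z ^ j)"
  have BB: "B j * cnj (B j) = of_real (real (n choose j) * t ^ j)" for j
  proof -
    have "B j * cnj (B j) = of_real ((norm (B j))\<^sup>2)" by (rule complex_norm_square[symmetric])
    also have "(norm (B j))\<^sup>2 = real (n choose j) * t ^ j"
      by (simp add: B_def t_def norm_mult norm_power power_mult_distrib power_mult[symmetric] mult.commute)
    finally show ?thesis .
  qed
  have DB: "D j = B j" for j by (simp add: D_def B_def)
  have QB: "z * Q j = of_real (real j) * B j" for j
    by (cases j) (simp_all add: Q_def B_def)
  have EB: "z\<^sup>2 * E j = of_real (real j * (real j - 1)) * B j" for j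
    by (cases j rule: nat.exhaust; cases "j - 1") (simp_all add: E_def B_def power2_eq_square)
  have ins: "{..n} = insert 0 (insert 1 {2..n})" using n by auto
  have split: "(\<Sum>j\<le>n. f j) = f 0 + f 1 + (\<Sum>j\<in>{2..n}. f j)" for f :: "nat \<Rightarrow> complex"
    unfolding ins by (subst sum.insert) (auto simp: add_ac)
  have sn: "complex_of_real (sqrt (real n)) * of_real (sqrt (real n)) = of_nat n"
    by (simp flip: of_real_mult)
  have g0: "gram_eq (real n) z 1 0 0 0 (of_nat n) (z * of_nat n) (1 + z * cnj z * of_nat n) 0 0 0"
    using n by (simp add: gram_eq_def)
  \<comment> \<open>The initial Gram entries are the summands j = 0, 1, so the sums over 2..n
    complete to full binomial sums.\<close>
  have s1: "of_nat n + (\<Sum>j\<in>{2..n}. Q j * cnj (Q j)) = (\<Sum>j\<le>n. Q j * cnj (Q j))"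
    and s2: "z * of_nat n + (\<Sum>j\<in>{2..n}. D j * cnj (Q j)) = (\<Sum>j\<le>n. D j * cnj (Q j))"
    and s3: "1 + z * cnj z * of_nat n + (\<Sum>j\<in>{2..n}. D j * cnj (D j)) = (\<Sum>j\<le>n. D j * cnj (D j))"
    and s4: "0 + (\<Sum>j\<in>{2..n}. E j * cnj (Q j)) = (\<Sum>j\<le>n. E j * cnj (Q j))"
    and s5: "0 + (\<Sum>j\<in>{2..n}. E j * cnj (D j)) = (\<Sum>j\<le>n. E j * cnj (D j))"
    and s6: "0 + (\<Sum>j\<in>{2..n}. E j * cnj (E j)) = (\<Sum>j\<le>n. E j * cnj (E j))"
    unfolding split by (simp_all add: D_def Q_def E_def sn mult_ac)
  obtain r k s l \<tau> c where
    g: "gram_eq r k s l \<tau> c (\<Sum>j\<le>n. Q j * cnj (Q j)) (\<Sum>j\<le>n. D j * cnj (Q j)) (\<Sum>j\<le>n. D j * cnj (D j))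
      (\<Sum>j\<le>n. E j * cnj (Q j)) (\<Sum>j\<le>n. E j * cnj (D j)) (\<Sum>j\<le>n. E j * cnj (E j))"
    and I: "\<And>x y w. (\<integral>\<^sup>+b. ennreal (gauss_weight (real n) z 1 0 0 0 (x - (\<Sum>j\<in>{2..n}. b j * D j))
          (y - (\<Sum>j\<in>{2..n}. b j * Q j)) (w + (\<Sum>j\<in>{2..n}. b j * E j))) \<partial>Pi\<^sub>M {2..n} (\<lambda>_. std_gauss))
        = ennreal (gauss_weight r k s l \<tau> c x y w)"
    using gauss_weight_product[OF _ g0, of "{2..n}" Q D E] unfolding s1 s2 s3 s4 s5 s6 by auto
  have vv: "z * cnj z * (\<Sum>j\<le>n. Q j * cnj (Q j)) = of_real (\<Sum>j\<le>n. real (n choose j) * (real j * real j) * t ^ j)"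
  proof -
    have "z * cnj z * (\<Sum>j\<le>n. Q j * cnj (Q j)) = (\<Sum>j\<le>n. (z * Q j) * cnj (z * Q j))"
      by (simp add: sum_distrib_left mult_ac)
    also have "\<dots> = (\<Sum>j\<le>n. of_real (real j * real j) * (B j * cnj (B j)))"
      unfolding QB by (simp add: mult_ac)
    finally show ?thesis unfolding BB by (simp add: mult_ac)
  qed
  have yv: "cnj z * (\<Sum>j\<le>n. D j * cnj (Q j)) = of_real (\<Sum>j\<le>n. real (n choose j) * real j * t ^ j)"
  proof -
    have "cnj z * (\<Sum>j\<le>n. D j * cnj (Q j)) = (\<Sum>j\<le>n. B j * cnj (z * Q j))"
      by (simp add: sum_distrib_left mult_ac DB)
    also have "\<dots> = (\<Sum>j\<le>n. of_real (real j) * (B j * cnj (B j)))"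
      unfolding QB by (simp add: mult_ac)
    finally show ?thesis unfolding BB by (simp add: mult_ac)
  qed
  have yy: "(\<Sum>j\<le>n. D j * cnj (D j)) = of_real (\<Sum>j\<le>n. real (n choose j) * t ^ j)"
    unfolding DB BB by simp
  have wv: "z\<^sup>2 * cnj z * (\<Sum>j\<le>n. E j * cnj (Q j))
      = of_real (\<Sum>j\<le>n. real (n choose j) * (real j * (real j * (real j - 1))) * t ^ j)"
  proof -
    have "z\<^sup>2 * cnj z * (\<Sum>j\<le>n. E j * cnj (Q j)) = (\<Sum>j\<le>n. (z\<^sup>2 * E j) * cnj (z * Q j))"
      by (simp add: sum_distrib_left mult_ac)
    also have "\<dots> = (\<Sum>j\<le>n. of_real (real j * (real j * (real j - 1))) * (B j * cnj (B j)))"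
      unfolding QB EB by (simp add: mult_ac)
    finally show ?thesis unfolding BB by (simp add: mult_ac)
  qed
  have wy: "z\<^sup>2 * (\<Sum>j\<le>n. E j * cnj (D j)) = of_real (\<Sum>j\<le>n. real (n choose j) * (real j * (real j - 1)) * t ^ j)"
  proof -
    have "z\<^sup>2 * (\<Sum>j\<le>n. E j * cnj (D j)) = (\<Sum>j\<le>n. (z\<^sup>2 * E j) * cnj (B j))"
      by (simp add: sum_distrib_left mult_ac DB)
    also have "\<dots> = (\<Sum>j\<le>n. of_real (real j * (real j - 1)) * (B j * cnj (B j)))"
      unfolding EB by (simp add: mult_ac)
    finally show ?thesis unfolding BB by (simp add: mult_ac)
  qed
  have ww: "z\<^sup>2 * (cnj z)\<^sup>2 * (\<Sum>j\<le>n. E j * cnj (E j))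
      = of_real (\<Sum>j\<le>n. real (n choose j) * ((real j * (real j - 1)) * (real j * (real j - 1))) * t ^ j)"
  proof -
    have "z\<^sup>2 * (cnj z)\<^sup>2 * (\<Sum>j\<le>n. E j * cnj (E j)) = (\<Sum>j\<le>n. (z\<^sup>2 * E j) * cnj (z\<^sup>2 * E j))"
      by (simp add: sum_distrib_left mult_ac)
    also have "\<dots> = (\<Sum>j\<le>n. of_real ((real j * (real j - 1)) * (real j * (real j - 1))) * (B j * cnj (B j)))"
      unfolding EB by (simp add: mult_ac)
    finally show ?thesis unfolding BB by (simp add: mult_ac)
  qed
  define N where "N = n - 2"
  have N: "n = Suc (Suc N)" using n by (simp add: N_def)
  have m1: "(\<Sum>j\<le>n. real (n choose j) * real j * t ^ j) = real n * t * (1 + t) ^ (n - 1)"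
    unfolding N by (subst binomial_sum_1) simp
  have m2: "(\<Sum>j\<le>n. real (n choose j) * (real j * (real j - 1)) * t ^ j)
      = real n * (real n - 1) * t\<^sup>2 * (1 + t) ^ (n - 2)"
    unfolding N by (subst binomial_sum_falling_2) simp
  note cov = critical_point_covariance[OF g z n t_def vv[unfolded binomial_sum_square[OF n]] yv[unfolded m1]
      yy[unfolded binomial_sum_0] wv[unfolded binomial_sum_square[OF n]] wy[unfolded m2]
      ww[unfolded binomial_sum_square[OF n]]]
  have t0: "t \<ge> 0" by (simp add: t_def)
  define R where "R = 1 + t"
  have R: "R > 0" using t0 by (simp add: R_def)
  have u: "1 + real n * t > 0" using t0 by (simp add: add_pos_nonneg)
  obtain K where K: "n = K + 4" using n by (metis add.commute le_iff_add)
  have "gauss_weight r k s l \<tau> c x 0 0 = exp (- ((norm x)\<^sup>2 / s)) * ((norm \<tau>)\<^sup>2 * (norm x)\<^sup>2 + c) / (pi\<^sup>2 * (r * s))"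
    by (simp add: gauss_weight_def norm_mult power_mult_distrib mult_ac)
  also have "r * s = real n * R ^ (n - 2) * R ^ n"
    unfolding cov using u by (simp add: R_def)
  also have "exp (- ((norm x)\<^sup>2 / s)) * ((norm \<tau>)\<^sup>2 * (norm x)\<^sup>2 + c) / (pi\<^sup>2 * (real n * R ^ (n - 2) * R ^ n))
     = exp (- ((norm x)\<^sup>2 / s)) * (((norm \<tau>)\<^sup>2 * (norm x)\<^sup>2 + c) / (real n * R ^ (n - 2) * R ^ n)) / pi\<^sup>2"
    by simp
  also have "((norm \<tau>)\<^sup>2 * (norm x)\<^sup>2 + c) / (real n * R ^ (n - 2) * R ^ n)
     = real n * (real n - 1)\<^sup>2 * t\<^sup>2 * (norm x)\<^sup>2 / R ^ (2 * n + 2) + 2 * (real n - 1) / R ^ (n + 2)"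
  proof -
    define m where "m = real n"
    have m: "m > 0" using n by (simp add: m_def)
    have "n - 2 = K + 2" "n - 4 = K" using K by auto
    define P where "P = R ^ (K + 2) * R ^ (K + 4)"
    have P: "P > 0" using R by (simp add: P_def)
    have p1: "R ^ (2 * n + 2) = R ^ 4 * P"
      unfolding P_def K power_add[symmetric] by (rule arg_cong[where f = "power R"]) simp
    have p2: "P = R ^ K * R ^ (n + 2)"
      unfolding P_def K power_add[symmetric] by (rule arg_cong[where f = "power R"]) simp
    have "real n * R ^ (n - 2) * R ^ n = m * P"
      using K by (simp add: P_def m_def)
    then have "((norm \<tau>)\<^sup>2 * (norm x)\<^sup>2 + c) / (real n * R ^ (n - 2) * R ^ n)
      = (m\<^sup>2 * (m - 1)\<^sup>2 * t\<^sup>2 / R ^ 4 * (norm x)\<^sup>2) / (m * P) + 2 * m * (m - 1) * R ^ K / (m * P)"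
      unfolding cov m_def[symmetric] R_def[symmetric] \<open>n - 4 = K\<close> by (simp only: add_divide_distrib)
    also have "(m\<^sup>2 * (m - 1)\<^sup>2 * t\<^sup>2 / R ^ 4 * (norm x)\<^sup>2) / (m * P) = m * (m - 1)\<^sup>2 * t\<^sup>2 * (norm x)\<^sup>2 / R ^ (2 * n + 2)"
      unfolding p1 using m by (simp add: power2_eq_square mult_ac)
    also have "2 * m * (m - 1) * R ^ K / (m * P) = 2 * (m - 1) / R ^ (n + 2)"
      unfolding p2 using m R by simp
    finally show ?thesis by (simp add: m_def)
  qed
  also have "exp (- ((norm x)\<^sup>2 / s)) = exp (- (norm x)\<^sup>2 * (1 + real n * t) / (1 + t) ^ n)"
    unfolding cov by simp
  finally have "gauss_weight r k s l \<tau> c x 0 0 = critical_integrand n ((norm x)\<^sup>2) t / pi\<^sup>2"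
    by (simp add: critical_integrand_def R_def)
  with I[of x 0 0] show ?thesis by (simp add: t_def)
qed

section \<open>Bump functions and uniqueness of densities\<close>

lemma frechet_derivative_eqI:
  "(f has_derivative f') (at x) \<Longrightarrow> frechet_derivative f (at x) = f'"
  using frechet_derivative_at by metis

lemma Ck_SucI:
  assumes "\<And>x. (f has_derivative f' x) (at x)" "\<And>v. Ck k (\<lambda>x. f' x v)"
  shows "Ck (Suc k) f"
  using assms frechet_derivative_eqI[OF assms(1)] by (auto simp: differentiable_def)

lemma Ck_SucE:
  assumes "Ck (Suc k) f"
  obtains f' where "\<And>x. (f has_derivative f' x) (at x)" "\<And>v. Ck k (\<lambda>x. f' x v)"
  using assms that[of "\<lambda>x. frechet_derivative f (at x)"] by (auto simp: frechet_derivative_works)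

text \<open>For the product rule, where one factor stays undifferentiated.\<close>

lemma Ck_Suc_imp_Ck: "Ck (Suc k) f \<Longrightarrow> Ck k f"
proof (induction k arbitrary: f)
  case 0
  then show ?case
    by (auto simp: continuous_on_eq_continuous_at differentiable_imp_continuous_within)
next
  case (Suc k)
  then show ?case by (metis Ck.simps(2))
qed

lemma Ck_add: "Ck k f \<Longrightarrow> Ck k g \<Longrightarrow> Ck k (\<lambda>x. f x + g x)"
proof (induction k arbitrary: f g)
  case (Suc k)
  obtain f' g' where *: "\<And>x. (f has_derivative f' x) (at x)" "\<And>v. Ck k (\<lambda>x. f' x v)"
    "\<And>x. (g has_derivative g' x) (at x)" "\<And>v. Ck k (\<lambda>x. g' x v)"
    using Suc.prems by (metis Ck_SucE)
  show ?case
    by (rule Ck_SucI[where f' = "\<lambda>x v. f' x v + g' x v"]) (auto intro!: has_derivative_add * Suc.IH)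
qed (auto intro: continuous_on_add)

lemma Ck_mult:
  fixes f g :: "'a::real_normed_vector \<Rightarrow> real"
  shows "Ck k f \<Longrightarrow> Ck k g \<Longrightarrow> Ck k (\<lambda>x. f x * g x)"
proof (induction k arbitrary: f g)
  case (Suc k)
  obtain f' g' where *: "\<And>x. (f has_derivative f' x) (at x)" "\<And>v. Ck k (\<lambda>x. f' x v)"
    "\<And>x. (g has_derivative g' x) (at x)" "\<And>v. Ck k (\<lambda>x. g' x v)"
    using Suc.prems by (metis Ck_SucE)
  have "Ck k f" "Ck k g" using Suc.prems Ck_Suc_imp_Ck by blast+
  then show ?case
    by (intro Ck_SucI[where f' = "\<lambda>x v. f x * g' x v + f' x v * g x"])
       (auto intro!: has_derivative_mult * Suc.IH Ck_add)
qed (auto intro: continuous_on_mult)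

lemma Ck_const: "Ck k (\<lambda>x. c)"
proof (induction k arbitrary: c)
  case (Suc k)
  show ?case by (rule Ck_SucI[where f' = "\<lambda>x v. 0"]) (auto intro: Suc.IH)
qed simp

text \<open>The classical smooth function exp(-1/t), with powers of 1/t included so that the
  derivative of each member is a linear combination of members; smoothness then follows by induction
  with m arbitrary.\<close>

definition flat_exp :: "nat \<Rightarrow> real \<Rightarrow> real" where
  "flat_exp m t = (if t > 0 then inverse t ^ m * exp (- inverse t) else 0)"

lemma tendsto_flat_exp: "(flat_exp m \<longlongrightarrow> 0) (at 0)"
proof (rule filterlim_split_at_real)
  show "(flat_exp m \<longlongrightarrow> 0) (at_left 0)"
    by (rule tendsto_eventually) (auto simp: flat_exp_def eventually_at_left_real intro: eventually_at_leftI[of "-1"])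
  have "((\<lambda>t::real. (inverse t) ^ m / exp (inverse t)) \<longlongrightarrow> 0) (at_right 0)"
    by (rule filterlim_compose[OF tendsto_power_div_exp_0 filterlim_inverse_at_top_right])
  moreover have "\<forall>\<^sub>F t::real in at_right 0. (inverse t) ^ m / exp (inverse t) = flat_exp m t"
    by (rule eventually_at_rightI[of _ 1]) (auto simp: flat_exp_def exp_minus divide_inverse)
  ultimately show "(flat_exp m \<longlongrightarrow> 0) (at_right 0)"
    using Lim_transform_eventually by blast
qed

lemma DERIV_flat_exp:
  "(flat_exp m has_real_derivative (- real m * flat_exp (Suc m) t + flat_exp (m + 2) t)) (at t)"
proof (cases t "0::real" rule: linorder_cases)
  case less
  have "((\<lambda>t. 0) has_real_derivative 0) (at t)" by simp
  then have "(flat_exp m has_real_derivative 0) (at t)"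
    by (rule has_field_derivative_transform_within_open[of _ _ _ "{..<0}"]) (use less in \<open>auto simp: flat_exp_def\<close>)
  then show ?thesis using less by (simp add: flat_exp_def)
next
  case equal
  \<comment> \<open>At 0 the difference quotient is itself \<open>flat_exp (Suc m)\<close>, which
    tends to 0.\<close>
  have "((\<lambda>h. (flat_exp m (0 + h) - flat_exp m 0) / h) \<longlongrightarrow> 0) (at 0)"
  proof (rule Lim_transform_eventually[OF tendsto_flat_exp[of "Suc m"]])
    show "\<forall>\<^sub>F h in at 0. flat_exp (Suc m) h = (flat_exp m (0 + h) - flat_exp m 0) / h"
      by (intro always_eventually) (auto simp: flat_exp_def divide_inverse)
  qed
  then show ?thesis using equal by (simp add: DERIV_def flat_exp_def)
next
  case greater
  have "((\<lambda>t. inverse t ^ m * exp (- inverse t)) has_real_derivative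
     (- real m * (inverse t ^ Suc m * exp (- inverse t)) + inverse t ^ (m + 2) * exp (- inverse t))) (at t)"
    using greater
    by (auto intro!: derivative_eq_intros simp: algebra_simps power2_eq_square)
       (cases m; simp add: algebra_simps)
  then have "(flat_exp m has_real_derivative
     (- real m * (inverse t ^ Suc m * exp (- inverse t)) + inverse t ^ (m + 2) * exp (- inverse t))) (at t)"
    by (rule has_field_derivative_transform_within_open[of _ _ _ "{0<..}"]) (use greater in \<open>auto simp: flat_exp_def\<close>)
  then show ?thesis using greater by (simp add: flat_exp_def)
qed

lemma Ck_flat_exp_affine:
  fixes B :: "'a::real_normed_vector \<Rightarrow> real"
  assumes B: "bounded_linear B"
  shows "Ck k (\<lambda>x. flat_exp m (b + B x))"
proof (induction k arbitrary: m)
  have der: "((\<lambda>x. flat_exp m (b + B x)) has_derivative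
      (\<lambda>v. (- real m * flat_exp (Suc m) (b + B x) + flat_exp (m + 2) (b + B x)) * B v)) (at x)" for x m
  proof -
    have "((\<lambda>x. b + B x) has_derivative B) (at x)"
      using B by (auto intro!: derivative_eq_intros bounded_linear_imp_has_derivative)
    from has_derivative_compose[OF this DERIV_flat_exp[unfolded has_field_derivative_def]]
    show ?thesis by simp
  qed
  {
    case 0
    then show ?case
      using der has_derivative_continuous by (auto simp: continuous_on_eq_continuous_at) blast
  next
    case (Suc k)
    show ?case
      by (rule Ck_SucI[OF der]) (intro Ck_mult Ck_add Ck_const Suc.IH)
  }
qed

text \<open>A product of four one-sided factors, positive exactly on an open square of half-side e
  around \<open>x0\<close>. Each factor has an affine argument, so only affine compositions have to
  be differentiated.\<close>

definition bump :: "complex \<Rightarrow> real \<Rightarrow> complex \<Rightarrow> real" where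
  "bump x0 e x = flat_exp 0 (e - Re x0 + Re x) * flat_exp 0 (e + Re x0 - Re x) *
     (flat_exp 0 (e - Im x0 + Im x) * flat_exp 0 (e + Im x0 - Im x))"

lemma bump_nonneg: "bump x0 e x \<ge> 0"
  by (simp add: bump_def flat_exp_def)

lemma bump_centre_pos: "e > 0 \<Longrightarrow> bump x0 e x0 > 0"
  by (simp add: bump_def flat_exp_def)

lemma bump_support:
  assumes "bump x0 e x \<noteq> 0"
  shows "x \<in> ball x0 (2 * e)"
proof -
  have "e - Re x0 + Re x > 0" "e + Re x0 - Re x > 0" "e - Im x0 + Im x > 0" "e + Im x0 - Im x > 0"
    using assms by (auto simp: bump_def flat_exp_def split: if_splits)
  then have "\<bar>Re (x0 - x)\<bar> < e" "\<bar>Im (x0 - x)\<bar> < e" by auto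
  then have "norm (x0 - x) < 2 * e" using cmod_le[of "x0 - x"] by linarith
  then show ?thesis by (simp add: dist_norm)
qed

lemma test_function_bump: "test_function (bump x0 e)"
proof -
  have "Ck k (bump x0 e)" for k
  proof -
    have 1: "Ck k (\<lambda>x. flat_exp 0 (b + Re x))" "Ck k (\<lambda>x. flat_exp 0 (b + Im x))" for b
      by (rule Ck_flat_exp_affine[OF bounded_linear_Re] Ck_flat_exp_affine[OF bounded_linear_Im])+
    have 2: "Ck k (\<lambda>x. flat_exp 0 (b - Re x))" "Ck k (\<lambda>x. flat_exp 0 (b - Im x))" for b
      using Ck_flat_exp_affine[OF bounded_linear_minus[OF bounded_linear_Re], of k 0 b]
        Ck_flat_exp_affine[OF bounded_linear_minus[OF bounded_linear_Im], of k 0 b] by simp_all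
    show ?thesis unfolding bump_def[abs_def] by (intro Ck_mult 1 2)
  qed
  moreover have "compact (closure {x. bump x0 e x \<noteq> 0})"
  proof -
    have "{x. bump x0 e x \<noteq> 0} \<subseteq> ball x0 (2 * e)" using bump_support by blast
    then have "bounded {x. bump x0 e x \<noteq> 0}" by (rule bounded_subset[OF bounded_ball])
    then show ?thesis by (simp add: compact_closure)
  qed
  ultimately show ?thesis by (simp add: test_function_def)
qed

lemma continuous_test_function: "test_function \<phi> \<Longrightarrow> continuous_on UNIV \<phi>"
  by (metis Ck.simps(1) test_function_def)

lemma integrable_test_function_mult:
  assumes "test_function \<phi>" "continuous_on UNIV D"
  shows "integrable lborel (\<lambda>x. \<phi> x * (D x :: real))"
proof -
  let ?K = "closure {x. \<phi> x \<noteq> 0}"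
  have "integrable lborel (\<lambda>x. indicator ?K x *\<^sub>R (\<phi> x * D x))"
    using assms continuous_test_function[OF assms(1)]
    by (intro borel_integrable_compact continuous_on_mult)
       (auto simp: test_function_def intro: continuous_on_subset)
  moreover have "(\<lambda>x. indicator ?K x *\<^sub>R (\<phi> x * D x)) = (\<lambda>x. \<phi> x * D x)"
    using closure_subset[of "{x. \<phi> x \<noteq> 0}"] by (auto simp: fun_eq_iff split: split_indicator)
  ultimately show ?thesis by simp
qed

text \<open>A bump supported where \<open>D1\<close> exceeds \<open>D2\<close> would separate the
  two integrals. The inequality suffices for uniqueness, since the roles can be exchanged.\<close>

lemma expected_density_le:
  assumes 1: "is_expected_density M p D1" and 2: "is_expected_density M p D2"
  shows "D1 x0 \<le> D2 x0"
proof (rule ccontr)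
  assume "\<not> ?thesis"
  then have pos: "D1 x0 - D2 x0 > 0" by simp
  have c: "continuous_on UNIV D1" "continuous_on UNIV D2"
    using 1 2 by (auto simp: is_expected_density_def)
  have "open {x. D1 x - D2 x > 0}"
    using c by (intro open_Collect_less continuous_intros)
  then obtain r where r: "r > 0" "ball x0 r \<subseteq> {x. D1 x - D2 x > 0}"
    using pos by (metis mem_Collect_eq open_contains_ball)
  define \<phi> where "\<phi> = bump x0 (r / 2)"
  have t: "test_function \<phi>" by (simp add: \<phi>_def test_function_bump)
  have c\<phi>: "continuous_on UNIV \<phi>" by (rule continuous_test_function[OF t])
  note i = integrable_test_function_mult[OF t c(1)] integrable_test_function_mult[OF t c(2)]
  let ?E = "\<integral>\<omega>. (\<Sum>z | poly (pderiv (p \<omega>)) z = 0. \<phi> (poly (p \<omega>) z)) \<partial>M"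
  have "?E = (\<integral>x. \<phi> x * D1 x \<partial>lborel)" using 1 t unfolding is_expected_density_def by blast
  moreover have "?E = (\<integral>x. \<phi> x * D2 x \<partial>lborel)" using 2 t unfolding is_expected_density_def by blast
  ultimately have "(\<integral>x. \<phi> x * D1 x \<partial>lborel) = (\<integral>x. \<phi> x * D2 x \<partial>lborel)" by simp
  then have 0: "(\<integral>x. \<phi> x * D1 x - \<phi> x * D2 x \<partial>lborel) = 0"
    using i by simp
  have nn: "\<phi> x * D1 x - \<phi> x * D2 x \<ge> 0" for x
  proof (cases "\<phi> x = 0")
    case False
    then have "x \<in> ball x0 r" using bump_support[of x0 "r/2" x] by (simp add: \<phi>_def)
    then have "D1 x - D2 x > 0" using r by blast
    then have "0 \<le> \<phi> x * (D1 x - D2 x)" using bump_nonneg by (simp add: \<phi>_def)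
    then show ?thesis by (simp add: algebra_simps)
  qed simp
  have "AE x in lborel. \<phi> x * D1 x - \<phi> x * D2 x = 0"
    using 0 i nn by (subst (asm) integral_nonneg_eq_0_iff_AE) auto
  then have "AE x in lebesgue. x \<in> {x. \<phi> x * D1 x - \<phi> x * D2 x = 0}"
    by (simp add: AE_completion)
  moreover have "closed {x. \<phi> x * D1 x - \<phi> x * D2 x = 0}"
    using c c\<phi> by (intro closed_Collect_eq continuous_intros)
  ultimately have "x0 \<in> {x. \<phi> x * D1 x - \<phi> x * D2 x = 0}"
    by (rule mem_closed_if_AE_lebesgue[rotated])
  then have "\<phi> x0 * (D1 x0 - D2 x0) = 0" by (simp add: algebra_simps)
  then show False using pos bump_centre_pos[of "r/2" x0] r by (simp add: \<phi>_def)
qed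

lemma expected_density_eqI:
  assumes "is_expected_density M p D"
  shows "expected_density M p = D"
  unfolding expected_density_def
  using assms expected_density_le by (intro the_equality) (auto intro!: ext antisym)

section \<open>Critical values\<close>

text \<open>\<open>SU2_poly\<close> as a function of the coefficient vector, so that expectations
  become integrals over a finite product of Gaussian measures.\<close>

definition coeff_poly :: "nat \<Rightarrow> (nat \<Rightarrow> complex) \<Rightarrow> complex poly" where
  "coeff_poly n b = (\<Sum>j\<le>n. monom (b j * of_real (sqrt (real (n choose j)))) j)"

text \<open>\<open>coord0\<close>, \<open>coord1\<close> and \<open>coord2\<close> are the
  coefficients of p(z), p'(z) and p''(z) as linear forms in b. The truncated exponents j - 1 and j -
  2 are harmless: the prefactor vanishes whenever truncation occurs.\<close>

definition coord0 :: "nat \<Rightarrow> complex \<Rightarrow> nat \<Rightarrow> complex" where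
  "coord0 n z j = of_real (sqrt (real (n choose j))) * z ^ j"

definition coord1 :: "nat \<Rightarrow> complex \<Rightarrow> nat \<Rightarrow> complex" where
  "coord1 n z j = of_real (real j * sqrt (real (n choose j))) * z ^ (j - 1)"

definition coord2 :: "nat \<Rightarrow> complex \<Rightarrow> nat \<Rightarrow> complex" where
  "coord2 n z j = of_real (real j * (real j - 1) * sqrt (real (n choose j))) * z ^ (j - 2)"

lemma borel_measurable_coord [measurable (raw)]:
  assumes [measurable]: "f \<in> borel_measurable M"
  shows "(\<lambda>x. coord0 n (f x) j) \<in> borel_measurable M" "(\<lambda>x. coord1 n (f x) j) \<in> borel_measurable M"
    "(\<lambda>x. coord2 n (f x) j) \<in> borel_measurable M"
  unfolding coord0_def coord1_def coord2_def by measurable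

lemma poly_coeff_poly: "poly (coeff_poly n b) z = (\<Sum>j\<le>n. b j * coord0 n z j)"
  by (simp add: coeff_poly_def poly_sum poly_monom coord0_def mult.assoc)

lemma pderiv_sum: "pderiv (sum f A) = (\<Sum>i\<in>A. pderiv (f i))"
  by (rule higher_pderiv_sum[of 1, simplified])

lemma poly_pderiv_coeff_poly: "poly (pderiv (coeff_poly n b)) z = (\<Sum>j\<le>n. b j * coord1 n z j)"
  by (simp add: coeff_poly_def pderiv_sum poly_sum pderiv_monom poly_monom coord1_def mult_ac)

text \<open>The polynomial q of the decomposition of p.\<close>

definition tail_poly :: "nat \<Rightarrow> (nat \<Rightarrow> complex) \<Rightarrow> complex poly" where
  "tail_poly n b = (\<Sum>j\<in>{2..n}. monom (b j * of_real (sqrt (real (n choose j)))) j)"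

lemma poly_tail_poly: "poly (tail_poly n b) z = (\<Sum>j\<in>{2..n}. b j * coord0 n z j)"
  by (simp add: tail_poly_def poly_sum poly_monom coord0_def mult.assoc)

lemma poly_pderiv_tail_poly: "poly (pderiv (tail_poly n b)) z = (\<Sum>j\<in>{2..n}. b j * coord1 n z j)"
  by (simp add: tail_poly_def pderiv_sum poly_sum pderiv_monom poly_monom coord1_def mult_ac)

lemma poly_pderiv2_tail_poly: "poly (pderiv (pderiv (tail_poly n b))) z = (\<Sum>j\<in>{2..n}. b j * coord2 n z j)"
proof -
  have "poly (pderiv (pderiv (monom (b j * of_real (sqrt (real (n choose j)))) j))) z = b j * coord2 n z j" for j
    by (cases j) (simp_all add: pderiv_monom poly_monom coord2_def mult_ac numeral_2_eq_2)
  then show ?thesis by (simp add: tail_poly_def pderiv_sum poly_sum)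
qed

lemma sum_atMost_split:
  fixes f :: "nat \<Rightarrow> complex"
  assumes "n \<ge> 2"
  shows "(\<Sum>j\<le>n. f j) = f 0 + f 1 + (\<Sum>j\<in>{2..n}. f j)"
proof -
  have "{..n} = insert 0 (insert 1 {2..n})" using assms by auto
  then show ?thesis by (simp add: add_ac)
qed

definition critical_sum :: "nat \<Rightarrow> (complex \<Rightarrow> real) \<Rightarrow> (nat \<Rightarrow> complex) \<Rightarrow> real" where
  "critical_sum n \<phi> b = (\<Sum>z | poly (pderiv (coeff_poly n b)) z = 0. \<phi> (poly (coeff_poly n b) z))"

text \<open>Makes the event of infinitely many critical points measurable.\<close>

lemma pderiv_coeff_poly_eq_0_iff:
  "pderiv (coeff_poly n b) = 0 \<longleftrightarrow> (\<forall>j\<in>{1..n}. b j = 0)"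
proof
  assume "pderiv (coeff_poly n b) = 0"
  then have "degree (coeff_poly n b) = 0" by (simp add: pderiv_eq_0_iff)
  show "\<forall>j\<in>{1..n}. b j = 0"
  proof
    fix j assume j: "j \<in> {1..n}"
    have "coeff (coeff_poly n b) j = 0"
      using j \<open>degree (coeff_poly n b) = 0\<close> by (intro coeff_eq_0) auto
    moreover have "coeff (coeff_poly n b) j = b j * of_real (sqrt (real (n choose j)))"
      using j by (simp add: coeff_poly_def coeff_sum coeff_monom)
    ultimately show "b j = 0" using j by simp
  qed
next
  assume *: "\<forall>j\<in>{1..n}. b j = 0"
  have "b j * coord1 n z j = 0" if "j \<le> n" for z j
    using * that by (cases "j = 0") (auto simp: coord1_def)
  then have "poly (pderiv (coeff_poly n b)) z = 0" for z
    unfolding poly_pderiv_coeff_poly by (intro sum.neutral) auto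
  then show "pderiv (coeff_poly n b) = 0" using poly_all_0_iff_0 by blast
qed

lemma borel_measurable_critical_sum:
  assumes \<phi>: "continuous_on UNIV \<phi>"
  shows "critical_sum n \<phi> \<in> borel_measurable (Pi\<^sub>M {..n} (\<lambda>_. borel))"
proof -
  have [measurable]: "\<phi> \<in> borel_measurable borel" using \<phi> by (rule borel_measurable_continuous_onI)
  have "(\<lambda>b. \<Sum>z | poly (pderiv (coeff_poly n b)) z = 0. \<phi> (poly (coeff_poly n b) z))
      \<in> borel_measurable (Pi\<^sub>M {..n} (\<lambda>_. borel))"
  proof (rule borel_measurable_sum_zeros)
    show "(\<lambda>b. poly (pderiv (coeff_poly n b)) z) \<in> borel_measurable (Pi\<^sub>M {..n} (\<lambda>_. borel))" for z
      unfolding poly_pderiv_coeff_poly by measurable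
    show "(\<lambda>b. \<phi> (poly (coeff_poly n b) z)) \<in> borel_measurable (Pi\<^sub>M {..n} (\<lambda>_. borel))" for z
      unfolding poly_coeff_poly by measurable
    show "continuous_on UNIV (\<lambda>z. \<phi> (poly (coeff_poly n b) z))" for b
      by (rule continuous_on_compose2[OF \<phi>]) (auto intro!: continuous_intros)
    show "{b \<in> space (Pi\<^sub>M {..n} (\<lambda>_. borel)). finite {z. poly (pderiv (coeff_poly n b)) z = 0}}
        \<in> sets (Pi\<^sub>M {..n} (\<lambda>_. borel))"
    proof -
      have "finite {z. poly (pderiv (coeff_poly n b)) z = 0} \<longleftrightarrow> \<not> (\<forall>j\<in>{1..n}. b j = 0)" for b
      proof (cases "pderiv (coeff_poly n b) = 0")
        case True
        then have "{z. poly (pderiv (coeff_poly n b)) z = 0} = UNIV" by simp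
        then show ?thesis using True pderiv_coeff_poly_eq_0_iff[of n b] by (simp add: infinite_UNIV_char_0)
      next
        case False
        then show ?thesis using poly_roots_finite[OF False] pderiv_coeff_poly_eq_0_iff[of n b] by simp
      qed
      then show ?thesis by simp
    qed
  qed (auto intro!: continuous_intros)
  then show ?thesis by (simp add: critical_sum_def[abs_def])
qed

text \<open>The coefficient \<open>w\<close> of \<open>z\<close> is a function of the critical point \<open>z\<close> and of the higher
  coefficients, so integrating over \<open>w\<close> turns the sum over critical points into an integral
  over \<open>z\<close>.\<close>

lemma critical_sum_area_formula:
  fixes b :: "nat \<Rightarrow> complex"
  assumes n: "n \<ge> 2" and \<phi>: "continuous_on UNIV \<phi>" "\<And>x. \<phi> x \<ge> 0"
  shows "(\<integral>\<^sup>+w. ennreal (exp (- (norm w)\<^sup>2) / pi) * ennreal (critical_sum n \<phi> (b(0 := a0, 1 := w))) \<partial>lborel)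
    = (\<integral>\<^sup>+z. ennreal (exp (- (norm (\<Sum>j\<in>{2..n}. b j * coord1 n z j))\<^sup>2 / real n) / pi *
          (norm (\<Sum>j\<in>{2..n}. b j * coord2 n z j))\<^sup>2 / real n *
          \<phi> (a0 - z * (\<Sum>j\<in>{2..n}. b j * coord1 n z j) + (\<Sum>j\<in>{2..n}. b j * coord0 n z j))) \<partial>lborel)"
proof -
  have [measurable]: "\<phi> \<in> borel_measurable borel" using \<phi>(1) by (rule borel_measurable_continuous_onI)
  define q where "q = tail_poly n b"
  define sn where "sn = complex_of_real (sqrt (real n))"
  have sn: "sn \<noteq> 0" using n by (simp add: sn_def)
  have nsn: "(norm sn)\<^sup>2 = real n" by (simp add: sn_def)
  \<comment> \<open>Chosen so that z is critical iff g(z) = w.\<close>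
  define g where "g = smult (- 1 / sn) (pderiv q)"
  have gz: "poly g z = - poly (pderiv q) z / sn" for z by (simp add: g_def)
  have g'z: "poly (pderiv g) z = - poly (pderiv (pderiv q)) z / sn" for z by (simp add: g_def pderiv_smult pderiv_minus)
  define F where "F = (\<lambda>z. ennreal (exp (- (norm (poly g z))\<^sup>2) / pi * \<phi> (a0 - z * poly (pderiv q) z + poly q z)))"
  have [measurable]: "(\<lambda>z. poly r z) \<in> borel_measurable borel" for r :: "complex poly"
    by (intro borel_measurable_continuous_onI continuous_intros)
  have F [measurable]: "F \<in> borel_measurable borel" unfolding F_def by measurable
  have "ennreal (exp (- (norm w)\<^sup>2) / pi) * ennreal (critical_sum n \<phi> (b(0 := a0, 1 := w)))
     = (\<Sum>z | poly g z = w. F z)" for w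
  proof -
    define B where "B = b(0 := a0, 1 := w)"
    have tail: "(\<Sum>j\<in>{2..n}. B j * v j) = (\<Sum>j\<in>{2..n}. b j * v j)" for v
      by (intro sum.cong) (auto simp: B_def)
    have B0: "B 0 = a0" "B 1 = w" by (auto simp: B_def)
    have c: "coord1 n z 0 = 0" "coord1 n z 1 = sn" "coord0 n z 0 = 1" "coord0 n z 1 = sn * z" for z
      by (auto simp: coord1_def coord0_def sn_def)
    have p1: "poly (pderiv (coeff_poly n B)) z = w * sn + poly (pderiv q) z" for z
      unfolding poly_pderiv_coeff_poly sum_atMost_split[OF n] tail c B0 q_def poly_pderiv_tail_poly by simp
    have p0: "poly (coeff_poly n B) z = a0 + w * (sn * z) + poly q z" for z
      unfolding poly_coeff_poly sum_atMost_split[OF n] tail c B0 q_def poly_tail_poly by simp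
    have iff: "poly (pderiv (coeff_poly n B)) z = 0 \<longleftrightarrow> poly g z = w" for z
    proof -
      have "poly g z = w \<longleftrightarrow> - poly (pderiv q) z = w * sn"
        unfolding gz by (subst divide_eq_eq) (simp add: sn)
      also have "\<dots> \<longleftrightarrow> poly (pderiv q) z + w * sn = 0" by (rule neg_eq_iff_add_eq_0)
      finally show ?thesis unfolding p1 by (simp only: add.commute)
    qed
    \<comment> \<open>At a critical point w can be eliminated from p(z), so the critical value
      becomes a function of z and of the other coefficients.\<close>
    have val: "poly (coeff_poly n B) z = a0 - z * poly (pderiv q) z + poly q z" if "poly g z = w" for z
      unfolding p0 that[symmetric] gz using sn by simp
    have "critical_sum n \<phi> B = (\<Sum>z | poly g z = w. \<phi> (a0 - z * poly (pderiv q) z + poly q z))"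
      unfolding critical_sum_def iff by (intro sum.cong) (auto simp: val)
    then have "ennreal (exp (- (norm w)\<^sup>2) / pi) * ennreal (critical_sum n \<phi> B)
       = (\<Sum>z | poly g z = w. ennreal (exp (- (norm w)\<^sup>2) / pi * \<phi> (a0 - z * poly (pderiv q) z + poly q z)))"
      using \<phi>(2) by (simp add: ennreal_mult'[symmetric] sum_distrib_left sum_nonneg)
    then show ?thesis unfolding B_def F_def by simp
  qed
  then have "(\<integral>\<^sup>+w. ennreal (exp (- (norm w)\<^sup>2) / pi) * ennreal (critical_sum n \<phi> (b(0 := a0, 1 := w))) \<partial>lborel)
     = (\<integral>\<^sup>+w. (\<Sum>z | poly g z = w. F z) \<partial>lborel)" by simp
  also have "\<dots> = (\<integral>\<^sup>+z. F z * ennreal ((norm (poly (pderiv g) z))\<^sup>2) \<partial>lborel)"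
    by (rule poly_area_formula[OF F])
  also have "\<dots> = (\<integral>\<^sup>+z. ennreal (exp (- (norm (poly (pderiv q) z))\<^sup>2 / real n) / pi *
          (norm (poly (pderiv (pderiv q)) z))\<^sup>2 / real n * \<phi> (a0 - z * poly (pderiv q) z + poly q z)) \<partial>lborel)"
    unfolding F_def gz g'z using \<phi>(2)
    by (intro nn_integral_cong, subst ennreal_mult[symmetric])
       (auto simp: norm_divide power_divide nsn intro!: arg_cong[where f = ennreal])
  finally show ?thesis
    unfolding q_def poly_tail_poly poly_pderiv_tail_poly poly_pderiv2_tail_poly .
qed

lemma sigma_finite_PiM_std_gauss: "sigma_finite_measure (Pi\<^sub>M {2..n::nat} (\<lambda>_. std_gauss))"
  by (rule std_gauss_product.sigma_finite) simp

text \<open>Tonelli arranges the integrations: the area formula trades \<open>a\<^sub>1\<close> for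
  z, a translation trades \<open>a\<^sub>0\<close> for the critical value x, and the remaining
  coefficients are then integrated for fixed z and x. Nonnegativity of \<phi> permits every exchange
  without an integrability check.\<close>

lemma nn_integral_critical_sum:
  assumes n: "n \<ge> 4" and \<phi>: "continuous_on UNIV \<phi>" "\<And>x. \<phi> x \<ge> 0"
  shows "(\<integral>\<^sup>+b. ennreal (critical_sum n \<phi> b) \<partial>Pi\<^sub>M {..n} (\<lambda>_. std_gauss))
    = (\<integral>\<^sup>+x. ennreal (\<phi> x * (critical_integral n ((norm x)\<^sup>2) / pi)) \<partial>lborel)"
proof -
  let ?P = "Pi\<^sub>M {2..n} (\<lambda>_. std_gauss)"
  have n2: "n \<ge> 2" using n by simp
  have [measurable]: "\<phi> \<in> borel_measurable borel" using \<phi>(1) by (rule borel_measurable_continuous_onI)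
  interpret P: sigma_finite_measure ?P by (rule sigma_finite_PiM_std_gauss)
  interpret PL: pair_sigma_finite ?P "lborel :: complex measure" ..
  have setsP: "sets (Pi\<^sub>M I (\<lambda>_. std_gauss)) = sets (Pi\<^sub>M I (\<lambda>_. borel))" for I :: "nat set"
    by (intro sets_PiM_cong) auto
  have cs: "(\<lambda>b. ennreal (critical_sum n \<phi> b)) \<in> borel_measurable (Pi\<^sub>M {..n} (\<lambda>_. std_gauss))"
    using borel_measurable_critical_sum[OF \<phi>(1), of n] by (simp cong: measurable_cong_sets add: measurable_cong_sets[OF setsP refl])
  define S0 where "S0 = (\<lambda>b z. \<Sum>j\<in>{2..n}. b j * coord0 n z j)"
  define S1 where "S1 = (\<lambda>b z. \<Sum>j\<in>{2..n}. b j * coord1 n z j)"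
  define S2 where "S2 = (\<lambda>b z. \<Sum>j\<in>{2..n}. b j * coord2 n z j)"
  have S_meas [measurable (raw)]:
    "(\<lambda>x. S0 (f x) (g x)) \<in> borel_measurable M" "(\<lambda>x. S1 (f x) (g x)) \<in> borel_measurable M"
    "(\<lambda>x. S2 (f x) (g x)) \<in> borel_measurable M"
    if "f \<in> measurable M ?P" "g \<in> borel_measurable M" for f g and M :: "'c measure"
  proof -
    note that(2)[measurable]
    have [measurable]: "(\<lambda>x. f x j) \<in> borel_measurable M" if "j \<in> {2..n}" for j
      using measurable_compose[OF \<open>f \<in> measurable M ?P\<close> measurable_component_singleton[OF that]]
      unfolding measurable_cong_sets[OF refl sets_std_gauss] .
    show "(\<lambda>x. S0 (f x) (g x)) \<in> borel_measurable M" "(\<lambda>x. S1 (f x) (g x)) \<in> borel_measurable M"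
      "(\<lambda>x. S2 (f x) (g x)) \<in> borel_measurable M"
      unfolding S0_def S1_def S2_def by (intro borel_measurable_sum borel_measurable_times; measurable)+
  qed
  define K where "K = (\<lambda>b z x. ennreal (\<phi> x) *
      ennreal (gauss_weight (real n) z 1 0 0 0 (x - S0 b z) (- S1 b z) (S2 b z)))"
  have gw: "(\<lambda>x. gauss_weight (real n) (f x) 1 0 0 0 (g x) (h x) (k x)) \<in> borel_measurable M"
    if [measurable]: "f \<in> borel_measurable M" "g \<in> borel_measurable M" "h \<in> borel_measurable M" "k \<in> borel_measurable M"
    for f g h k and M :: "'c measure"
    unfolding gauss_weight_def by measurable
  note gw[measurable (raw)]
  \<comment> \<open>Index 1 is inserted last, which makes \<open>a\<^sub>1\<close> the innermost
    variable.\<close>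
  have ins: "{..n} = insert 1 (insert 0 {2..n})" using n by auto
  have "(\<integral>\<^sup>+b. ennreal (critical_sum n \<phi> b) \<partial>Pi\<^sub>M {..n} (\<lambda>_. std_gauss))
    = (\<integral>\<^sup>+b. \<integral>\<^sup>+w. ennreal (critical_sum n \<phi> (b(1 := w))) \<partial>std_gauss \<partial>Pi\<^sub>M (insert 0 {2..n}) (\<lambda>_. std_gauss))"
    using cs unfolding ins by (intro std_gauss_product.product_nn_integral_insert) auto
  also have "\<dots> = (\<integral>\<^sup>+b. \<integral>\<^sup>+a0. \<integral>\<^sup>+w. ennreal (critical_sum n \<phi> (b(0 := a0, 1 := w))) \<partial>std_gauss \<partial>std_gauss \<partial>?P)"
  proof (rule std_gauss_product.product_nn_integral_insert)
    have "(\<lambda>(b, w). b(1 := w)) \<in> measurable (Pi\<^sub>M (insert 0 {2..n}) (\<lambda>_. std_gauss) \<Otimes>\<^sub>M std_gauss)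
        (Pi\<^sub>M (insert 1 (insert 0 {2..n})) (\<lambda>_. std_gauss))"
      by (rule measurable_add_dim)
    from measurable_compose[OF this cs[unfolded ins]]
    have "(\<lambda>(b, w). ennreal (critical_sum n \<phi> (b(1 := w)))) \<in> borel_measurable (Pi\<^sub>M (insert 0 {2..n}) (\<lambda>_. std_gauss) \<Otimes>\<^sub>M std_gauss)"
      by (simp add: case_prod_unfold)
    then show "(\<lambda>b. \<integral>\<^sup>+w. ennreal (critical_sum n \<phi> (b(1 := w))) \<partial>std_gauss)
        \<in> borel_measurable (Pi\<^sub>M (insert 0 {2..n}) (\<lambda>_. std_gauss))"
      by (rule std_gauss.borel_measurable_nn_integral)
  qed auto
  also have "\<dots> = (\<integral>\<^sup>+b. \<integral>\<^sup>+z. \<integral>\<^sup>+x. K b z x \<partial>lborel \<partial>lborel \<partial>?P)"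
  proof (rule nn_integral_cong)
    fix b assume b: "b \<in> space ?P"
    have meas [measurable]: "S0 b \<in> borel_measurable borel" "S1 b \<in> borel_measurable borel" "S2 b \<in> borel_measurable borel"
      unfolding S0_def S1_def S2_def by measurable
    define h where "h = (\<lambda>z. exp (- (norm (S1 b z))\<^sup>2 / real n) / pi * (norm (S2 b z))\<^sup>2 / real n)"
    have h0: "h z \<ge> 0" for z by (simp add: h_def)
    have [measurable]: "h \<in> borel_measurable borel" unfolding h_def by measurable
    have inner: "(\<integral>\<^sup>+w. ennreal (critical_sum n \<phi> (b(0 := a0, 1 := w))) \<partial>std_gauss)
       = (\<integral>\<^sup>+z. ennreal (h z * \<phi> (a0 - z * S1 b z + S0 b z)) \<partial>lborel)" for a0
    proof -
      have b0: "b(0 := a0) \<in> space (Pi\<^sub>M (insert 0 {2..n}) (\<lambda>_. std_gauss))"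
        using b by (auto simp: space_PiM PiE_iff extensional_def)
      have "(\<lambda>w. ennreal (critical_sum n \<phi> ((b(0 := a0))(1 := w)))) \<in> borel_measurable std_gauss"
        using measurable_compose[OF measurable_component_update[OF b0, of 1] cs[unfolded ins]] by simp
      then have "(\<lambda>w. ennreal (critical_sum n \<phi> (b(0 := a0, 1 := w)))) \<in> borel_measurable borel"
        by (simp cong: measurable_cong_sets)
      from nn_integral_std_gauss[OF this] show ?thesis
        unfolding critical_sum_area_formula[OF n2 \<phi>] h_def S0_def S1_def S2_def .
    qed
    have "(\<integral>\<^sup>+a0. \<integral>\<^sup>+w. ennreal (critical_sum n \<phi> (b(0 := a0, 1 := w))) \<partial>std_gauss \<partial>std_gauss)
       = (\<integral>\<^sup>+a0. ennreal (exp (- (norm a0)\<^sup>2) / pi) * (\<integral>\<^sup>+z. ennreal (h z * \<phi> (a0 - z * S1 b z + S0 b z)) \<partial>lborel) \<partial>lborel)"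
      unfolding inner by (rule nn_integral_std_gauss) measurable
    also have "\<dots> = (\<integral>\<^sup>+a0. \<integral>\<^sup>+z. ennreal (exp (- (norm a0)\<^sup>2) / pi * h z * \<phi> (a0 - z * S1 b z + S0 b z)) \<partial>lborel \<partial>lborel)"
      using \<phi>(2) h0 by (intro nn_integral_cong, subst nn_integral_cmult[symmetric])
        (auto simp: ennreal_mult'[symmetric] mult.assoc)
    also have "\<dots> = (\<integral>\<^sup>+z. \<integral>\<^sup>+a0. ennreal (exp (- (norm a0)\<^sup>2) / pi * h z * \<phi> (a0 - z * S1 b z + S0 b z)) \<partial>lborel \<partial>lborel)"
      by (rule lborel_pair.Fubini') measurable
    also have "\<dots> = (\<integral>\<^sup>+z. \<integral>\<^sup>+x. K b z x \<partial>lborel \<partial>lborel)"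
    proof (rule nn_integral_cong)
      fix z :: complex
      \<comment> \<open>The critical value is \<open>a\<^sub>0\<close> - e, so the translation
        \<open>a\<^sub>0\<close> = e + x makes it x.\<close>
      define e where "e = z * S1 b z - S0 b z"
      have "(\<integral>\<^sup>+a0. ennreal (exp (- (norm a0)\<^sup>2) / pi * h z * \<phi> (a0 - z * S1 b z + S0 b z)) \<partial>lborel)
        = (\<integral>\<^sup>+x. ennreal (exp (- (norm (e + x))\<^sup>2) / pi * h z * \<phi> ((e + x) - z * S1 b z + S0 b z)) \<partial>lborel)"
        by (subst nn_integral_lborel_shift) auto
      also have "\<dots> = (\<integral>\<^sup>+x. K b z x \<partial>lborel)"
      proof (rule nn_integral_cong)
        fix x
        have 1: "(e + x) - z * S1 b z + S0 b z = x" by (simp add: e_def)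
        have 2: "x - S0 b z - z * (- S1 b z) = e + x" by (simp add: e_def)
        have "exp (- (norm (e + x))\<^sup>2) / pi * h z = gauss_weight (real n) z 1 0 0 0 (x - S0 b z) (- S1 b z) (S2 b z)"
          unfolding gauss_weight_def 2 h_def
          by (simp add: exp_diff exp_minus field_simps power2_eq_square)
        then show "ennreal (exp (- (norm (e + x))\<^sup>2) / pi * h z * \<phi> ((e + x) - z * S1 b z + S0 b z)) = K b z x"
          unfolding 1 K_def using \<phi>(2) by (subst ennreal_mult'[symmetric]) (auto simp: mult.commute)
      qed
      finally show "(\<integral>\<^sup>+a0. ennreal (exp (- (norm a0)\<^sup>2) / pi * h z * \<phi> (a0 - z * S1 b z + S0 b z)) \<partial>lborel)
        = (\<integral>\<^sup>+x. K b z x \<partial>lborel)" .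
    qed
    finally show "(\<integral>\<^sup>+a0. \<integral>\<^sup>+w. ennreal (critical_sum n \<phi> (b(0 := a0, 1 := w))) \<partial>std_gauss \<partial>std_gauss)
       = (\<integral>\<^sup>+z. \<integral>\<^sup>+x. K b z x \<partial>lborel \<partial>lborel)" .
  qed
  also have "\<dots> = (\<integral>\<^sup>+z. \<integral>\<^sup>+b. \<integral>\<^sup>+x. K b z x \<partial>lborel \<partial>?P \<partial>lborel)"
    unfolding K_def by (rule PL.Fubini'[symmetric]) measurable
  also have "\<dots> = (\<integral>\<^sup>+z. \<integral>\<^sup>+x. \<integral>\<^sup>+b. K b z x \<partial>?P \<partial>lborel \<partial>lborel)"
    unfolding K_def by (rule nn_integral_cong, rule PL.Fubini'[symmetric]) measurable
  also have "\<dots> = (\<integral>\<^sup>+(z::complex). \<integral>\<^sup>+x. ennreal (\<phi> x) * ennreal (critical_integrand n ((norm x)\<^sup>2) ((norm z)\<^sup>2) / pi\<^sup>2) \<partial>lborel \<partial>lborel)"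
  \<comment> \<open>The covariance computation divides by z; the excluded point is a null
    set.\<close>
  proof (rule nn_integral_cong_AE)
    have "AE z in lborel. z \<notin> {0::complex}"
      by (intro AE_not_in finite_imp_null_set_lborel) simp
    then show "AE z in lborel. (\<integral>\<^sup>+x. \<integral>\<^sup>+b. K b z x \<partial>?P \<partial>lborel)
       = (\<integral>\<^sup>+x. ennreal (\<phi> x) * ennreal (critical_integrand n ((norm x)\<^sup>2) ((norm z)\<^sup>2) / pi\<^sup>2) \<partial>lborel)"
    proof eventually_elim
      case (elim z)
      then have z: "z \<noteq> 0" by simp
      show ?case
      proof (rule nn_integral_cong)
        fix x
        have "(\<integral>\<^sup>+b. K b z x \<partial>?P) = ennreal (\<phi> x) *
           (\<integral>\<^sup>+b. ennreal (gauss_weight (real n) z 1 0 0 0 (x - S0 b z) (- S1 b z) (S2 b z)) \<partial>?P)"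
          unfolding K_def by (rule nn_integral_cmult) measurable
        also have "(\<integral>\<^sup>+b. ennreal (gauss_weight (real n) z 1 0 0 0 (x - S0 b z) (- S1 b z) (S2 b z)) \<partial>?P)
           = ennreal (critical_integrand n ((norm x)\<^sup>2) ((norm z)\<^sup>2) / pi\<^sup>2)"
          unfolding S0_def S1_def S2_def coord0_def coord1_def coord2_def
          by (rule gaussian_critical_weight[OF n z])
        finally show "(\<integral>\<^sup>+b. K b z x \<partial>?P) = ennreal (\<phi> x) * ennreal (critical_integrand n ((norm x)\<^sup>2) ((norm z)\<^sup>2) / pi\<^sup>2)" .
      qed
    qed
  qed
  also have "\<dots> = (\<integral>\<^sup>+x. \<integral>\<^sup>+(z::complex). ennreal (\<phi> x) * ennreal (critical_integrand n ((norm x)\<^sup>2) ((norm z)\<^sup>2) / pi\<^sup>2) \<partial>lborel \<partial>lborel)"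
    by (rule lborel_pair.Fubini') measurable
  also have "\<dots> = (\<integral>\<^sup>+x. ennreal (\<phi> x * (critical_integral n ((norm x)\<^sup>2) / pi)) \<partial>lborel)"
  proof (rule nn_integral_cong)
    fix x :: complex
    have "(\<integral>\<^sup>+(z::complex). ennreal (critical_integrand n ((norm x)\<^sup>2) ((norm z)\<^sup>2) / pi\<^sup>2) \<partial>lborel)
      = (\<integral>\<^sup>+(z::complex). ennreal (1 / pi\<^sup>2) * ennreal (critical_integrand n ((norm x)\<^sup>2) ((norm z)\<^sup>2)) \<partial>lborel)"
      using n by (intro nn_integral_cong, subst ennreal_mult[symmetric]) (auto simp: critical_integrand_nonneg)
    also have "\<dots> = ennreal (1 / pi\<^sup>2) * (ennreal pi * ennreal (critical_integral n ((norm x)\<^sup>2)))"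
      using n by (subst nn_integral_cmult, measurable, subst nn_integral_norm_sq, measurable, subst nn_integral_critical_integrand) auto
    also have "\<dots> = ennreal (critical_integral n ((norm x)\<^sup>2) / pi)"
      by (simp add: ennreal_mult'[symmetric] power2_eq_square)
    finally have "(\<integral>\<^sup>+(z::complex). ennreal (critical_integrand n ((norm x)\<^sup>2) ((norm z)\<^sup>2) / pi\<^sup>2) \<partial>lborel)
       = ennreal (critical_integral n ((norm x)\<^sup>2) / pi)" .
    then show "(\<integral>\<^sup>+(z::complex). ennreal (\<phi> x) * ennreal (critical_integrand n ((norm x)\<^sup>2) ((norm z)\<^sup>2) / pi\<^sup>2) \<partial>lborel)
      = ennreal (\<phi> x * (critical_integral n ((norm x)\<^sup>2) / pi))"
      by (subst nn_integral_cmult, measurable) (simp only: ennreal_mult'[OF \<phi>(2)])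
  qed
  finally show ?thesis .
qed

section \<open>Identification of the expected density\<close>

lemma continuous_critical_integral:
  assumes "n \<ge> 1"
  shows "continuous_on UNIV (\<lambda>x::complex. critical_integral n ((norm x)\<^sup>2) / pi)"
proof -
  have "isCont (\<lambda>x::complex. critical_integral n ((norm x)\<^sup>2)) x" for x
    unfolding continuous_at_sequentially comp_def
  proof (intro allI impI)
    fix u :: "nat \<Rightarrow> complex" assume "u \<longlonglongrightarrow> x"
    then have "(\<lambda>i. (norm (u i))\<^sup>2) \<longlonglongrightarrow> (norm x)\<^sup>2" by (intro tendsto_intros)
    then show "(\<lambda>i. critical_integral n ((norm (u i))\<^sup>2)) \<longlonglongrightarrow> critical_integral n ((norm x)\<^sup>2)"
      by (intro tendsto_critical_integral assms) auto
  qed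
  then show ?thesis by (intro continuous_at_imp_continuous_on ballI continuous_intros) auto
qed

lemma distr_gaussian_coefficients:
  fixes M :: "'a measure" and a :: "nat \<Rightarrow> 'a \<Rightarrow> complex"
  assumes M: "prob_space M" and indep: "prob_space.indep_vars M (\<lambda>_. borel) a UNIV"
    and distr: "\<And>j. distributed M lborel (a j) (\<lambda>z. ennreal (exp (- (norm z)\<^sup>2) / pi))"
  shows "distr M (Pi\<^sub>M {..n} (\<lambda>_. borel)) (\<lambda>\<omega>. \<lambda>j\<in>{..n}. a j \<omega>) = Pi\<^sub>M {..n} (\<lambda>_. std_gauss)"
proof -
  interpret prob_space M by (rule M)
  have rv: "a j \<in> borel_measurable M" for j
    using distr[of j] by (simp add: distributed_def)
  have "indep_vars (\<lambda>_. borel) a {..n}" using indep indep_vars_subset by blast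
  then have "distr M (Pi\<^sub>M {..n} (\<lambda>_. borel)) (\<lambda>\<omega>. \<lambda>j\<in>{..n}. a j \<omega>) = Pi\<^sub>M {..n} (\<lambda>j. distr M borel (a j))"
    using rv by (subst (asm) indep_vars_iff_distr_eq_PiM') auto
  moreover have "distr M borel (a j) = std_gauss" for j
  proof -
    have "distr M borel (a j) = distr M lborel (a j)" by (rule distr_cong) auto
    also have "\<dots> = std_gauss" using distr[of j] by (simp add: distributed_def std_gauss_def)
    finally show ?thesis .
  qed
  ultimately show ?thesis by simp
qed

text \<open>The integral formula covers nonnegative functions, so a test function is split into
  positive and negative parts. These are continuous but in general not smooth, which is why the
  formula is stated for continuous \<phi>.\<close>

lemma is_expected_density_critical_integral:
  fixes M :: "'a measure" and a :: "nat \<Rightarrow> 'a \<Rightarrow> complex"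
  assumes M: "prob_space M" and indep: "prob_space.indep_vars M (\<lambda>_. borel) a UNIV"
    and distr: "\<And>j. distributed M lborel (a j) (\<lambda>z. ennreal (exp (- (norm z)\<^sup>2) / pi))"
    and n: "n \<ge> 4"
  shows "is_expected_density M (SU2_poly a n) (\<lambda>x. critical_integral n ((norm x)\<^sup>2) / pi)"
proof -
  define D where "D = (\<lambda>x::complex. critical_integral n ((norm x)\<^sup>2) / pi)"
  define X where "X = (\<lambda>\<omega>. \<lambda>j\<in>{..n}. a j \<omega>)"
  have rv [measurable]: "a j \<in> borel_measurable M" for j
    using distr[of j] by (simp add: distributed_def)
  have X [measurable]: "X \<in> measurable M (Pi\<^sub>M {..n} (\<lambda>_. borel))"
    unfolding X_def by measurable
  have dX: "distr M (Pi\<^sub>M {..n} (\<lambda>_. borel)) X = Pi\<^sub>M {..n} (\<lambda>_. std_gauss)"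
    unfolding X_def by (rule distr_gaussian_coefficients[OF M indep distr])
  have SU2: "SU2_poly a n \<omega> = coeff_poly n (X \<omega>)" for \<omega>
    by (simp add: SU2_poly_def coeff_poly_def X_def)
  have D0: "D x \<ge> 0" for x using n by (simp add: D_def critical_integral_nonneg)
  have contD: "continuous_on UNIV D" unfolding D_def using n by (intro continuous_critical_integral) simp
  have part: "integrable M (\<lambda>\<omega>. critical_sum n \<psi> (X \<omega>)) \<and>
      (\<integral>\<omega>. critical_sum n \<psi> (X \<omega>) \<partial>M) = (\<integral>x. \<psi> x * D x \<partial>lborel)"
    if cont: "continuous_on UNIV \<psi>" and nonneg: "\<And>x. \<psi> x \<ge> 0" and int: "integrable lborel (\<lambda>x. \<psi> x * D x)" for \<psi>
  proof -
    have cs: "critical_sum n \<psi> \<in> borel_measurable (Pi\<^sub>M {..n} (\<lambda>_. borel))"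
      by (rule borel_measurable_critical_sum[OF cont])
    then have [measurable]: "(\<lambda>\<omega>. critical_sum n \<psi> (X \<omega>)) \<in> borel_measurable M"
      using X by (rule measurable_compose[rotated])
    have cs0: "critical_sum n \<psi> b \<ge> 0" for b using nonneg by (simp add: critical_sum_def sum_nonneg)
    have "(\<integral>\<^sup>+\<omega>. ennreal (critical_sum n \<psi> (X \<omega>)) \<partial>M)
       = (\<integral>\<^sup>+b. ennreal (critical_sum n \<psi> b) \<partial>distr M (Pi\<^sub>M {..n} (\<lambda>_. borel)) X)"
      using cs by (subst nn_integral_distr) auto
    also have "\<dots> = (\<integral>\<^sup>+x. ennreal (\<psi> x * D x) \<partial>lborel)"
      unfolding dX D_def by (rule nn_integral_critical_sum[OF n cont nonneg])
    also have "\<dots> = ennreal (\<integral>x. \<psi> x * D x \<partial>lborel)"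
      using nonneg D0 by (intro nn_integral_eq_integral int) auto
    finally have eq: "(\<integral>\<^sup>+\<omega>. ennreal (critical_sum n \<psi> (X \<omega>)) \<partial>M) = ennreal (\<integral>x. \<psi> x * D x \<partial>lborel)" .
    have nn: "(\<integral>x. \<psi> x * D x \<partial>lborel) \<ge> 0"
      using nonneg D0 by (intro Bochner_Integration.integral_nonneg) auto
    have "integrable M (\<lambda>\<omega>. critical_sum n \<psi> (X \<omega>))"
      using eq nn cs0 by (intro integrableI_nn_integral_finite) auto
    moreover have "(\<integral>\<omega>. critical_sum n \<psi> (X \<omega>) \<partial>M) = (\<integral>x. \<psi> x * D x \<partial>lborel)"
      using eq nn cs0 by (subst integral_eq_nn_integral) auto
    ultimately show ?thesis by blast
  qed
  have "(\<integral>\<omega>. (\<Sum>z | poly (pderiv (SU2_poly a n \<omega>)) z = 0. \<phi> (poly (SU2_poly a n \<omega>) z)) \<partial>M)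
      = (\<integral>x. \<phi> x * D x \<partial>lborel)" if \<phi>: "test_function \<phi>" for \<phi>
  proof -
    have c: "continuous_on UNIV \<phi>" by (rule continuous_test_function[OF \<phi>])
    have [measurable]: "\<phi> \<in> borel_measurable borel" "D \<in> borel_measurable borel"
      using c contD by (auto intro: borel_measurable_continuous_onI)
    have i: "integrable lborel (\<lambda>x. \<phi> x * D x)" by (rule integrable_test_function_mult[OF \<phi> contD])
    define p where "p = (\<lambda>x. max (\<phi> x) 0)"
    define m where "m = (\<lambda>x. max (- \<phi> x) 0)"
    have [measurable]: "p \<in> borel_measurable borel" "m \<in> borel_measurable borel" unfolding p_def m_def by measurable
    have cpm: "continuous_on UNIV p" "continuous_on UNIV m"
      unfolding p_def m_def using c by (auto intro!: continuous_intros)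
    have ip: "integrable lborel (\<lambda>x. p x * D x)"
      by (rule Bochner_Integration.integrable_bound[OF i]) (auto simp: p_def abs_mult intro!: mult_right_mono)
    have im: "integrable lborel (\<lambda>x. m x * D x)"
      by (rule Bochner_Integration.integrable_bound[OF i]) (auto simp: m_def abs_mult intro!: mult_right_mono)
    note P = part[OF cpm(1) _ ip] and N = part[OF cpm(2) _ im]
    have pm: "\<phi> x = p x - m x" for x by (simp add: p_def m_def)
    have "(\<Sum>z | poly (pderiv (SU2_poly a n \<omega>)) z = 0. \<phi> (poly (SU2_poly a n \<omega>) z))
        = critical_sum n p (X \<omega>) - critical_sum n m (X \<omega>)" for \<omega>
      unfolding critical_sum_def SU2 pm by (rule sum_subtractf)
    then have "(\<integral>\<omega>. (\<Sum>z | poly (pderiv (SU2_poly a n \<omega>)) z = 0. \<phi> (poly (SU2_poly a n \<omega>) z)) \<partial>M)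
       = (\<integral>\<omega>. critical_sum n p (X \<omega>) - critical_sum n m (X \<omega>) \<partial>M)" by simp
    also have "\<dots> = (\<integral>x. p x * D x \<partial>lborel) - (\<integral>x. m x * D x \<partial>lborel)"
      using P N by (subst Bochner_Integration.integral_diff) (auto simp: p_def m_def)
    also have "\<dots> = (\<integral>x. p x * D x - m x * D x \<partial>lborel)"
      using ip im by simp
    also have "\<dots> = (\<integral>x. \<phi> x * D x \<partial>lborel)"
      by (simp add: pm left_diff_distrib)
    finally show ?thesis .
  qed
  with contD show ?thesis by (simp add: is_expected_density_def D_def)
qed

theorem theorem1:
  fixes M :: "'a measure" and a :: "nat \<Rightarrow> 'a \<Rightarrow> complex" and x :: complex
  assumes "prob_space M"
    and "prob_space.indep_vars M (\<lambda>_. borel) a UNIV"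
    and "\<And>j. distributed M lborel (a j) (\<lambda>z. ennreal (exp (- (norm z)\<^sup>2) / pi))"
  shows "(\<lambda>n. expected_density M (SU2_poly a n) x
            - ((if x = 0 then 1 else (1 - exp (- (norm x)\<^sup>2)) / (norm x)\<^sup>2) / pi
               + (LBINT s:{0..1}. exp (- (s - s * ln s) * (norm x)\<^sup>2)) / pi))
         \<in> o(\<lambda>_. 1)"
proof -
  define L where "L = (if x = 0 then 1 else (1 - exp (- (norm x)\<^sup>2)) / (norm x)\<^sup>2) / pi
               + (LBINT s:{0..1}. exp (- (s - s * ln s) * (norm x)\<^sup>2)) / pi"
  have "(\<lambda>n. critical_integral n ((norm x)\<^sup>2) / pi)
      \<longlonglongrightarrow> (\<integral>\<tau>. limit_integrand ((norm x)\<^sup>2) \<tau> * indicator {0..} \<tau> \<partial>lborel) / pi"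
    by (intro tendsto_intros critical_integral_limit) auto
  also have "(\<integral>\<tau>. limit_integrand ((norm x)\<^sup>2) \<tau> * indicator {0..} \<tau> \<partial>lborel) / pi = L"
    by (subst integral_limit_integrand) (auto simp: L_def add_divide_distrib)
  finally have "(\<lambda>n. critical_integral n ((norm x)\<^sup>2) / pi - L) \<longlonglongrightarrow> 0"
    by (simp add: LIM_zero)
  \<comment> \<open>The density is identified for n \<ge> 4, which is enough for the limit.\<close>
  moreover have "\<forall>\<^sub>F n in sequentially. critical_integral n ((norm x)\<^sup>2) / pi - L = expected_density M (SU2_poly a n) x - L"
    using eventually_ge_at_top[of 4]
    by eventually_elim (simp add: expected_density_eqI[OF is_expected_density_critical_integral[OF assms]])
  ultimately have "(\<lambda>n. expected_density M (SU2_poly a n) x - L) \<longlonglongrightarrow> 0"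
    by (rule Lim_transform_eventually)
  then show ?thesis
    unfolding L_def by (intro smalloI_tendsto) auto
qed

end
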